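(* Let $\mathbb{U}$ be a unipotent $\mathbb{Q}$-group. Let $\Gamma$ be a finitely generated, Zariski dense subgroup of $\mathbb{U}(\mathbb{Q})$, and let $p,p_1,\ldots,p_m\in\mathbb{Q}[\mathbb{U}]$ be such that $p\neq 0$ and $\gcd(p_1,\ldots,p_m)=1$. Then there are a finite set $S$ of primes and a positive integer $r$ such that $$\{\gamma\in\Gamma : p(\gamma)\text{ has at most } r\text{ prime factors in }\mathbb{Z}_S\text{ and }\gcd(p_1(\gamma),\ldots,p_m(\gamma))\text{ is a unit in }\mathbb{Z}_S\}$$ is Zariski dense in $\mathbb{U}$.
   Context: As a $\mathbb{Q}$-variety $\mathbb{U}$ is isomorphic to affine space (via the exponential map from its Lie algebra), so $\mathbb{Q}[\mathbb{U}]$ is a polynomial ring over $\mathbb{Q}$, and $\gcd$ is taken in this unique factorization domain (up to units). For a finite set $S$ of primes, $\mathbb{Z}_S$ is the ring of $S$-integers (rationals whose denominators have all prime factors in $S$). "$q$ has at most $r$ prime factors in $\mathbb{Z}_S$" means that $q$ is a non-zero element of $\mathbb{Z}_S$ and $\sum_{\ell\notin S} v_\ell(q)\le r$ (prime factors counted with multiplicity). "$\gcd(p_1(\gamma),\ldots,p_m(\gamma))$ is a unit in $\mathbb{Z}_S$" means that all $p_i(\gamma)$ lie in $\mathbb{Z}_S$ and generate the unit ideal of $\mathbb{Z}_S$. *)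

theory Defs
  imports
    "HOL-Analysis.Analysis"
    "HOL-Algebra.Generated_Groups"
    "HOL-Algebra.Divisibility"
    "HOL-Algebra.Ideal"
    "HOL-Computational_Algebra.Primes"
begin

section \<open>Unipotent groups over the rationals\<close>

text \<open>
  Linear algebraic groups are taken in the classical sense: Zariski closed subgroups of
  $\mathrm{GL}_n(\mathbb{C})$, identified with their sets of complex points. The index type
  \<open>'n\<close> carries the dimension $n$.
\<close>

definition GL :: "(complex^'n^'n) monoid"
  where "GL = \<lparr>carrier = {A. invertible A}, mult = (**), one = mat 1\<rparr>"

lemma group_GL: "group (GL :: (complex^'n^'n) monoid)"
proof (rule groupI)
  show "\<exists>B\<in>carrier GL. B \<otimes>\<^bsub>GL\<^esub> A = \<one>\<^bsub>GL\<^esub>" if "A \<in> carrier GL" for A :: "complex^'n^'n"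
    using that by (auto simp: GL_def invertible_def)
qed (auto simp: GL_def invertible_mult matrix_mul_assoc invertible_def[of "mat 1"] intro: exI[of _ "mat 1"])

text \<open>
  \<open>GL_regular K\<close> is $K[x_{ij}, 1/\det]$ for a subfield $K$ of $\mathbb{C}$, as a ring of
  functions. Only the values at invertible matrices matter.
\<close>

inductive_set GL_regular :: "complex set \<Rightarrow> (complex^'n^'n \<Rightarrow> complex) set"
  for K :: "complex set"
  where
    const: "c \<in> K \<Longrightarrow> (\<lambda>_. c) \<in> GL_regular K"
  | entry: "(\<lambda>A. A $ i $ j) \<in> GL_regular K"
  | inv_det: "(\<lambda>A. inverse (det A)) \<in> GL_regular K"
  | add: "f \<in> GL_regular K \<Longrightarrow> g \<in> GL_regular K \<Longrightarrow> (\<lambda>A. f A + g A) \<in> GL_regular K"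
  | mult: "f \<in> GL_regular K \<Longrightarrow> g \<in> GL_regular K \<Longrightarrow> (\<lambda>A. f A * g A) \<in> GL_regular K"

definition zariski_closed_over :: "complex set \<Rightarrow> (complex^'n^'n) set \<Rightarrow> bool"
  where "zariski_closed_over K Z \<longleftrightarrow>
    (\<exists>F \<subseteq> GL_regular K. Z = {A \<in> carrier GL. \<forall>f\<in>F. f A = 0})"

text \<open>The closed subsets of a closed set \<open>U\<close> are the intersections of \<open>U\<close> with closed sets.\<close>

definition zariski_dense_in :: "(complex^'n^'n) set \<Rightarrow> (complex^'n^'n) set \<Rightarrow> bool"
  where "zariski_dense_in X U \<longleftrightarrow>
    X \<subseteq> U \<and> (\<forall>Z. zariski_closed_over UNIV Z \<longrightarrow> X \<subseteq> Z \<longrightarrow> U \<subseteq> Z)"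

definition unipotent :: "complex^'n^'n \<Rightarrow> bool"
  where "unipotent A \<longleftrightarrow> (\<exists>k. (((**) (A - mat 1)) ^^ k) (mat 1) = 0)"

text \<open>
  Zero loci of rational functions are defined over $\mathbb{Q}$ because $\mathbb{Q}$ is perfect.
\<close>

definition unipotent_Q_group :: "(complex^'n^'n) set \<Rightarrow> bool"
  where "unipotent_Q_group U \<longleftrightarrow>
    subgroup U GL \<and> zariski_closed_over \<rat> U \<and> (\<forall>A\<in>U. unipotent A)"

definition rational_points :: "(complex^'n^'n) set \<Rightarrow> (complex^'n^'n) set"
  where "rational_points U = {A \<in> U. \<forall>i j. A $ i $ j \<in> \<rat>}"

definition finitely_generated_subgroup :: "'a set \<Rightarrow> ('a, 'b) monoid_scheme \<Rightarrow> bool"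
  where "finitely_generated_subgroup H G \<longleftrightarrow>
    subgroup H G \<and> (\<exists>X. finite X \<and> X \<subseteq> carrier G \<and> H = generate G X)"


section \<open>The coordinate ring\<close>

text \<open>
  $\mathbb{Q}[U]$ consists of restrictions to \<open>U\<close>; \<open>restrict\<close> makes functions that agree on \<open>U\<close>
  equal.
\<close>

definition Q_coord_ring :: "(complex^'n^'n) set \<Rightarrow> (complex^'n^'n \<Rightarrow> complex) ring"
  where "Q_coord_ring U =
    \<lparr>carrier = (\<lambda>f. restrict f U) ` GL_regular \<rat>,
     mult = (\<lambda>f g. \<lambda>A\<in>U. f A * g A),
     one = (\<lambda>A\<in>U. 1),
     zero = (\<lambda>A\<in>U. 0),
     add = (\<lambda>f g. \<lambda>A\<in>U. f A + g A)\<rparr>"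

lemma cring_Q_coord_ring: "cring (Q_coord_ring U)"
proof -
  let ?C = "carrier (Q_coord_ring U)"
  have carrierI: "restrict f U \<in> ?C" if "f \<in> GL_regular \<rat>" for f
    using that by (auto simp: Q_coord_ring_def)
  have const: "(\<lambda>A\<in>U. c) \<in> ?C" if "c \<in> \<rat>" for c
    using that by (intro carrierI GL_regular.const)
  have closed: "(\<lambda>A\<in>U. x A + y A) \<in> ?C" "(\<lambda>A\<in>U. x A * y A) \<in> ?C"
    if "x \<in> ?C" "y \<in> ?C" for x y
  proof -
    from that obtain f g where fg: "x = restrict f U" "y = restrict g U"
      "f \<in> GL_regular \<rat>" "g \<in> GL_regular \<rat>"
      by (auto simp: Q_coord_ring_def)
    have "(\<lambda>A\<in>U. x A + y A) = (\<lambda>A\<in>U. f A + g A)" "(\<lambda>A\<in>U. x A * y A) = (\<lambda>A\<in>U. f A * g A)"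
      using fg by (auto simp: fun_eq_iff)
    then show "(\<lambda>A\<in>U. x A + y A) \<in> ?C" "(\<lambda>A\<in>U. x A * y A) \<in> ?C"
      using fg by (simp_all add: carrierI GL_regular.add GL_regular.mult)
  qed
  have ext: "x = restrict x U" if "x \<in> ?C" for x
    using that by (auto simp: Q_coord_ring_def)
  have ops: "x \<otimes>\<^bsub>Q_coord_ring U\<^esub> y = (\<lambda>A\<in>U. x A * y A)" "x \<oplus>\<^bsub>Q_coord_ring U\<^esub> y = (\<lambda>A\<in>U. x A + y A)"
    "\<one>\<^bsub>Q_coord_ring U\<^esub> = (\<lambda>A\<in>U. 1)" "\<zero>\<^bsub>Q_coord_ring U\<^esub> = (\<lambda>A\<in>U. 0)" for x y
    by (simp_all add: Q_coord_ring_def)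
  have unit: "(\<lambda>A\<in>U. x A) = x" if "x \<in> ?C" for x
    using ext[OF that] by simp
  have neg: "\<exists>y\<in>?C. y \<oplus>\<^bsub>Q_coord_ring U\<^esub> x = \<zero>\<^bsub>Q_coord_ring U\<^esub>" if "x \<in> ?C" for x
    by (rule bexI[OF _ closed(2)[OF const[of "-1"] that]]) (auto simp: ops fun_eq_iff)
  show ?thesis
  proof (intro cringI abelian_groupI comm_monoidI)
    show "\<exists>y\<in>?C. y \<oplus>\<^bsub>Q_coord_ring U\<^esub> x = \<zero>\<^bsub>Q_coord_ring U\<^esub>" if "x \<in> ?C" for x
      using that by (rule neg)
  qed (auto simp: ops closed const unit algebra_simps cong: restrict_cong)
qed

text \<open>
  \<open>d\<close> is a greatest common divisor of the set \<open>P\<close>, i.e. an infimum for divisibility; it is unique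
  only up to units.
\<close>

definition is_gcd_of :: "('a, 'b) monoid_scheme \<Rightarrow> 'a \<Rightarrow> 'a set \<Rightarrow> bool"
  where "is_gcd_of R d P \<longleftrightarrow> greatest (division_rel R) d (Lower (division_rel R) P)"

lemma is_gcd_of_iff:
  assumes "P \<subseteq> carrier R"
  shows "is_gcd_of R d P \<longleftrightarrow>
    d \<in> carrier R \<and> (\<forall>x\<in>P. d divides\<^bsub>R\<^esub> x) \<and>
    (\<forall>e\<in>carrier R. (\<forall>x\<in>P. e divides\<^bsub>R\<^esub> x) \<longrightarrow> e divides\<^bsub>R\<^esub> d)"
proof -
  have "P \<inter> carrier R = P"
    using assms by blast
  then show ?thesis
    by (auto simp: is_gcd_of_def greatest_def Lower_def)
qed

text \<open>Elements of $\mathbb{Q}[U]$ take rational values at the rational points.\<close>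

definition to_rat :: "complex \<Rightarrow> rat"
  where "to_rat = the_inv of_rat"

lemma of_rat_to_rat:
  assumes "z \<in> \<rat>"
  shows "of_rat (to_rat z) = z"
  using assms by (auto elim!: Rats_cases simp: to_rat_def the_inv_f_f inj_on_def)

lemma det_in_Rats:
  fixes A :: "complex^'n^'n"
  assumes "\<And>i j. A $ i $ j \<in> \<rat>"
  shows "det A \<in> \<rat>"
proof -
  have "(\<Prod>i\<in>I. A $ i $ \<sigma> i) \<in> \<rat>" for I \<sigma>
    using assms by (induction I rule: infinite_finite_induct) auto
  then show ?thesis
    unfolding det_def by (intro Rats_sum Rats_mult) auto
qed

lemma Q_coord_ring_value_in_Rats:
  assumes "f \<in> carrier (Q_coord_ring U)" and "A \<in> rational_points U"
  shows "f A \<in> \<rat>"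
proof -
  have "g A \<in> \<rat>" if "g \<in> GL_regular \<rat>" for g
    using that assms(2) by induction (auto simp: rational_points_def intro: det_in_Rats)
  then show ?thesis
    using assms by (auto simp: Q_coord_ring_def rational_points_def)
qed


section \<open>S-integers\<close>

definition S_integers :: "nat set \<Rightarrow> rat set"
  where "S_integers S =
    {q. \<forall>l. Factorial_Ring.prime l \<and> int l dvd snd (quotient_of q) \<longrightarrow> l \<in> S}"

definition S_integer_ring :: "nat set \<Rightarrow> rat ring"
  where "S_integer_ring S =
    \<lparr>carrier = S_integers S, mult = (*), one = 1, zero = 0, add = (+)\<rparr>"

lemma S_integersI:
  assumes "q = of_int a / of_int b" "b \<noteq> 0"
    and "\<And>l. Factorial_Ring.prime l \<Longrightarrow> int l dvd b \<Longrightarrow> l \<in> S"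
  shows "q \<in> S_integers S"
proof -
  obtain n d where nd: "quotient_of q = (n, d)"
    by fastforce
  then have q: "q = of_int n / of_int d" and "d > 0" "coprime n d"
    by (simp_all add: quotient_of_div quotient_of_denom_pos quotient_of_coprime)
  from q assms(1,2) \<open>d > 0\<close> have "(of_int (n * b) :: rat) = of_int (a * d)"
    by (simp add: frac_eq_eq)
  then have "n * b = a * d"
    by (simp only: of_int_eq_iff)
  then have "d dvd n * b"
    by simp
  then have "d dvd b"
    using \<open>coprime n d\<close> by (simp add: coprime_dvd_mult_right_iff coprime_commute)
  then show ?thesis
    using assms(3) by (auto simp: S_integers_def nd intro: dvd_trans)
qed

lemma S_integersE:
  assumes "q \<in> S_integers S"
  obtains a b where "q = of_int a / of_int b" "b > 0"
    "\<And>l. Factorial_Ring.prime l \<Longrightarrow> int l dvd b \<Longrightarrow> l \<in> S"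
proof -
  obtain n d where nd: "quotient_of q = (n, d)"
    by fastforce
  show thesis
  proof (rule that)
    show "q = of_int n / of_int d" "d > 0"
      using nd by (simp_all add: quotient_of_div quotient_of_denom_pos)
    show "l \<in> S" if "Factorial_Ring.prime l" "int l dvd d" for l
      using assms that nd by (simp add: S_integers_def)
  qed
qed

lemma cring_S_integer_ring: "cring (S_integer_ring S)"
proof -
  have int: "of_int k \<in> S_integers S" for k
    by (rule S_integersI[of _ k 1]) (auto simp: prime_nat_iff)
  have closed: "x + y \<in> S_integers S" "x * y \<in> S_integers S"
    if xy: "x \<in> S_integers S" "y \<in> S_integers S" for x y
  proof -
    from xy(1) obtain a b where x: "x = of_int a / of_int b" "b > 0"
      "\<And>l. Factorial_Ring.prime l \<Longrightarrow> int l dvd b \<Longrightarrow> l \<in> S"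
      by (rule S_integersE) blast
    from xy(2) obtain c d where y: "y = of_int c / of_int d" "d > 0"
      "\<And>l. Factorial_Ring.prime l \<Longrightarrow> int l dvd d \<Longrightarrow> l \<in> S"
      by (rule S_integersE) blast
    have bd: "l \<in> S" if "Factorial_Ring.prime l" "int l dvd b * d" for l
      using that x(3) y(3) by (auto simp: prime_dvd_mult_iff)
    show "x + y \<in> S_integers S"
      by (rule S_integersI[of _ "a * d + c * b" "b * d"]) (use x y bd in \<open>auto simp: field_simps\<close>)
    show "x * y \<in> S_integers S"
      by (rule S_integersI[of _ "a * c" "b * d"]) (use x y bd in auto)
  qed
  have neg: "- x \<in> S_integers S" if "x \<in> S_integers S" for x
    using closed(2)[OF int[of "-1"] that] by simp
  show ?thesis
    using int[of 0] int[of 1] closed neg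
    by (intro cringI abelian_groupI comm_monoidI)
      (auto simp: S_integer_ring_def algebra_simps intro!: bexI[of _ "- x" for x])
qed

definition rat_valuation :: "nat \<Rightarrow> rat \<Rightarrow> int"
  where "rat_valuation l q =
    int (multiplicity (int l) (fst (quotient_of q))) -
    int (multiplicity (int l) (snd (quotient_of q)))"

lemma finite_rat_valuation_support:
  assumes "q \<noteq> 0"
  shows "finite {l. Factorial_Ring.prime l \<and> rat_valuation l q \<noteq> 0}"
proof -
  define a b where "a = fst (quotient_of q)" and "b = snd (quotient_of q)"
  have "a \<noteq> 0"
    using assms quotient_of_div[of q a b] by (auto simp: a_def b_def)
  moreover have "b > 0"
    by (simp add: b_def quotient_of_denom_pos')
  ultimately have fin: "finite {l. int l dvd a * b}"
    using finite_imageD[of int "{l. int l dvd a * b}"]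
      finite_subset[of "int ` {l. int l dvd a * b}" "{d. d dvd a * b}"]
    by (force simp: inj_on_def)
  have "int l dvd a * b" if "rat_valuation l q \<noteq> 0" for l
  proof (rule ccontr)
    assume "\<not> int l dvd a * b"
    then have "\<not> int l dvd a" "\<not> int l dvd b"
      by auto
    with that show False
      by (simp add: rat_valuation_def a_def b_def not_dvd_imp_multiplicity_0)
  qed
  then show ?thesis
    by (auto intro: finite_subset[OF _ fin])
qed

text \<open>
  The sum is restricted to the primes with non-zero valuation since a sum over an infinite index
  set would be zero by convention.
\<close>

definition at_most_prime_factors :: "nat set \<Rightarrow> nat \<Rightarrow> rat \<Rightarrow> bool"
  where "at_most_prime_factors S r q \<longleftrightarrow>
    q \<in> S_integers S \<and> q \<noteq> 0 \<and>
    (\<Sum>l | Factorial_Ring.prime l \<and> l \<notin> S \<and> rat_valuation l q \<noteq> 0. rat_valuation l q) \<le> int r"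

definition gcd_is_unit :: "nat set \<Rightarrow> rat set \<Rightarrow> bool"
  where "gcd_is_unit S Q \<longleftrightarrow>
    Q \<subseteq> S_integers S \<and> Idl\<^bsub>S_integer_ring S\<^esub> Q = carrier (S_integer_ring S)"

end

theory Submission
  imports Defs "HOL-Number_Theory.Cong" "HOL-Computational_Algebra.Fundamental_Theorem_Algebra"
begin

text \<open>
  The proof replaces the group by integer points of affine space and then combines a sieve in one
  variable with elimination of variables.

  \<^emph>\<open>The group.\<close> A non-trivial group \<open>\<Gamma>\<close> of rational unipotent matrices has a rational linear form
  on matrices that is additive along \<open>\<Gamma>\<close> and takes the value \<open>1\<close> at some \<open>\<gamma> \<in> \<Gamma>\<close>
  (\<open>additive_coordinate\<close>). Such a form exists because the algebra spanned by the \<open>g - 1\<close> is not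
  equal to its own square. The kernel of the form is a smaller group \<open>\<Gamma>'\<close>, and up to Zariski
  closure every element of \<open>\<Gamma>\<close> is a power of \<open>\<gamma>\<close> times an element of \<open>\<Gamma>'\<close>, where the binomial series
  defines powers with rational exponents. By induction there are \<open>\<gamma>\<^sub>1, \<dots>, \<gamma>\<^sub>d \<in> \<Gamma>\<close> such that the products of integer powers of the \<open>\<gamma>\<^sub>i\<close>
  depend polynomially on the exponents, the exponents are regular functions of the product, and
  the products are Zariski dense (\<open>parametrization_exists\<close>). This identifies \<open>\<rat>[U]\<close> with the
  ring of polynomials in \<open>d\<close> variables, and non-vanishing, divisibility and density can be
  tested on integer points.

  \<^emph>\<open>The sieve on integer points.\<close> The statement about polynomials \<open>f\<close> and \<open>g\<^sub>1, \<dots>, g\<^sub>m\<close> in \<open>d + 1\<close>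
  variables follows from the statement in \<open>d\<close> variables (\<open>sievable_Suc\<close>). Expand everything in
  powers of the last variable \<open>t\<close>. If the \<open>g\<^sub>i\<close> have no common factor, neither do all their
  coefficients. The induction hypothesis, for the leading coefficient of \<open>f\<close> and the coefficients of
  the \<open>g\<^sub>i\<close>, gives a dense set of points \<open>x\<close> at which the content of \<open>f(x,t)\<close> has a bounded number of
  prime factors outside \<open>S\<close> and no prime outside \<open>S\<close> divides all coefficients of all \<open>g\<^sub>i(x,t)\<close>.
  For such an \<open>x\<close> the integers \<open>t\<close> that make \<open>l\<close> divide either the primitive part of \<open>f(x,t)\<close> or all
  \<open>g\<^sub>i(x,t)\<close> fill a bounded number of residue classes modulo \<open>l\<close>. A sieve
  finds \<open>t\<close> in every interval of length \<open>X\<close> outside these classes for all primes \<open>l\<close> between a constant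
  and a fixed power of \<open>X\<close>.
  Then \<open>f(x,t)\<close> has boundedly many prime factors outside \<open>S\<close>, as those that do not come from the
  content exceed a power of \<open>X\<close>. A prime dividing all \<open>g\<^sub>i(x,t)\<close> divides a fixed non-zero element
  \<open>c(x)\<close> of the ideal of the \<open>g\<^sub>i\<close> (\<open>fibre_resultant\<close>), hence is smaller than this power of \<open>X\<close> once \<open>X\<close>
  is large, and has been excluded. The bounds depend on the degrees only and not on \<open>x\<close>. The element
  \<open>c\<close> exists by Gauss's lemma, which needs unique factorization in polynomial rings
  (\<open>factorial_polys\<close>).

  \<^emph>\<open>The sieve in one variable\<close> (\<open>exists_avoiding_residues\<close>) is the Brun--Hooley sieve. The primes are
  split into blocks between \<open>y\<close> and \<open>y\<^sup>2\<close>. In each block inclusion-exclusion is truncated by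
  Bonferroni's inequalities, and the truncated sums of the blocks are multiplied. The sum of \<open>1/p\<close> over
  a block is at most \<open>2\<close>, so truncation orders growing linearly from the last block backwards
  make the relative errors summable while the number of terms stays below a fixed power of \<open>X\<close>.
\<close>

section \<open>Truncated inclusion-exclusion and sieve weights\<close>

definition esym :: "(nat \<Rightarrow> real) \<Rightarrow> nat set \<Rightarrow> nat \<Rightarrow> real"
  where "esym g P k = (\<Sum>T | T \<subseteq> P \<and> card T = k. \<Prod>p\<in>T. g p)"

text \<open>
  If \<open>g\<close> is the indicator of a subset \<open>D\<close> of \<open>P\<close>, the sum over all orders is inclusion-exclusion for
  the statement that \<open>D\<close> is empty. If \<open>g p\<close> is a probability, it is the expectation of the same
  quantity for independent events. Keeping \<open>g\<close> arbitrary treats both at once.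
\<close>

definition bonferroni :: "(nat \<Rightarrow> real) \<Rightarrow> nat set \<Rightarrow> nat \<Rightarrow> real"
  where "bonferroni g P b = (\<Sum>k\<le>b. (-1) ^ k * esym g P k)"

lemma esym_0 [simp]:
  assumes "finite P"
  shows "esym g P 0 = 1"
proof -
  have "{T. T \<subseteq> P \<and> card T = 0} = {{}}"
    using assms by (auto dest: finite_subset)
  then show ?thesis
    by (simp add: esym_def)
qed

lemma esym_insert:
  assumes "finite P" "x \<notin> P"
  shows "esym g (insert x P) (Suc k) = esym g P (Suc k) + g x * esym g P k"
proof -
  let ?A = "{T. T \<subseteq> P \<and> card T = Suc k}" and ?B = "{T. T \<subseteq> P \<and> card T = k}"
  have fin: "finite T" if "T \<subseteq> P" for T
    using that assms finite_subset by blast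
  have split: "{T. T \<subseteq> insert x P \<and> card T = Suc k} = ?A \<union> insert x ` ?B"
  proof (intro equalityI subsetI)
    fix T assume T: "T \<in> {T. T \<subseteq> insert x P \<and> card T = Suc k}"
    show "T \<in> ?A \<union> insert x ` ?B"
    proof (cases "x \<in> T")
      case True
      then have "T = insert x (T - {x})" "T - {x} \<in> ?B"
        using T by (auto simp: card_Diff_singleton)
      then show ?thesis by blast
    qed (use T in auto)
  next
    fix T assume "T \<in> ?A \<union> insert x ` ?B"
    then show "T \<in> {T. T \<subseteq> insert x P \<and> card T = Suc k}"
      using assms fin by (auto simp: card_insert_if subset_iff)
  qed
  have inj: "inj_on (insert x) ?B"
    using assms by (intro inj_onI) (auto simp: insert_ident subset_iff)
  have "esym g (insert x P) (Suc k) = (\<Sum>T\<in>?A. \<Prod>p\<in>T. g p) + (\<Sum>T\<in>insert x ` ?B. \<Prod>p\<in>T. g p)"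
    unfolding esym_def split
    using assms by (intro sum.union_disjoint) auto
  also have "(\<Sum>T\<in>insert x ` ?B. \<Prod>p\<in>T. g p) = (\<Sum>T\<in>?B. g x * (\<Prod>p\<in>T. g p))"
    using assms fin by (subst sum.reindex[OF inj], intro sum.cong refl)
      (auto intro!: prod.insert)
  finally show ?thesis
    by (simp add: esym_def sum_distrib_left)
qed

lemma esym_empty_Suc [simp]: "esym g {} (Suc k) = 0"
proof -
  have "{T :: nat set. T \<subseteq> {} \<and> card T = Suc k} = {}" by auto
  then show ?thesis unfolding esym_def by (metis sum.empty)
qed

lemma power_Suc_add_ge:
  fixes x y :: real
  assumes "0 \<le> x" "0 \<le> y"
  shows "y ^ Suc k + real (Suc k) * x * y ^ k \<le> (y + x) ^ Suc k"
proof (induction k)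
  case (Suc k)
  have "y ^ Suc (Suc k) + real (Suc (Suc k)) * x * y ^ Suc k
      \<le> (y ^ Suc k + real (Suc k) * x * y ^ k) * (y + x)"
    using assms by (simp add: algebra_simps)
  also have "\<dots> \<le> (y + x) ^ Suc k * (y + x)"
    using Suc assms by (intro mult_right_mono) auto
  finally show ?case by (simp add: mult.commute)
qed simp

lemma esym_le:
  assumes "finite P" "\<And>p. p \<in> P \<Longrightarrow> 0 \<le> g p"
  shows "esym g P k \<le> (\<Sum>p\<in>P. g p) ^ k / fact k"
  using assms
proof (induction P arbitrary: k rule: finite_induct)
  case empty
  then show ?case by (cases k) auto
next
  case (insert x P)
  let ?G = "\<Sum>p\<in>P. g p"
  have G: "0 \<le> ?G" "0 \<le> g x" using insert.prems by (auto intro: sum_nonneg)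
  show ?case
  proof (cases k)
    case (Suc l)
    have "esym g P (Suc l) \<le> ?G ^ Suc l / fact (Suc l)" "esym g P l \<le> ?G ^ l / fact l"
      using insert.IH[of "Suc l"] insert.IH[of l] insert.prems by blast+
    then have "esym g (insert x P) (Suc l) \<le> ?G ^ Suc l / fact (Suc l) + g x * (?G ^ l / fact l)"
      unfolding esym_insert[OF insert.hyps] using G by (intro add_mono mult_left_mono)
    also have "\<dots> = (?G ^ Suc l + real (Suc l) * g x * ?G ^ l) / fact (Suc l)"
      by (simp add: add_divide_distrib)
    also have "\<dots> \<le> (?G + g x) ^ Suc l / fact (Suc l)"
      using power_Suc_add_ge[OF G(2) G(1)] by (intro divide_right_mono) auto
    finally show ?thesis using Suc insert.hyps by (simp add: add.commute)
  qed (use insert in auto)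
qed

lemma bonferroni_0 [simp]: "finite P \<Longrightarrow> bonferroni g P 0 = 1"
  by (simp add: bonferroni_def)

lemma bonferroni_Suc: "bonferroni g P (Suc b) = bonferroni g P b + (-1) ^ Suc b * esym g P (Suc b)"
  by (simp add: bonferroni_def)

lemma bonferroni_insert:
  assumes "finite P" "x \<notin> P"
  shows "bonferroni g (insert x P) (Suc b) = bonferroni g P (Suc b) - g x * bonferroni g P b"
  using assms by (induction b) (simp_all add: bonferroni_Suc esym_insert algebra_simps)

text \<open>
  Adding one element to \<open>P\<close> turns the bounds for two consecutive truncation orders into the bound
  for the larger set.
\<close>

lemma bonferroni_bounds:
  assumes "finite P" "\<And>p. p \<in> P \<Longrightarrow> 0 \<le> g p \<and> g p \<le> 1"
  shows "(even b \<longrightarrow> (\<Prod>p\<in>P. 1 - g p) \<le> bonferroni g P b) \<and>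
    (odd b \<longrightarrow> bonferroni g P b \<le> (\<Prod>p\<in>P. 1 - g p))"
  using assms
proof (induction P arbitrary: b rule: finite_induct)
  case empty
  have "bonferroni g {} b = 1" for b
    by (induction b) (auto simp: bonferroni_Suc)
  then show ?case by simp
next
  case (insert x P)
  have x: "0 \<le> g x" "g x \<le> 1" using insert.prems by auto
  have V: "0 \<le> (\<Prod>p\<in>P. 1 - g p)" "(\<Prod>p\<in>P. 1 - g p) \<le> 1"
    using insert.prems by (auto intro!: prod_nonneg prod_le_1)
  show ?case
  proof (cases b)
    case 0
    have "(1 - g x) * (\<Prod>p\<in>P. 1 - g p) \<le> 1"
      using x V by (intro mult_le_one) auto
    then show ?thesis using 0 insert.hyps by simp
  next
    case (Suc c)
    have IH: "(even b \<longrightarrow> (\<Prod>p\<in>P. 1 - g p) \<le> bonferroni g P b) \<and>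
      (odd b \<longrightarrow> bonferroni g P b \<le> (\<Prod>p\<in>P. 1 - g p))" for b
      using insert by auto
    have "even c \<longrightarrow> g x * (\<Prod>p\<in>P. 1 - g p) \<le> g x * bonferroni g P c"
         "odd c \<longrightarrow> g x * bonferroni g P c \<le> g x * (\<Prod>p\<in>P. 1 - g p)"
      using IH[of c] x by (auto intro: mult_left_mono)
    with IH[of "Suc c"] show ?thesis
      using insert.hyps Suc by (auto simp: bonferroni_insert algebra_simps)
  qed
qed

text \<open>
  \<open>F\<close> is a combination of the monomials \<open>\<Prod>p\<in>T. g p\<close> for \<open>T \<subseteq> P\<close>. The number \<open>r\<close> bounds the error
  made when a sum of \<open>F\<close> over integers is replaced by the main term that the local densities predict, if
  for the monomial of \<open>T\<close> alone this error is at most \<open>\<kappa> ^ card T\<close>.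
\<close>

definition multilinear :: "real \<Rightarrow> nat set \<Rightarrow> ((nat \<Rightarrow> real) \<Rightarrow> real) \<Rightarrow> real \<Rightarrow> bool"
  where "multilinear \<kappa> P F r \<longleftrightarrow>
    (\<exists>c. (\<forall>g. F g = (\<Sum>T\<in>Pow P. c T * (\<Prod>p\<in>T. g p))) \<and> (\<Sum>T\<in>Pow P. \<bar>c T\<bar> * \<kappa> ^ card T) \<le> r)"

lemma multilinear_average:
  assumes "multilinear \<kappa> P F r" "finite P"
    and "\<And>T. T \<subseteq> P \<Longrightarrow> \<bar>(\<Sum>n\<in>I. \<Prod>p\<in>T. h n p) - X * (\<Prod>p\<in>T. g p)\<bar> \<le> \<kappa> ^ card T"
  shows "\<bar>(\<Sum>n\<in>I. F (h n)) - X * F g\<bar> \<le> r"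
proof -
  obtain c where F: "\<And>g. F g = (\<Sum>T\<in>Pow P. c T * (\<Prod>p\<in>T. g p))"
    and r: "(\<Sum>T\<in>Pow P. \<bar>c T\<bar> * \<kappa> ^ card T) \<le> r"
    using assms(1) by (auto simp: multilinear_def)
  have "(\<Sum>n\<in>I. F (h n)) - X * F g =
      (\<Sum>T\<in>Pow P. c T * ((\<Sum>n\<in>I. \<Prod>p\<in>T. h n p) - X * (\<Prod>p\<in>T. g p)))"
    unfolding F by (subst sum.swap) (simp add: sum_distrib_left sum_subtractf algebra_simps)
  also have "\<bar>\<dots>\<bar> \<le> (\<Sum>T\<in>Pow P. \<bar>c T\<bar> * \<kappa> ^ card T)"
    using assms(3) by (intro order.trans[OF sum_abs] sum_mono) (auto simp: abs_mult intro: mult_left_mono)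
  finally show ?thesis using r by linarith
qed

lemma multilinear_mono: "multilinear \<kappa> P F r \<Longrightarrow> r \<le> r' \<Longrightarrow> multilinear \<kappa> P F r'"
  unfolding multilinear_def by force

lemma multilinear_one: "multilinear \<kappa> {} (\<lambda>g. 1) 1"
  unfolding multilinear_def by (rule exI[of _ "\<lambda>_. 1"]) auto

lemma multilinear_add:
  assumes "\<kappa> \<ge> 0" "multilinear \<kappa> P F r" "multilinear \<kappa> P G s"
  shows "multilinear \<kappa> P (\<lambda>g. F g + G g) (r + s)"
proof -
  obtain c where F: "\<And>g. F g = (\<Sum>T\<in>Pow P. c T * (\<Prod>p\<in>T. g p))"
    and r: "(\<Sum>T\<in>Pow P. \<bar>c T\<bar> * \<kappa> ^ card T) \<le> r"
    using assms by (auto simp: multilinear_def)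
  obtain d where G: "\<And>g. G g = (\<Sum>T\<in>Pow P. d T * (\<Prod>p\<in>T. g p))"
    and s: "(\<Sum>T\<in>Pow P. \<bar>d T\<bar> * \<kappa> ^ card T) \<le> s"
    using assms by (auto simp: multilinear_def)
  have "(\<Sum>T\<in>Pow P. \<bar>c T + d T\<bar> * \<kappa> ^ card T) \<le>
      (\<Sum>T\<in>Pow P. \<bar>c T\<bar> * \<kappa> ^ card T) + (\<Sum>T\<in>Pow P. \<bar>d T\<bar> * \<kappa> ^ card T)"
    unfolding sum.distrib[symmetric] distrib_right[symmetric]
    using assms(1) by (intro sum_mono mult_right_mono) auto
  then show ?thesis
    unfolding multilinear_def using r s
    by (intro exI[of _ "\<lambda>T. c T + d T"]) (auto simp: F G sum.distrib distrib_right)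
qed

lemma multilinear_scale:
  assumes "multilinear \<kappa> P F r"
  shows "multilinear \<kappa> P (\<lambda>g. a * F g) (\<bar>a\<bar> * r)"
proof -
  obtain c where F: "\<And>g. F g = (\<Sum>T\<in>Pow P. c T * (\<Prod>p\<in>T. g p))"
    and r: "(\<Sum>T\<in>Pow P. \<bar>c T\<bar> * \<kappa> ^ card T) \<le> r"
    using assms by (auto simp: multilinear_def)
  have "(\<Sum>T\<in>Pow P. \<bar>a * c T\<bar> * \<kappa> ^ card T) \<le> \<bar>a\<bar> * r"
    using mult_left_mono[OF r, of "\<bar>a\<bar>"] by (simp add: sum_distrib_left abs_mult mult.assoc)
  then show ?thesis
    unfolding multilinear_def
    by (intro exI[of _ "\<lambda>T. a * c T"]) (auto simp: F sum_distrib_left mult.assoc)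
qed

lemma sum_Pow_Un:
  fixes f :: "'a set \<Rightarrow> 'a set \<Rightarrow> 'b::comm_monoid_add"
  assumes "P \<inter> Q = {}"
  shows "(\<Sum>T\<in>Pow (P \<union> Q). f (T \<inter> P) (T \<inter> Q)) = (\<Sum>A\<in>Pow P. \<Sum>B\<in>Pow Q. f A B)"
proof -
  have "(\<Sum>(A, B)\<in>Pow P \<times> Pow Q. f A B) = (\<Sum>T\<in>Pow (P \<union> Q). f (T \<inter> P) (T \<inter> Q))"
    by (rule sum.reindex_bij_witness[of _ "\<lambda>T. (T \<inter> P, T \<inter> Q)" "\<lambda>(A, B). A \<union> B"])
      (use assms in \<open>auto intro!: arg_cong2[of _ _ _ _ f]\<close>)
  then show ?thesis by (simp add: sum.cartesian_product)
qed

lemma multilinear_mult: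
  assumes "\<kappa> \<ge> 0" "finite P" "finite Q" "P \<inter> Q = {}"
    and "multilinear \<kappa> P F r" "multilinear \<kappa> Q G s"
  shows "multilinear \<kappa> (P \<union> Q) (\<lambda>g. F g * G g) (r * s)"
proof -
  obtain c where F: "\<And>g. F g = (\<Sum>T\<in>Pow P. c T * (\<Prod>p\<in>T. g p))"
    and r: "(\<Sum>T\<in>Pow P. \<bar>c T\<bar> * \<kappa> ^ card T) \<le> r"
    using assms by (auto simp: multilinear_def)
  obtain d where G: "\<And>g. G g = (\<Sum>T\<in>Pow Q. d T * (\<Prod>p\<in>T. g p))"
    and s: "(\<Sum>T\<in>Pow Q. \<bar>d T\<bar> * \<kappa> ^ card T) \<le> s"
    using assms by (auto simp: multilinear_def)
  let ?e = "\<lambda>T. c (T \<inter> P) * d (T \<inter> Q)"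
  have T: "T = (T \<inter> P) \<union> (T \<inter> Q)" "(T \<inter> P) \<inter> (T \<inter> Q) = {}" "finite (T \<inter> P)" "finite (T \<inter> Q)"
    if "T \<in> Pow (P \<union> Q)" for T
    using that assms by auto
  have pr: "(\<Prod>p\<in>T. g p) = (\<Prod>p\<in>T \<inter> P. g p) * (\<Prod>p\<in>T \<inter> Q. g p)" if "T \<in> Pow (P \<union> Q)" for T g
    using T[OF that] prod.union_disjoint[of "T \<inter> P" "T \<inter> Q" g] by metis
  have ca: "card T = card (T \<inter> P) + card (T \<inter> Q)" if "T \<in> Pow (P \<union> Q)" for T
    using T[OF that] card_Un_disjoint[of "T \<inter> P" "T \<inter> Q"] by metis
  have "F g * G g = (\<Sum>T\<in>Pow (P \<union> Q). ?e T * (\<Prod>p\<in>T. g p))" for g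
  proof -
    have "(\<Sum>T\<in>Pow (P \<union> Q). ?e T * (\<Prod>p\<in>T. g p)) =
        (\<Sum>T\<in>Pow (P \<union> Q). (c (T \<inter> P) * (\<Prod>p\<in>T \<inter> P. g p)) * (d (T \<inter> Q) * (\<Prod>p\<in>T \<inter> Q. g p)))"
      by (intro sum.cong refl) (simp add: pr mult_ac)
    also have "\<dots> = F g * G g"
      by (subst sum_Pow_Un[OF assms(4), of "\<lambda>A B. (c A * (\<Prod>p\<in>A. g p)) * (d B * (\<Prod>p\<in>B. g p))"])
        (simp add: F G sum_product)
    finally show ?thesis by simp
  qed
  moreover have "(\<Sum>T\<in>Pow (P \<union> Q). \<bar>?e T\<bar> * \<kappa> ^ card T) \<le> r * s"
  proof -
    have "(\<Sum>T\<in>Pow (P \<union> Q). \<bar>?e T\<bar> * \<kappa> ^ card T) =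
        (\<Sum>T\<in>Pow (P \<union> Q). (\<bar>c (T \<inter> P)\<bar> * \<kappa> ^ card (T \<inter> P)) * (\<bar>d (T \<inter> Q)\<bar> * \<kappa> ^ card (T \<inter> Q)))"
      by (intro sum.cong refl) (simp add: ca abs_mult power_add mult_ac)
    also have "\<dots> = (\<Sum>T\<in>Pow P. \<bar>c T\<bar> * \<kappa> ^ card T) * (\<Sum>T\<in>Pow Q. \<bar>d T\<bar> * \<kappa> ^ card T)"
      by (subst sum_Pow_Un[OF assms(4), of "\<lambda>A B. (\<bar>c A\<bar> * \<kappa> ^ card A) * (\<bar>d B\<bar> * \<kappa> ^ card B)"])
        (simp add: sum_product)
    also have "\<dots> \<le> r * s"
      using r s assms(1) by (intro mult_mono) (auto intro!: sum_nonneg order.trans[OF _ r])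
    finally show ?thesis .
  qed
  ultimately show ?thesis
    unfolding multilinear_def by (intro exI[of _ ?e]) auto
qed

lemma multilinear_esym:
  assumes "\<kappa> \<ge> 0" "finite P"
  shows "multilinear \<kappa> P (\<lambda>g. esym g P k) ((\<kappa> * card P) ^ k)"
proof -
  let ?c = "\<lambda>T :: nat set. if card T = k then 1 else 0 :: real"
  have eq: "(\<Sum>T\<in>Pow P. ?c T * f T) = (\<Sum>T | T \<subseteq> P \<and> card T = k. f T)" for f
  proof -
    have "(\<Sum>T\<in>Pow P. ?c T * f T) = (\<Sum>T\<in>Pow P. if card T = k then f T else 0)"
      by (intro sum.cong) auto
    also have "\<dots> = (\<Sum>T\<in>Pow P \<inter> {T. card T = k}. f T)"
      using assms by (subst sum.inter_restrict) auto
    also have "Pow P \<inter> {T. card T = k} = {T. T \<subseteq> P \<and> card T = k}" by auto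
    finally show ?thesis .
  qed
  have "(\<Sum>T\<in>Pow P. \<bar>?c T\<bar> * \<kappa> ^ card T) = (\<Sum>T\<in>Pow P. ?c T * \<kappa> ^ card T)"
    by (intro sum.cong) auto
  also have "\<dots> = real (card P choose k) * \<kappa> ^ k"
    using assms by (simp add: eq n_subsets)
  also have "\<dots> \<le> real (card P ^ k) * \<kappa> ^ k"
  proof (intro mult_right_mono of_nat_mono)
    show "card P choose k \<le> card P ^ k"
      by (cases "k \<le> card P") (auto simp: binomial_le_pow binomial_eq_0)
  qed (use assms in auto)
  finally have "(\<Sum>T\<in>Pow P. \<bar>?c T\<bar> * \<kappa> ^ card T) \<le> (\<kappa> * card P) ^ k"
    by (simp add: power_mult_distrib mult.commute)
  then show ?thesis
    unfolding multilinear_def by (intro exI[of _ ?c]) (auto simp: eq esym_def)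
qed

lemma multilinear_bonferroni:
  assumes "\<kappa> \<ge> 0" "finite P"
  shows "multilinear \<kappa> P (\<lambda>g. bonferroni g P b) ((1 + \<kappa> * card P) ^ b)"
proof (induction b)
  case 0
  have "multilinear \<kappa> P (\<lambda>g. esym g P 0) 1"
    using multilinear_esym[OF assms, of 0] by simp
  then show ?case using assms by simp
next
  case (Suc b)
  let ?y = "\<kappa> * card P"
  have "multilinear \<kappa> P (\<lambda>g. (-1) ^ Suc b * esym g P (Suc b)) (?y ^ Suc b)"
    using multilinear_scale[OF multilinear_esym[OF assms, of "Suc b"], of "(-1) ^ Suc b"]
    by (simp add: power_abs)
  then have "multilinear \<kappa> P (\<lambda>g. bonferroni g P (Suc b)) ((1 + ?y) ^ b + ?y ^ Suc b)"
    unfolding bonferroni_Suc by (rule multilinear_add[OF assms(1) Suc])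
  moreover have "?y * ?y ^ b \<le> ?y * (1 + ?y) ^ b"
    using assms by (intro mult_left_mono power_mono) auto
  ultimately show ?case
    by (elim multilinear_mono) (simp add: algebra_simps)
qed

text \<open>
  For non-negative \<open>E \<le> U\<close>, \<open>E' \<le> U'\<close> and \<open>L \<le> E\<close> one has
  \<open>E * E' = E * U' - E * (U' - E') \<ge> L * U' - U * (U' - E')\<close>. The lower weight iterates this over
  the blocks; the excess \<open>U' - E'\<close> of a truncated sum is at most the first omitted symmetric
  function.
\<close>

fun upper_weight :: "(nat \<Rightarrow> nat set) \<Rightarrow> (nat \<Rightarrow> nat) \<Rightarrow> nat \<Rightarrow> (nat \<Rightarrow> real) \<Rightarrow> real"
  where
    "upper_weight P b 0 g = 1"
  | "upper_weight P b (Suc j) g = upper_weight P b j g * bonferroni g (P j) (b j)"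

fun lower_weight :: "(nat \<Rightarrow> nat set) \<Rightarrow> (nat \<Rightarrow> nat) \<Rightarrow> nat \<Rightarrow> (nat \<Rightarrow> real) \<Rightarrow> real"
  where
    "lower_weight P b 0 g = 1"
  | "lower_weight P b (Suc j) g =
      lower_weight P b j g * bonferroni g (P j) (b j) - upper_weight P b j g * esym g (P j) (Suc (b j))"

lemma bonferroni_excess:
  assumes "finite P" "\<And>p. p \<in> P \<Longrightarrow> 0 \<le> g p \<and> g p \<le> 1" "even b"
  shows "(\<Prod>p\<in>P. 1 - g p) \<le> bonferroni g P b"
    and "bonferroni g P b - (\<Prod>p\<in>P. 1 - g p) \<le> esym g P (Suc b)"
  using bonferroni_bounds[where P=P and g=g and b=b] bonferroni_bounds[where P=P and g=g and b="Suc b"] assms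
  by (auto simp: bonferroni_Suc)

lemma weight_bounds:
  assumes "\<And>i. finite (P i)" "\<And>i. even (b i)"
    and "\<And>i p. p \<in> P i \<Longrightarrow> 0 \<le> g p \<and> g p \<le> 1"
  shows "lower_weight P b j g \<le> (\<Prod>i<j. \<Prod>p\<in>P i. 1 - g p)"
    and "(\<Prod>i<j. \<Prod>p\<in>P i. 1 - g p) \<le> upper_weight P b j g"
proof (induction j)
  case (Suc j)
  let ?E = "\<Prod>i<j. \<Prod>p\<in>P i. 1 - g p" and ?E' = "\<Prod>p\<in>P j. 1 - g p"
  let ?B = "bonferroni g (P j) (b j)"
  have E: "0 \<le> ?E" "0 \<le> ?E'" using assms(3) by (auto intro!: prod_nonneg)
  have B: "?E' \<le> ?B" "?B - ?E' \<le> esym g (P j) (Suc (b j))"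
    using bonferroni_excess[where P="P j" and g=g and b="b j"] assms by auto
  {
    case 1
    have "lower_weight P b (Suc j) g \<le> ?E * ?B - ?E * (?B - ?E')"
    proof -
      have "lower_weight P b j g * ?B \<le> ?E * ?B"
        using Suc(1) B E by (intro mult_right_mono) auto
      moreover have "?E * (?B - ?E') \<le> upper_weight P b j g * esym g (P j) (Suc (b j))"
        using Suc(2) B E by (intro mult_mono) linarith+
      ultimately show ?thesis by simp
    qed
    also have "?E * ?B - ?E * (?B - ?E') = ?E * ?E'" by (simp only: right_diff_distrib diff_diff_eq2 add_diff_cancel_left')
    finally show ?case by simp
  next
    case 2
    have "?E * ?E' \<le> upper_weight P b j g * ?B"
      using Suc(2) B E by (intro mult_mono) linarith+
    then show ?case by simp
  }
qed auto

text \<open>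
  Each block costs a factor \<open>1 - s i\<close> compared with the upper weight, since the first omitted
  symmetric function is at most \<open>s i\<close> times the truncated sum.
\<close>

lemma lower_weight_ge:
  assumes "\<And>i. finite (P i)" "\<And>i. even (b i)"
    and "\<And>i p. p \<in> P i \<Longrightarrow> 0 \<le> g p \<and> g p \<le> 1"
    and "\<And>i. i < j \<Longrightarrow> v \<le> (\<Prod>p\<in>P i. 1 - g p)" "v > 0"
    and "\<And>i. i < j \<Longrightarrow> esym g (P i) (Suc (b i)) \<le> s i * v"
    and "\<And>i. s i \<ge> 0"
  shows "(1 - (\<Sum>i<j. s i)) * upper_weight P b j g \<le> lower_weight P b j g \<and> v ^ j \<le> upper_weight P b j g"
  using assms(4,6)
proof (induction j)
  case (Suc j)
  let ?B = "bonferroni g (P j) (b j)" and ?U = "upper_weight P b j g" and ?\<sigma> = "\<Sum>i<j. s i"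
  have IH: "(1 - ?\<sigma>) * ?U \<le> lower_weight P b j g" "v ^ j \<le> ?U"
    using Suc.IH Suc.prems by auto
  have vB: "v \<le> ?B"
    using bonferroni_excess(1)[where P="P j" and g=g and b="b j"] assms(1-3) Suc.prems(1)[of j]
    by (meson lessI order_trans)
  have U: "0 \<le> ?U" using IH(2) assms(5) by (meson order.trans zero_le_power less_imp_le)
  have "esym g (P j) (Suc (b j)) \<le> s j * ?B"
    using Suc.prems(2)[of j] vB assms(7)[of j] by (meson lessI mult_left_mono order_trans)
  then have "?U * esym g (P j) (Suc (b j)) \<le> ?U * (s j * ?B)"
    using U by (intro mult_left_mono)
  moreover have "((1 - ?\<sigma>) * ?U) * ?B \<le> lower_weight P b j g * ?B"
    using IH(1) vB assms(5) by (intro mult_right_mono) auto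
  ultimately have "(1 - ?\<sigma>) * ?U * ?B - ?U * (s j * ?B) \<le> lower_weight P b (Suc j) g"
    unfolding lower_weight.simps by linarith
  moreover have "(1 - ?\<sigma>) * ?U * ?B - ?U * (s j * ?B) = (1 - (\<Sum>i<Suc j. s i)) * upper_weight P b (Suc j) g"
    by (simp add: algebra_simps)
  moreover have "v ^ j * v \<le> ?U * ?B"
    using IH(2) vB U assms(5) by (intro mult_mono) auto
  ultimately show ?case by (simp add: mult.commute)
qed auto

lemma multilinear_weights:
  fixes \<kappa> :: real and R :: "nat \<Rightarrow> real"
  assumes "\<kappa> \<ge> 0" "\<And>i. finite (P i)" "\<And>i j. i \<noteq> j \<Longrightarrow> P i \<inter> P j = {}"
    and "\<And>i. i < j \<Longrightarrow> (1 + \<kappa> * card (P i)) ^ Suc (b i) \<le> R i"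
  shows "multilinear \<kappa> (\<Union>i<j. P i) (upper_weight P b j) (\<Prod>i<j. R i) \<and>
    multilinear \<kappa> (\<Union>i<j. P i) (lower_weight P b j) (real (Suc j) * (\<Prod>i<j. R i))"
  using assms(4)
proof (induction j)
  case 0
  then show ?case using multilinear_one by simp
next
  case (Suc j)
  let ?Q = "\<Union>i<j. P i"
  let ?R = "\<Prod>i<j. R i"
  have IH: "multilinear \<kappa> ?Q (upper_weight P b j) ?R"
    "multilinear \<kappa> ?Q (lower_weight P b j) (real (Suc j) * ?R)"
    using Suc.IH Suc.prems by auto
  have Q: "finite ?Q" "?Q \<inter> P j = {}" "(\<Union>i<Suc j. P i) = ?Q \<union> P j"
    using assms(2,3) by (auto simp: lessThan_Suc) (metis disjoint_iff order_less_irrefl)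
  have y: "0 \<le> \<kappa> * card (P j)" using assms(1) by simp
  have "(1 + \<kappa> * card (P j)) ^ b j \<le> R j"
    using Suc.prems[of j] power_increasing[of "b j" "Suc (b j)" "1 + \<kappa> * card (P j)"] y by linarith
  then have B: "multilinear \<kappa> (P j) (\<lambda>g. bonferroni g (P j) (b j)) (R j)"
    using multilinear_bonferroni[of \<kappa> "P j" "b j"] assms(1,2) multilinear_mono by blast
  have "(\<kappa> * card (P j)) ^ Suc (b j) \<le> R j"
    using Suc.prems[of j] power_mono[of "\<kappa> * card (P j)" "1 + \<kappa> * card (P j)" "Suc (b j)"] y by linarith
  then have e: "multilinear \<kappa> (P j) (\<lambda>g. esym g (P j) (Suc (b j))) (R j)"
    using multilinear_esym[of \<kappa> "P j" "Suc (b j)"] assms(1,2) multilinear_mono by blast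
  have 1: "multilinear \<kappa> (?Q \<union> P j) (\<lambda>g. upper_weight P b j g * bonferroni g (P j) (b j)) (?R * R j)"
    using multilinear_mult[OF assms(1) Q(1) assms(2) Q(2) IH(1) B] .
  have 2: "multilinear \<kappa> (?Q \<union> P j) (\<lambda>g. lower_weight P b j g * bonferroni g (P j) (b j)) (real (Suc j) * ?R * R j)"
    using multilinear_mult[OF assms(1) Q(1) assms(2) Q(2) IH(2) B] .
  have 3: "multilinear \<kappa> (?Q \<union> P j) (\<lambda>g. upper_weight P b j g * esym g (P j) (Suc (b j))) (?R * R j)"
    using multilinear_mult[OF assms(1) Q(1) assms(2) Q(2) IH(1) e] .
  have eq: "lower_weight P b (Suc j) =
      (\<lambda>g. lower_weight P b j g * bonferroni g (P j) (b j)
        + (-1) * (upper_weight P b j g * esym g (P j) (Suc (b j))))"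
    "upper_weight P b (Suc j) = (\<lambda>g. upper_weight P b j g * bonferroni g (P j) (b j))"
    by (simp_all add: fun_eq_iff)
  have 4: "multilinear \<kappa> (?Q \<union> P j) (lower_weight P b (Suc j)) (real (Suc j) * ?R * R j + \<bar>-1\<bar> * (?R * R j))"
    unfolding eq by (rule multilinear_add[OF assms(1) 2 multilinear_scale[OF 3]])
  have e: "real (Suc j) * ?R * R j + \<bar>-1\<bar> * (?R * R j) = real (Suc (Suc j)) * (\<Prod>i<Suc j. R i)"
    "?R * R j = (\<Prod>i<Suc j. R i)"
    by (simp_all add: algebra_simps)
  show ?case
    using 1[unfolded e(2)] 4[unfolded e(1)] unfolding Q(3) eq(2) by blast
qed

text \<open>
  The sum of the lower weight over \<open>I\<close> is \<open>X\<close> times its value at the densities \<open>g\<close>, up to the error bound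
  of multilinearity, hence positive. So the lower weight is positive at some \<open>n\<close>, and there it is a
  lower bound for the indicator of the sifted set.
\<close>

lemma sieve_weights_positive:
  fixes \<kappa> :: real and R :: "nat \<Rightarrow> real"
  assumes "\<And>i. finite (P i)" "\<And>i. even (b i)" "\<And>i j. i \<noteq> j \<Longrightarrow> P i \<inter> P j = {}"
    and g: "\<And>i p. p \<in> P i \<Longrightarrow> 0 \<le> g p \<and> g p \<le> 1"
    and h: "\<And>n i p. p \<in> P i \<Longrightarrow> h n p = 0 \<or> h n p = 1"
    and v: "\<And>i. i < j \<Longrightarrow> v \<le> (\<Prod>p\<in>P i. 1 - g p)" "v > 0"
    and s: "\<And>i. i < j \<Longrightarrow> esym g (P i) (Suc (b i)) \<le> s i * v" "\<And>i. s i \<ge> 0" "(\<Sum>i<j. s i) \<le> 1/2"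
    and R: "\<kappa> \<ge> 0" "\<And>i. i < j \<Longrightarrow> (1 + \<kappa> * card (P i)) ^ Suc (b i) \<le> R i"
    and avg: "\<And>T. T \<subseteq> (\<Union>i<j. P i) \<Longrightarrow> \<bar>(\<Sum>n\<in>I. \<Prod>p\<in>T. h n p) - X * (\<Prod>p\<in>T. g p)\<bar> \<le> \<kappa> ^ card T"
    and X: "X \<ge> 0" "real (Suc j) * (\<Prod>i<j. R i) < X * v ^ j / 2"
  shows "\<exists>n\<in>I. \<forall>i<j. \<forall>p\<in>P i. h n p = 0"
proof -
  let ?Q = "\<Union>i<j. P i"
  let ?L = "lower_weight P b j"
  have Q: "finite ?Q" using assms(1) by auto
  have ml: "multilinear \<kappa> ?Q ?L (real (Suc j) * (\<Prod>i<j. R i))"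
    using multilinear_weights[where \<kappa>=\<kappa> and P=P and b=b and j=j and R=R] R assms(1,3) by simp
  have "\<bar>(\<Sum>n\<in>I. ?L (h n)) - X * ?L g\<bar> \<le> real (Suc j) * (\<Prod>i<j. R i)"
    by (rule multilinear_average[OF ml Q avg])
  moreover have "v ^ j / 2 \<le> ?L g"
  proof -
    have *: "(1 - (\<Sum>i<j. s i)) * upper_weight P b j g \<le> ?L g" "v ^ j \<le> upper_weight P b j g"
      using lower_weight_ge[where P=P and b=b and g=g and j=j and v=v and s=s] assms(1,2) g v s(1,2) by simp_all
    have "v ^ j > 0" using v(2) by simp
    with *(2) have "(1/2) * v ^ j \<le> (1 - (\<Sum>i<j. s i)) * upper_weight P b j g"
      using s(3) by (intro mult_mono) auto
    with *(1) show ?thesis by simp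
  qed
  then have "X * (v ^ j / 2) \<le> X * ?L g" using X(1) by (intro mult_left_mono)
  ultimately have "(\<Sum>n\<in>I. ?L (h n)) > 0" using X(2) by simp
  then have "\<exists>n\<in>I. ?L (h n) > 0"
    using sum_nonpos[of I "\<lambda>n. ?L (h n)"] by (force simp: not_less[symmetric])
  then obtain n where n: "n \<in> I" "?L (h n) > 0" by blast
  have h01: "0 \<le> h n p \<and> h n p \<le> 1" if "p \<in> P i" for i p
    using h[OF that, of n] by auto
  have "0 < (\<Prod>i<j. \<Prod>p\<in>P i. 1 - h n p)"
    using weight_bounds(1)[where P=P and b=b and j=j, OF assms(1,2) h01] n(2) by (rule less_le_trans[rotated])
  then have "(\<Prod>p\<in>P i. 1 - h n p) \<noteq> 0" if "i < j" for i
    using that by (metis finite_lessThan lessThan_iff less_irrefl prod_zero_iff)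
  then have "h n p \<noteq> 1" if "i < j" "p \<in> P i" for i p
    using that assms(1) by (metis eq_iff_diff_eq_0 prod_zero_iff)
  then show ?thesis using n(1) h by blast
qed

section \<open>Counting integers in residue classes\<close>

definition periodic :: "int \<Rightarrow> int set \<Rightarrow> bool"
  where "periodic d E \<longleftrightarrow> (\<forall>n. n + d \<in> E \<longleftrightarrow> n \<in> E)"

lemma periodic_add_mult:
  assumes "periodic d E"
  shows "n + d * k \<in> E \<longleftrightarrow> n \<in> E"
proof (induction k rule: int_induct[where k = 0])
  case (step1 i)
  have "n + d * (i + 1) = (n + d * i) + d" by (simp add: algebra_simps)
  then show ?case using step1 assms by (simp only: periodic_def)
next
  case (step2 i)
  have "n + d * i = (n + d * (i - 1)) + d" by (simp add: algebra_simps)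
  then show ?case using step2 assms by (metis periodic_def)
qed simp

lemma periodic_cong:
  assumes "periodic d E" "[m = n] (mod d)"
  shows "m \<in> E \<longleftrightarrow> n \<in> E"
proof -
  obtain k where "m = n + d * k"
    using assms(2) by (metis cong_iff_lin cong_sym)
  then show ?thesis using periodic_add_mult[OF assms(1)] by simp
qed

lemma periodic_mod:
  assumes "periodic d E"
  shows "n mod d \<in> E \<longleftrightarrow> n \<in> E"
  by (rule periodic_cong[OF assms]) (simp add: cong_def)

lemma card_periodic_window:
  assumes "periodic d E" "d > 0"
  shows "card (E \<inter> {y..<y + d}) = card (E \<inter> {0..<d})"
proof -
  have "bij_betw (\<lambda>n. n mod d) (E \<inter> {y..<y + d}) (E \<inter> {0..<d})"
  proof (rule bij_betwI[where g = "\<lambda>n. y + (n - y) mod d"])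
    show "(\<lambda>n. n mod d) \<in> E \<inter> {y..<y + d} \<rightarrow> E \<inter> {0..<d}"
      using assms periodic_mod by auto
    show "(\<lambda>n. y + (n - y) mod d) \<in> E \<inter> {0..<d} \<rightarrow> E \<inter> {y..<y + d}"
    proof
      fix n assume n: "n \<in> E \<inter> {0..<d}"
      have "[y + (n - y) mod d = n] (mod d)"
        by (simp add: cong_def mod_simps)
      with n show "y + (n - y) mod d \<in> E \<inter> {y..<y + d}"
        using assms(2) periodic_cong[OF assms(1)] by auto
    qed
  next
    fix n assume n: "n \<in> E \<inter> {y..<y + d}"
    have "(n mod d - y) mod d = (n - y) mod d" by (simp add: mod_simps)
    also have "\<dots> = n - y" using n by simp
    finally show "y + (n mod d - y) mod d = n" by simp
  next
    fix n assume n: "n \<in> E \<inter> {0..<d}"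
    have "(y + (n - y) mod d) mod d = n mod d" by (simp add: mod_simps)
    then show "(y + (n - y) mod d) mod d = n" using n by simp
  qed
  then show ?thesis by (rule bij_betw_same_card)
qed

lemma card_periodic_interval:
  assumes "periodic d E" "d > 0"
  shows "\<bar>real (card (E \<inter> {y..<y + int X})) - real X * (card (E \<inter> {0..<d}) / d)\<bar> \<le> card (E \<inter> {0..<d})"
proof (induction X arbitrary: y rule: less_induct)
  case (less X)
  let ?\<rho> = "card (E \<inter> {0..<d})"
  show ?case
  proof (cases "int X < d")
    case True
    have "card (E \<inter> {y..<y + int X}) \<le> card (E \<inter> {y..<y + d})"
      using True by (intro card_mono) auto
    then have "card (E \<inter> {y..<y + int X}) \<le> ?\<rho>"
      using card_periodic_window[OF assms] by simp
    moreover have "real X * (?\<rho> / d) \<le> ?\<rho>"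
    proof -
      have "real X \<le> d" using True by linarith
      then have "real X * real ?\<rho> \<le> real_of_int d * real ?\<rho>" by (intro mult_right_mono) auto
      then show ?thesis using assms(2) by (simp add: field_simps)
    qed
    moreover have "0 \<le> real X * (?\<rho> / d)" using assms(2) by simp
    ultimately show ?thesis by linarith
  next
    case False
    define Z where "Z = X - nat d"
    have Z: "int X = int Z + d" "Z < X" using False assms(2) by (auto simp: Z_def)
    have "E \<inter> {y..<y + int X} = (E \<inter> {y..<y + d}) \<union> (E \<inter> {(y + d)..<(y + d) + int Z})"
      using Z assms(2) by auto
    then have "card (E \<inter> {y..<y + int X}) = card (E \<inter> {y..<y + d}) + card (E \<inter> {(y + d)..<(y + d) + int Z})"
      by (simp only:) (rule card_Un_disjoint, auto)
    then have "real (card (E \<inter> {y..<y + int X})) = ?\<rho> + card (E \<inter> {(y + d)..<(y + d) + int Z})"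
      using card_periodic_window[OF assms] by simp
    moreover have "real X * (?\<rho> / d) = real Z * (?\<rho> / d) + ?\<rho>"
    proof -
      have "real X = real Z + d" using Z by linarith
      then show ?thesis using assms(2) by (simp add: field_simps)
    qed
    ultimately show ?thesis
      using less.IH[OF Z(2), of "y + d"] by linarith
  qed
qed

lemma card_periodic_inter:
  assumes "periodic d E" "periodic e F" "d > 0" "e > 0" "coprime d e"
  shows "card (E \<inter> F \<inter> {0..<d * e}) = card (E \<inter> {0..<d}) * card (F \<inter> {0..<e})"
proof -
  have "bij_betw (\<lambda>n. (n mod d, n mod e)) (E \<inter> F \<inter> {0..<d * e}) ((E \<inter> {0..<d}) \<times> (F \<inter> {0..<e}))"
  proof (intro bij_betwI' )
    fix m n assume mn: "m \<in> E \<inter> F \<inter> {0..<d * e}" "n \<in> E \<inter> F \<inter> {0..<d * e}"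
    show "((m mod d, m mod e) = (n mod d, n mod e)) = (m = n)"
    proof
      assume "(m mod d, m mod e) = (n mod d, n mod e)"
      then have "[m = n] (mod d * e)"
        using assms(5) coprime_cong_mult by (auto simp: cong_def[symmetric])
      then show "m = n" using mn by (simp add: cong_def)
    qed simp
  next
    fix n assume "n \<in> E \<inter> F \<inter> {0..<d * e}"
    then show "(n mod d, n mod e) \<in> (E \<inter> {0..<d}) \<times> (F \<inter> {0..<e})"
      using assms periodic_mod by auto
  next
    fix ab assume ab: "ab \<in> (E \<inter> {0..<d}) \<times> (F \<inter> {0..<e})"
    obtain x where x: "[x = fst ab] (mod d)" "[x = snd ab] (mod e)"
      using binary_chinese_remainder_int[OF assms(5)] by blast
    let ?n = "x mod (d * e)"
    have n: "[?n = fst ab] (mod d)" "[?n = snd ab] (mod e)"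
      using x by (auto simp: cong_def mod_mult_eq mod_mod_cancel)
    have "?n \<in> E" "?n \<in> F"
      using ab n periodic_cong assms(1,2) by auto
    moreover have "0 \<le> ?n" "?n < d * e" using assms by auto
    moreover have "ab = (?n mod d, ?n mod e)"
      using n ab by (auto simp: cong_def)
    ultimately show "\<exists>n\<in>E \<inter> F \<inter> {0..<d * e}. ab = (n mod d, n mod e)" by auto
  qed
  then show ?thesis by (simp add: bij_betw_same_card card_cartesian_product)
qed

text \<open>
  By the Chinese remainder theorem the number of residues modulo a product of distinct primes is the
  product of the local numbers.
\<close>

lemma card_periodic_Inter:
  assumes "finite T" "\<And>p. p \<in> T \<Longrightarrow> Factorial_Ring.prime p" "\<And>p. p \<in> T \<Longrightarrow> periodic (int p) (\<Omega> p)"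
  shows "periodic (\<Prod>p\<in>T. int p) {n. \<forall>p\<in>T. n \<in> \<Omega> p} \<and>
    card ({n. \<forall>p\<in>T. n \<in> \<Omega> p} \<inter> {0..<(\<Prod>p\<in>T. int p)}) = (\<Prod>p\<in>T. card (\<Omega> p \<inter> {0..<int p}))"
  using assms
proof (induction T rule: finite_induct)
  case empty
  have "{0..<1} = {0 :: int}" by auto
  then show ?case by (simp add: periodic_def)
next
  case (insert q T)
  let ?E = "{n. \<forall>p\<in>T. n \<in> \<Omega> p}" and ?d = "\<Prod>p\<in>T. int p"
  have IH: "periodic ?d ?E" "card (?E \<inter> {0..<?d}) = (\<Prod>p\<in>T. card (\<Omega> p \<inter> {0..<int p}))"
    using insert by auto
  have E: "{n. \<forall>p\<in>insert q T. n \<in> \<Omega> p} = \<Omega> q \<inter> ?E" by auto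
  have q: "periodic (int q) (\<Omega> q)" "int q > 0" "?d > 0"
    using insert.prems by (auto intro!: prod_pos simp: prime_gt_0_nat)
  have cop: "coprime (int q) ?d"
    using insert by (intro prod_coprime_right) (auto intro!: primes_coprime simp: coprime_int_iff)
  have "periodic (int q * ?d) (\<Omega> q \<inter> ?E)"
    unfolding periodic_def
  proof
    fix n
    have "n + int q * ?d \<in> \<Omega> q \<longleftrightarrow> n \<in> \<Omega> q" by (rule periodic_add_mult[OF q(1)])
    moreover have "n + int q * ?d \<in> ?E \<longleftrightarrow> n \<in> ?E"
      using periodic_add_mult[OF IH(1), of n "int q"] by (simp add: mult.commute)
    ultimately show "n + int q * ?d \<in> \<Omega> q \<inter> ?E \<longleftrightarrow> n \<in> \<Omega> q \<inter> ?E" by blast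
  qed
  moreover have "card (\<Omega> q \<inter> ?E \<inter> {0..<int q * ?d}) = card (\<Omega> q \<inter> {0..<int q}) * card (?E \<inter> {0..<?d})"
    by (rule card_periodic_inter[OF q(1) IH(1) q(2,3) cop])
  ultimately show ?case
    unfolding E using insert.hyps IH(2) by simp
qed

lemma sum_periodic_density:
  assumes "finite T" "\<And>p. p \<in> T \<Longrightarrow> Factorial_Ring.prime p" "\<And>p. p \<in> T \<Longrightarrow> periodic (int p) (\<Omega> p)"
    and "\<And>p. p \<in> T \<Longrightarrow> card (\<Omega> p \<inter> {0..<int p}) \<le> \<kappa>"
  shows "\<bar>(\<Sum>n\<in>{y..<y + int X}. \<Prod>p\<in>T. of_bool (n \<in> \<Omega> p))
      - real X * (\<Prod>p\<in>T. card (\<Omega> p \<inter> {0..<int p}) / real p)\<bar> \<le> real \<kappa> ^ card T"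
proof -
  let ?E = "{n. \<forall>p\<in>T. n \<in> \<Omega> p}" and ?d = "\<Prod>p\<in>T. int p"
  have E: "periodic ?d ?E" "card (?E \<inter> {0..<?d}) = (\<Prod>p\<in>T. card (\<Omega> p \<inter> {0..<int p}))"
    using card_periodic_Inter[OF assms(1-3)] by auto
  have d: "?d > 0" using assms(2) by (auto intro!: prod_pos simp: prime_gt_0_nat)
  have "(\<Prod>p\<in>T. of_bool (n \<in> \<Omega> p)) = (of_bool (n \<in> ?E) :: real)" for n
    using assms(1) by (induction T rule: finite_induct) auto
  then have "(\<Sum>n\<in>{y..<y + int X}. \<Prod>p\<in>T. of_bool (n \<in> \<Omega> p)) = (\<Sum>n\<in>{y..<y + int X}. (of_bool (n \<in> ?E) :: real))"
    by simp
  also have "\<dots> = card (?E \<inter> {y..<y + int X})"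
    by (simp add: sum.If_cases of_bool_def Int_commute)
  finally have 1: "(\<Sum>n\<in>{y..<y + int X}. \<Prod>p\<in>T. of_bool (n \<in> \<Omega> p)) = real (card (?E \<inter> {y..<y + int X}))" .
  have 2: "(\<Prod>p\<in>T. card (\<Omega> p \<inter> {0..<int p}) / real p) = card (?E \<inter> {0..<?d}) / ?d"
    unfolding E(2) by (simp add: prod_dividef)
  have 3: "real (card (?E \<inter> {0..<?d})) \<le> real \<kappa> ^ card T"
  proof -
    have "(\<Prod>p\<in>T. card (\<Omega> p \<inter> {0..<int p})) \<le> (\<Prod>p\<in>T. \<kappa>)"
      using assms(4) by (intro prod_mono) auto
    then show ?thesis unfolding E(2) of_nat_power[symmetric] of_nat_le_iff by simp
  qed
  show ?thesis
    unfolding 1 2 using card_periodic_interval[OF E(1) d, of y X] 3 by linarith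
qed

section \<open>Primes in blocks\<close>

lemma prod_primes_dvd:
  assumes "finite T" "\<And>p. p \<in> T \<Longrightarrow> Factorial_Ring.prime p \<and> p dvd n"
  shows "(\<Prod>p\<in>T. p) dvd (n :: nat)"
  using assms
proof (induction T rule: finite_induct)
  case (insert q T)
  have "coprime q (\<Prod>p\<in>T. p)"
    using insert by (intro prod_coprime_right) (auto intro!: primes_coprime)
  then show ?case using insert by (simp add: divides_mult)
qed simp

text \<open>
  Chebyshev's argument: each prime between \<open>n\<close> and \<open>2 * n\<close> divides the central binomial coefficient.
\<close>

lemma prod_primes_le_binomial:
  "(\<Prod>p | Factorial_Ring.prime p \<and> n < p \<and> p \<le> 2 * n. p) \<le> 4 ^ n"
proof -
  let ?P = "{p. Factorial_Ring.prime p \<and> n < p \<and> p \<le> 2 * n}"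
  have fin: "finite ?P" by (rule finite_subset[of _ "{..2 * n}"]) auto
  have "p dvd (2 * n) choose n" if "p \<in> ?P" for p
  proof -
    have "p dvd fact (2 * n)" using that by (simp add: prime_dvd_fact_iff)
    moreover have "\<not> p dvd (fact n :: nat)" using that by (simp add: prime_dvd_fact_iff)
    moreover have "(fact (2 * n) :: nat) = fact n * fact n * (2 * n choose n)"
      using binomial_fact_lemma[of n "2 * n"] by (simp add: mult_2)
    ultimately show ?thesis using that by (simp add: prime_dvd_mult_iff)
  qed
  then have "(\<Prod>p\<in>?P. p) dvd (2 * n) choose n"
    using fin by (intro prod_primes_dvd) auto
  then have "(\<Prod>p\<in>?P. p) \<le> (2 * n) choose n"
    by (rule dvd_imp_le) simp
  also have "\<dots> \<le> 2 ^ (2 * n)" by (rule binomial_le_pow2)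
  finally show ?thesis by (simp add: power_mult)
qed

lemma sum_inverse_primes_dyadic:
  assumes "i > 0"
  shows "(\<Sum>p | Factorial_Ring.prime p \<and> 2 ^ i < p \<and> p \<le> 2 ^ Suc i. 1 / real p) \<le> 2 / real i"
proof -
  let ?P = "{p :: nat. Factorial_Ring.prime p \<and> 2 ^ i < p \<and> p \<le> 2 ^ Suc i}"
  have fin: "finite ?P" by (rule finite_subset[of _ "{..2 ^ Suc i}"]) auto
  have "(2 ^ i) ^ card ?P = (\<Prod>p\<in>?P. 2 ^ i :: nat)" by simp
  also have "\<dots> \<le> (\<Prod>p\<in>?P. p)" by (intro prod_mono) auto
  also have "\<dots> \<le> 4 ^ (2 ^ i)" using prod_primes_le_binomial[of "2 ^ i"] by simp
  also have "\<dots> = 2 ^ (2 * 2 ^ i)" by (simp add: power_mult)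
  finally have "(2 :: nat) ^ (i * card ?P) \<le> 2 ^ (2 * 2 ^ i)" unfolding power_mult .
  then have "i * card ?P \<le> 2 * 2 ^ i" by (rule power_le_imp_le_exp[rotated]) simp
  then have "real (i * card ?P) \<le> real (2 * 2 ^ i)" by (rule of_nat_mono)
  then have c: "real i * real (card ?P) \<le> 2 * 2 ^ i" by simp
  have "(\<Sum>p\<in>?P. 1 / real p) \<le> (\<Sum>p\<in>?P. 1 / 2 ^ i)"
  proof (intro sum_mono)
    fix p assume "p \<in> ?P"
    then have "real (2 ^ i) \<le> real p" by (subst of_nat_le_iff) auto
    then show "1 / real p \<le> 1 / 2 ^ i" by (intro frac_le) auto
  qed
  also have "\<dots> = real (card ?P) / 2 ^ i" by simp
  also have "\<dots> \<le> 2 / real i" using c assms by (simp add: field_simps)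
  finally show ?thesis .
qed

definition prime_block :: "nat \<Rightarrow> nat set"
  where "prime_block j = {p. Factorial_Ring.prime p \<and> 2 ^ 2 ^ j < p \<and> p \<le> 2 ^ 2 ^ Suc j}"

lemma finite_prime_block: "finite (prime_block j)"
  unfolding prime_block_def by (rule finite_subset[of _ "{..2 ^ 2 ^ Suc j}"]) auto

text \<open>
  A block consists of \<open>2 ^ j\<close> dyadic ranges, and each of them contributes at most \<open>2 / 2 ^ j\<close>.
\<close>

lemma sum_inverse_prime_block: "(\<Sum>p\<in>prime_block j. 1 / real p) \<le> 2"
proof -
  let ?D = "\<lambda>i. {p :: nat. Factorial_Ring.prime p \<and> 2 ^ i < p \<and> p \<le> 2 ^ Suc i}"
  let ?I = "{2 ^ j..<2 ^ Suc j :: nat}"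
  have finD: "finite (?D i)" for i by (rule finite_subset[of _ "{..2 ^ Suc i}"]) auto
  have "prime_block j \<subseteq> (\<Union>i\<in>?I. ?D i)"
  proof
    fix p assume p: "p \<in> prime_block j"
    define i where "i = (LEAST k. p \<le> 2 ^ Suc k)"
    have ex: "p \<le> 2 ^ Suc (2 ^ Suc j)" using p by (auto simp: prime_block_def)
    have i1: "p \<le> 2 ^ Suc i" unfolding i_def using ex by (rule LeastI)
    have i2: "2 ^ i < p"
    proof (cases i)
      case 0 then show ?thesis using p prime_gt_1_nat[of p] by (simp add: prime_block_def)
    next
      case (Suc k)
      then have "\<not> p \<le> 2 ^ Suc k" using not_less_Least[of k "\<lambda>k. p \<le> 2 ^ Suc k"] i_def by auto
      then show ?thesis using Suc by simp
    qed
    have "2 ^ 2 ^ j < (2 :: nat) ^ Suc i" using p i1 by (auto simp: prime_block_def)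
    then have "2 ^ j < Suc i" by (simp only: power_strict_increasing_iff)
    moreover have "(2 :: nat) ^ i < 2 ^ 2 ^ Suc j"
      using less_le_trans[OF i2] p unfolding prime_block_def by blast
    then have "i < 2 ^ Suc j" by (simp only: power_strict_increasing_iff)
    ultimately show "p \<in> (\<Union>i\<in>?I. ?D i)"
      using i1 i2 p by (intro UN_I[of i]) (auto simp: prime_block_def)
  qed
  then have "(\<Sum>p\<in>prime_block j. 1 / real p) \<le> (\<Sum>p\<in>(\<Union>i\<in>?I. ?D i). 1 / real p)"
    using finD by (intro sum_mono2) auto
  also have "\<dots> \<le> (\<Sum>i\<in>?I. \<Sum>p\<in>?D i. 1 / real p)"
  proof -
    have "(\<Sum>p\<in>(\<Union>i\<in>J. ?D i). 1 / real p) \<le> (\<Sum>i\<in>J. \<Sum>p\<in>?D i. 1 / real p)" if "finite J" for J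
      using that
    proof (induction J rule: finite_induct)
      case (insert k J)
      have "(\<Sum>p\<in>(\<Union>i\<in>insert k J. ?D i). 1 / real p) \<le> (\<Sum>p\<in>?D k. 1 / real p) + (\<Sum>p\<in>(\<Union>i\<in>J. ?D i). 1 / real p)"
        using finD insert.hyps(1) sum.union_inter[of "?D k" "\<Union>i\<in>J. ?D i" "\<lambda>p. 1 / real p"]
          sum_nonneg[of "?D k \<inter> (\<Union>i\<in>J. ?D i)" "\<lambda>p. 1 / real p"] by simp
      then show ?case using insert by simp
    qed simp
    then show ?thesis by simp
  qed
  also have "\<dots> \<le> (\<Sum>i\<in>?I. 2 / 2 ^ j)"
  proof (intro sum_mono)
    fix i assume i: "i \<in> ?I"
    then have "real (2 ^ j) \<le> real i" by (subst of_nat_le_iff) auto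
    moreover have "i > 0" using i by (cases i) auto
    ultimately have "2 / real i \<le> 2 / 2 ^ j" by (intro divide_left_mono) auto
    then show "(\<Sum>p\<in>?D i. 1 / real p) \<le> 2 / 2 ^ j"
      using sum_inverse_primes_dyadic[OF \<open>i > 0\<close>] by linarith
  qed
  also have "\<dots> = 2" by (simp add: of_nat_diff)
  finally show ?thesis .
qed

lemma prime_block_disjoint:
  assumes "i \<noteq> j"
  shows "prime_block i \<inter> prime_block j = {}"
proof -
  have "prime_block i \<inter> prime_block j = {}" if "i < j" for i j
  proof -
    have "(2 :: nat) ^ 2 ^ Suc i \<le> 2 ^ 2 ^ j"
      using that by (intro power_increasing) auto
    then show ?thesis by (force simp: prime_block_def simp del: power_Suc power_increasing_iff)
  qed
  then show ?thesis using assms by (metis inf_commute nat_neq_iff)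
qed

lemma prime_block_cover:
  assumes "Factorial_Ring.prime p" "2 ^ 2 ^ j0 < p" "p \<le> 2 ^ 2 ^ (j0 + j)"
  shows "\<exists>i<j. p \<in> prime_block (j0 + i)"
  using assms(3)
proof (induction j)
  case 0
  then show ?case using assms(2) by simp
next
  case (Suc j)
  show ?case
  proof (cases "p \<le> 2 ^ 2 ^ (j0 + j)")
    case True
    then show ?thesis using Suc.IH less_SucI by blast
  next
    case False
    then have "p \<in> prime_block (j0 + j)"
      using Suc.prems assms(1) by (auto simp: prime_block_def)
    then show ?thesis by blast
  qed
qed

section \<open>A lower bound sieve\<close>

lemma exp_le_one_minus:
  fixes x :: real
  assumes "0 \<le> x" "x \<le> 1 / 2"
  shows "exp (- 2 * x) \<le> 1 - x"
proof -
  have "- x - 2 * x\<^sup>2 \<le> ln (1 - x)"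
    using ln_one_minus_pos_lower_bound[of x] assms by simp
  moreover have "2 * x\<^sup>2 \<le> x"
    using mult_right_mono[of x "1/2" x] assms by (simp add: power2_eq_square)
  ultimately have "- 2 * x \<le> ln (1 - x)" by simp
  then show ?thesis using assms by (subst (asm) ln_ge_iff) auto
qed

text \<open>
  This bounds the binary logarithm of the total error of the sieve: the blocks decrease doubly
  exponentially, so linearly growing truncation orders cost no more than a constant multiple of the
  size of the last block.
\<close>

lemma sum_block_exponents:
  "(\<Sum>i<j. 2 ^ (j0 + i + 2) * (2 * (b + (j - 1 - i)) + 1)) \<le> 2 ^ (j0 + j) * (8 * b + 12 :: nat)"
proof (induction j arbitrary: b)
  case (Suc j)
  have "(\<Sum>i<j. 2 ^ (j0 + i + 2) * (2 * (b + (Suc j - 1 - i)) + 1)) =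
      (\<Sum>i<j. 2 ^ (j0 + i + 2) * (2 * (Suc b + (j - 1 - i)) + 1))"
    by (intro sum.cong refl) (auto simp: Suc_diff_Suc)
  also have "\<dots> \<le> 2 ^ (j0 + j) * (8 * Suc b + 12)" by (rule Suc.IH)
  finally show ?case by (simp add: algebra_simps)
qed simp

text \<open>
  The sifting range reaches \<open>2 ^ 2 ^ J\<close> and the interval has length \<open>(2 ^ 2 ^ J) ^ E\<close>, so the primes up
  to a fixed power of the length can be avoided. Only the number \<open>\<kappa>\<close> of residue classes enters the
  constants.
\<close>

lemma exists_avoiding_residues:
  fixes \<kappa> :: nat
  shows "\<exists>j0 E. E > 0 \<and> (\<forall>J\<ge>j0. \<forall>\<Omega> y.
    (\<forall>p. Factorial_Ring.prime p \<and> 2 ^ 2 ^ j0 < p \<and> p \<le> 2 ^ 2 ^ J \<longrightarrow>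
       periodic (int p) (\<Omega> p) \<and> card (\<Omega> p \<inter> {0..<int p}) \<le> \<kappa>) \<longrightarrow>
    (\<exists>n\<in>{y..<y + 2 ^ (E * 2 ^ J)}. \<forall>p. Factorial_Ring.prime p \<and> 2 ^ 2 ^ j0 < p \<and> p \<le> 2 ^ 2 ^ J \<longrightarrow> n \<notin> \<Omega> p))"
proof -
  define K where "K = Suc \<kappa>"
  \<comment> \<open>a lower bound for the proportion of integers that survive one block\<close>
  define v where "v = exp (- 4 * real K)"
  define L where "L = 2 * real K"
  have v: "v > 0" by (simp add: v_def)
  have "(\<lambda>n. (2 * L) ^ n / fact n) \<longlonglongrightarrow> 0"
    using summable_LIMSEQ_zero[OF summable_exp[of "2 * L"]] by (simp add: field_simps)
  then have "\<forall>\<^sub>F n in sequentially. (2 * L) ^ n / fact n < v / 2"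
    using v by (intro order_tendstoD(2)) auto
  then obtain b where b: "(2 * L) ^ n / fact n < v / 2" if "n \<ge> b" for n
    by (auto simp: eventually_sequentially)
  \<comment> \<open>the sieved primes exceed \<open>2 * K\<close>, which makes all local densities at most \<open>1 / 2\<close>\<close>
  define j0 where "j0 = 2 * K"
  define a where "a = 8 * K"
  define c where "c = 8 * b + 12"
  define E where "E = c + a + 2"
  have exp_self: "n < 2 ^ n" for n :: nat by (rule less_exp)
  have j0: "2 * K \<le> 2 ^ 2 ^ j0"
    using exp_self[of j0] exp_self[of "2 ^ j0"] unfolding j0_def by linarith
  have va: "1 / 2 ^ a \<le> v"
  proof -
    have "exp (4 * real K) = exp 1 ^ (4 * K)" by (simp flip: exp_of_nat_mult)
    also have "\<dots> \<le> 4 ^ (4 * K)" using exp_le by (intro power_mono) auto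
    also have "\<dots> = 2 ^ a" by (simp add: a_def power_mult flip: power_mult_distrib)
    finally have "1 / 2 ^ a \<le> 1 / exp (4 * real K)" by (intro divide_left_mono) auto
    then show ?thesis by (simp add: v_def exp_minus field_simps)
  qed
  have main: "\<exists>n\<in>{y..<y + 2 ^ (E * 2 ^ J)}. \<forall>p. Factorial_Ring.prime p \<and> 2 ^ 2 ^ j0 < p \<and> p \<le> 2 ^ 2 ^ J \<longrightarrow> n \<notin> \<Omega> p"
    if "J \<ge> j0" and \<Omega>: "\<And>p. Factorial_Ring.prime p \<and> 2 ^ 2 ^ j0 < p \<and> p \<le> 2 ^ 2 ^ J \<Longrightarrow>
       periodic (int p) (\<Omega> p) \<and> card (\<Omega> p \<inter> {0..<int p}) \<le> \<kappa>" for J \<Omega> y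
  proof -
    define j where "j = J - j0"
    have J: "J = j0 + j" using that(1) by (simp add: j_def)
    define P where "P i = (if i < j then prime_block (j0 + i) else {})" for i
    \<comment> \<open>even truncation orders, growing from the last block backwards\<close>
    define bb where "bb i = 2 * (b + (j - 1 - i))" for i
    define g where "g p = card (\<Omega> p \<inter> {0..<int p}) / real p" for p
    define h where "h n p = (of_bool (n \<in> \<Omega> p) :: real)" for n p
    define s where "s i = (1 / 2) ^ (j - i) / (2 :: real)" for i
    define R where "R i = (2 :: real) ^ (2 ^ (j0 + i + 2) * (2 * (b + (j - 1 - i)) + 1))" for i
    define X :: nat where "X = 2 ^ (E * 2 ^ J)"
    have P: "Factorial_Ring.prime p \<and> 2 ^ 2 ^ j0 < p \<and> p \<le> 2 ^ 2 ^ J" if "p \<in> P i" for i p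
    proof -
      have i: "i < j" "p \<in> prime_block (j0 + i)" using that by (auto simp: P_def split: if_splits)
      have "(2 :: nat) ^ 2 ^ j0 \<le> 2 ^ 2 ^ (j0 + i)" "(2 :: nat) ^ 2 ^ Suc (j0 + i) \<le> 2 ^ 2 ^ J"
        using i(1) J by (intro power_increasing; simp)+
      then show ?thesis
        using i(2) le_less_trans[of "2 ^ 2 ^ j0" "2 ^ 2 ^ (j0 + i)" p] order_trans[of p "2 ^ 2 ^ Suc (j0 + i)" "2 ^ 2 ^ J"]
        unfolding prime_block_def by blast
    qed
    have gK: "0 \<le> g p" "g p \<le> K * (1 / real p)" "g p \<le> 1 / 2" if "p \<in> P i" for i p
    proof -
      have p: "p > 0" "2 * K \<le> p" using P[OF that] j0 by (auto simp: prime_gt_0_nat)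
      show "0 \<le> g p" by (simp add: g_def)
      have "real (card (\<Omega> p \<inter> {0..<int p})) \<le> real K" using \<Omega>[OF P[OF that]] by (simp add: K_def)
      then show 1: "g p \<le> K * (1 / real p)" using p by (simp add: g_def divide_right_mono)
      have "2 * real K \<le> real p" using p(2) by linarith
      then have "K * (1 / real p) \<le> 1 / 2" using p by (simp add: field_simps)
      with 1 show "g p \<le> 1 / 2" by linarith
    qed
    have finP: "finite (P i)" for i by (simp add: P_def finite_prime_block)
    have sumg: "(\<Sum>p\<in>P i. g p) \<le> L" for i
    proof -
      have "(\<Sum>p\<in>P i. g p) \<le> (\<Sum>p\<in>P i. K * (1 / real p))" using gK(2) by (intro sum_mono)
      also have "\<dots> = K * (\<Sum>p\<in>P i. 1 / real p)" by (simp only: sum_distrib_left)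
      also have "\<dots> \<le> real K * 2"
        using sum_inverse_prime_block[of "j0 + i"] by (intro mult_left_mono) (auto simp: P_def)
      finally show ?thesis by (simp add: L_def)
    qed
    have "\<exists>n\<in>{y..<y + int X}. \<forall>i<j. \<forall>p\<in>P i. h n p = 0"
    proof (rule sieve_weights_positive[where g = g and b = bb and v = v and s = s and R = R and \<kappa> = "real K" and X = "real X"])
      show "finite (P i)" "even (bb i)" for i by (simp_all add: finP bb_def)
      show "P i \<inter> P k = {}" if "i \<noteq> k" for i k using that prime_block_disjoint by (simp add: P_def)
      show "0 \<le> g p \<and> g p \<le> 1" if "p \<in> P i" for i p using gK[OF that] by simp
      show "h n p = 0 \<or> h n p = 1" for n p by (simp add: h_def)
      show "v > 0" by fact
      show "s i \<ge> 0" for i by (simp add: s_def)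
      show "v \<le> (\<Prod>p\<in>P i. 1 - g p)" for i
      proof -
        have "v \<le> exp (- 2 * (\<Sum>p\<in>P i. g p))" using sumg[of i] by (simp add: v_def L_def)
        also have "\<dots> = (\<Prod>p\<in>P i. exp (- 2 * g p))" by (simp only: sum_distrib_left exp_sum[OF finP])
        also have "\<dots> \<le> (\<Prod>p\<in>P i. 1 - g p)" using gK by (intro prod_mono conjI exp_le_one_minus) auto
        finally show ?thesis .
      qed
      show "esym g (P i) (Suc (bb i)) \<le> s i * v" if "i < j" for i
      proof -
        let ?k = "Suc (bb i)"
        have "esym g (P i) ?k \<le> (\<Sum>p\<in>P i. g p) ^ ?k / fact ?k" using finP gK(1) by (intro esym_le)
        also have "\<dots> \<le> L ^ ?k / fact ?k"
          using gK(1) sumg by (intro divide_right_mono power_mono sum_nonneg) auto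
        also have "\<dots> = ((2 * L) ^ ?k / fact ?k) * (1 / 2) ^ ?k"
          by (simp add: power_mult_distrib power_divide)
        also have "\<dots> \<le> (v / 2) * (1 / 2) ^ ?k"
          using b[of ?k] by (intro mult_right_mono) (auto simp: bb_def)
        also have "\<dots> \<le> (v / 2) * (1 / 2) ^ (j - i)"
          using v that by (intro mult_left_mono power_decreasing) (auto simp: bb_def)
        finally show ?thesis by (simp add: s_def mult.commute)
      qed
      show "(\<Sum>i<j. s i) \<le> 1 / 2"
      proof -
        have "(\<Sum>i<k. (1 / 2) ^ (k - i)) \<le> (1 :: real)" for k :: nat
        proof (induction k)
          case (Suc k)
          have "(\<Sum>i<k. (1 / 2) ^ (Suc k - i)) = (1 / 2) * (\<Sum>i<k. (1 / 2) ^ (k - i) :: real)"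
            unfolding sum_distrib_left by (intro sum.cong refl) (simp add: Suc_diff_le)
          then show ?case using Suc by simp
        qed simp
        then show ?thesis by (simp add: s_def flip: sum_divide_distrib)
      qed
      show "(1 + real K * card (P i)) ^ Suc (bb i) \<le> R i" if "i < j" for i
      proof -
        define m :: nat where "m = 2 ^ 2 ^ Suc (j0 + i)"
        have "P i \<subseteq> {1..m}" using that by (auto simp: P_def prime_block_def m_def prime_gt_0_nat Suc_le_eq)
        then have "card (P i) \<le> m" using card_mono[of "{1..m}"] by fastforce
        moreover have "Suc K \<le> m"
        proof -
          have "(2 :: nat) ^ 2 ^ j0 \<le> m" unfolding m_def by (intro power_increasing) auto
          then show ?thesis using j0 by (simp add: K_def)
        qed
        ultimately have "1 + K * card (P i) \<le> m + K * m" by (intro add_mono mult_left_mono) auto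
        also have "\<dots> = Suc K * m" by simp
        also have "\<dots> \<le> m * m" using \<open>Suc K \<le> m\<close> by (intro mult_right_mono) auto
        also have "m * m = 2 ^ 2 ^ (j0 + i + 2)"
          by (simp add: m_def flip: power_add power2_eq_square power_mult)
        finally have "real (1 + K * card (P i)) \<le> real (2 ^ 2 ^ (j0 + i + 2))" by (rule of_nat_mono)
        then have "(1 + real K * card (P i)) ^ Suc (bb i) \<le> (2 ^ 2 ^ (j0 + i + 2)) ^ Suc (bb i)"
          by (intro power_mono) auto
        also have "\<dots> = R i" unfolding R_def bb_def Suc_eq_plus1 by (simp only: power_mult)
        finally show ?thesis .
      qed
      show "\<bar>(\<Sum>n\<in>{y..<y + int X}. \<Prod>p\<in>T. h n p) - real X * (\<Prod>p\<in>T. g p)\<bar> \<le> real K ^ card T"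
        if "T \<subseteq> (\<Union>i<j. P i)" for T
      proof -
        have T: "Factorial_Ring.prime p \<and> periodic (int p) (\<Omega> p) \<and> card (\<Omega> p \<inter> {0..<int p}) \<le> K" if "p \<in> T" for p
        proof -
          from that \<open>T \<subseteq> (\<Union>i<j. P i)\<close> obtain i where "p \<in> P i" by auto
          from \<Omega>[OF P[OF this]] P[OF this] show ?thesis by (simp add: K_def)
        qed
        have "finite T" by (rule finite_subset[OF that]) (simp add: finP)
        then show ?thesis
          unfolding h_def g_def using T by (intro sum_periodic_density) auto
      qed
      show "real (Suc j) * (\<Prod>i<j. R i) < real X * v ^ j / 2"
      proof -
        let ?M = "2 ^ J :: nat"
        have "(\<Prod>i<j. R i) = 2 ^ (\<Sum>i<j. 2 ^ (j0 + i + 2) * (2 * (b + (j - 1 - i)) + 1))"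
          by (simp add: R_def power_sum)
        also have "\<dots> \<le> 2 ^ (?M * c)"
          unfolding c_def J by (intro power_increasing sum_block_exponents) auto
        finally have 1: "(\<Prod>i<j. R i) \<le> 2 ^ (?M * c)" .
        have "j < ?M" using exp_self[of J] J by linarith
        then have "Suc j \<le> ?M" by simp
        also have "\<dots> < 2 ^ ?M" by (rule exp_self)
        finally have "real (Suc j) < real (2 ^ ?M)" by (rule of_nat_less_iff[THEN iffD2])
        then have "real (Suc j) < 2 ^ ?M" by simp
        then have "real (Suc j) * (\<Prod>i<j. R i) < 2 ^ ?M * 2 ^ (?M * c)"
          using 1 by (intro mult_less_le_imp_less) (auto simp: R_def intro: prod_pos)
        also have "\<dots> = 2 ^ (?M * (c + 1))" by (simp add: power_add)
        also have "\<dots> \<le> real X * (1 / 2 ^ a) ^ j / 2"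
        proof -
          have "?M * (c + 1) + (a * j + 1) \<le> E * ?M"
          proof -
            have "a * j \<le> a * ?M" using \<open>j < ?M\<close> by (intro mult_left_mono) auto
            moreover have "1 \<le> ?M" by simp
            moreover have "E * ?M = ?M * (c + 1) + a * ?M + ?M" by (simp add: E_def algebra_simps)
            ultimately show ?thesis by linarith
          qed
          then have "(2 :: real) ^ (?M * (c + 1) + (a * j + 1)) \<le> 2 ^ (E * ?M)"
            by (intro power_increasing) auto
          then have "2 ^ (?M * (c + 1)) * (2 ^ (a * j) * 2) \<le> real X"
            by (simp add: X_def power_add)
          moreover have "real X * (1 / 2 ^ a) ^ j / 2 = real X / (2 ^ (a * j) * 2)"
            by (simp add: power_divide flip: power_mult)
          ultimately show ?thesis by (simp only: pos_le_divide_eq zero_less_mult_iff zero_less_power zero_less_numeral simp_thms)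
        qed
        also have "\<dots> \<le> real X * v ^ j / 2"
          using va by (intro divide_right_mono mult_left_mono power_mono) auto
        finally show ?thesis .
      qed
    qed auto
    then obtain n where n: "n \<in> {y..<y + int X}" "\<And>i p. i < j \<Longrightarrow> p \<in> P i \<Longrightarrow> h n p = 0" by blast
    have "n \<notin> \<Omega> p" if "Factorial_Ring.prime p \<and> 2 ^ 2 ^ j0 < p \<and> p \<le> 2 ^ 2 ^ J" for p
    proof -
      from that obtain i where "i < j" "p \<in> prime_block (j0 + i)" using prime_block_cover[of p j0 j] J by auto
      then have "h n p = 0" using n(2)[of i p] by (simp add: P_def)
      then show ?thesis by (simp add: h_def)
    qed
    moreover have "n \<in> {y..<y + 2 ^ (E * 2 ^ J)}" using n(1) by (simp add: X_def)
    ultimately show ?thesis by blast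
  qed
  moreover have "E > 0" by (simp add: E_def)
  ultimately show ?thesis by blast
qed

section \<open>Unique factorization over a subring\<close>

text \<open>
  Rings are given as subsets of an integral domain. The polynomial rings in any number of variables
  then live in one type, and induction on the number of variables is possible.
\<close>

definition subring_of :: "'a::idom set \<Rightarrow> bool"
  where "subring_of A \<longleftrightarrow> 1 \<in> A \<and> (\<forall>x\<in>A. \<forall>y\<in>A. x - y \<in> A \<and> x * y \<in> A)"

lemma subring_ofD:
  assumes "subring_of A"
  shows "0 \<in> A" "1 \<in> A" "x \<in> A \<Longrightarrow> y \<in> A \<Longrightarrow> x + y \<in> A" "x \<in> A \<Longrightarrow> y \<in> A \<Longrightarrow> x - y \<in> A"
    "x \<in> A \<Longrightarrow> y \<in> A \<Longrightarrow> x * y \<in> A" "x \<in> A \<Longrightarrow> - x \<in> A"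
proof -
  show 1: "1 \<in> A" using assms by (simp add: subring_of_def)
  show d: "x \<in> A \<Longrightarrow> y \<in> A \<Longrightarrow> x - y \<in> A" for x y using assms by (simp add: subring_of_def)
  show 0: "0 \<in> A" using d[OF 1 1] by simp
  show m: "x \<in> A \<Longrightarrow> - x \<in> A" for x using d[OF 0, of x] by simp
  show "x \<in> A \<Longrightarrow> y \<in> A \<Longrightarrow> x + y \<in> A" using d[OF _ m, of x y] by simp
  show "x \<in> A \<Longrightarrow> y \<in> A \<Longrightarrow> x * y \<in> A" using assms by (simp add: subring_of_def)
qed

lemma subring_of_sum:
  assumes "subring_of A" "\<And>i. i \<in> I \<Longrightarrow> f i \<in> A"
  shows "sum f I \<in> A"
  using assms(2) by (induction I rule: infinite_finite_induct) (auto intro: subring_ofD[OF assms(1)])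

definition unit_in :: "'a::idom set \<Rightarrow> 'a \<Rightarrow> bool"
  where "unit_in A x \<longleftrightarrow> x \<in> A \<and> (\<exists>y\<in>A. x * y = 1)"

definition dvd_in :: "'a::idom set \<Rightarrow> 'a \<Rightarrow> 'a \<Rightarrow> bool"
  where "dvd_in A x y \<longleftrightarrow> (\<exists>z\<in>A. y = x * z)"

definition irreducible_in :: "'a::idom set \<Rightarrow> 'a \<Rightarrow> bool"
  where "irreducible_in A x \<longleftrightarrow> x \<in> A \<and> x \<noteq> 0 \<and> \<not> unit_in A x \<and>
    (\<forall>a\<in>A. \<forall>b\<in>A. x = a * b \<longrightarrow> unit_in A a \<or> unit_in A b)"

definition prime_in :: "'a::idom set \<Rightarrow> 'a \<Rightarrow> bool"
  where "prime_in A x \<longleftrightarrow> (\<forall>a\<in>A. \<forall>b\<in>A. dvd_in A x (a * b) \<longrightarrow> dvd_in A x a \<or> dvd_in A x b)"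

text \<open>
  An additive norm that vanishes exactly on units, such as the number of irreducible factors, gives
  the existence of factorizations.
\<close>

definition factorial_norm :: "'a::idom set \<Rightarrow> ('a \<Rightarrow> nat) \<Rightarrow> bool"
  where "factorial_norm A \<mu> \<longleftrightarrow>
    (\<forall>x\<in>A - {0}. \<forall>y\<in>A - {0}. \<mu> (x * y) = \<mu> x + \<mu> y) \<and> (\<forall>x\<in>A - {0}. \<mu> x = 0 \<longleftrightarrow> unit_in A x)"

definition factorial_subring :: "'a::idom set \<Rightarrow> bool"
  where "factorial_subring A \<longleftrightarrow> subring_of A \<and> (\<exists>\<mu>. factorial_norm A \<mu>) \<and>
    (\<forall>x. irreducible_in A x \<longrightarrow> prime_in A x)"

definition polys_over :: "'a::idom set \<Rightarrow> 'a poly set"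
  where "polys_over A = {p. \<forall>i. coeff p i \<in> A}"

lemma coeff_in: "p \<in> polys_over A \<Longrightarrow> coeff p i \<in> A"
  by (simp add: polys_over_def)


lemma dvd_in_trans:
  assumes "subring_of A" "dvd_in A x y" "dvd_in A y z"
  shows "dvd_in A x z"
  using assms unfolding dvd_in_def by (metis mult.assoc subring_ofD(5))

lemma irreducible_factor_exists:
  assumes "subring_of A" "factorial_norm A \<mu>" "x \<in> A" "x \<noteq> 0" "\<not> unit_in A x"
  shows "\<exists>p. irreducible_in A p \<and> dvd_in A p x"
  using assms(3-)
proof (induction "\<mu> x" arbitrary: x rule: less_induct)
  case less
  show ?case
  proof (cases "irreducible_in A x")
    case True
    have "dvd_in A x x"
      unfolding dvd_in_def using subring_ofD(2)[OF assms(1)] by (intro bexI[of _ 1]) auto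
    then show ?thesis using True by blast
  next
    case False
    then obtain a b where ab: "a \<in> A" "b \<in> A" "x = a * b" "\<not> unit_in A a" "\<not> unit_in A b"
      using less.prems by (auto simp: irreducible_in_def)
    then have "\<mu> x = \<mu> a + \<mu> b" "\<mu> b \<noteq> 0"
      using assms(2) less.prems by (auto simp: factorial_norm_def)
    then obtain p where "irreducible_in A p" "dvd_in A p a"
      using less.hyps[of a] ab less.prems by auto
    then show ?thesis
      using ab dvd_in_trans[OF assms(1), of p a x] by (auto simp: dvd_in_def)
  qed
qed

lemma pCons_in_polys_over [simp]:
  "pCons a p \<in> polys_over A \<longleftrightarrow> a \<in> A \<and> p \<in> polys_over A"
proof
  assume *: "pCons a p \<in> polys_over A"
  show "a \<in> A \<and> p \<in> polys_over A"
    using coeff_in[OF *, of 0] coeff_in[OF *, of "Suc i" for i] by (auto simp: polys_over_def)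
qed (auto simp: polys_over_def coeff_pCons split: nat.split)

lemma subring_of_polys_over:
  assumes "subring_of A"
  shows "subring_of (polys_over A)"
proof -
  note A = subring_ofD[OF assms]
  have "1 \<in> polys_over A"
    using A by (simp add: polys_over_def coeff_1)
  moreover have "p - q \<in> polys_over A" "p * q \<in> polys_over A"
    if "p \<in> polys_over A" "q \<in> polys_over A" for p q
    using that A by (auto simp: polys_over_def coeff_mult intro!: subring_of_sum[OF assms])
  ultimately show ?thesis by (simp add: subring_of_def)
qed

lemma smult_in_polys_over:
  assumes "subring_of A" "a \<in> A" "p \<in> polys_over A"
  shows "smult a p \<in> polys_over A"
  using assms by (simp add: polys_over_def subring_ofD(5))

lemma const_dvd_iff:
  assumes "subring_of A"
  shows "(\<exists>h\<in>polys_over A. f = smult a h) \<longleftrightarrow> (\<forall>i. dvd_in A a (coeff f i))"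
proof
  assume "\<forall>i. dvd_in A a (coeff f i)"
  then show "\<exists>h\<in>polys_over A. f = smult a h"
  proof (induction f)
    case 0
    show ?case using subring_ofD(1)[OF subring_of_polys_over[OF assms]] by (intro bexI[of _ 0]) auto
  next
    case (pCons c f)
    have "dvd_in A a (coeff f i)" for i
      using pCons.prems[rule_format, of "Suc i"] by simp
    then obtain h where h: "h \<in> polys_over A" "f = smult a h" using pCons.IH by blast
    obtain z where "z \<in> A" "c = a * z" using pCons.prems[rule_format, of 0] by (auto simp: dvd_in_def)
    with h show ?case by (intro bexI[of _ "pCons z h"]) auto
  qed
qed (auto simp: dvd_in_def polys_over_def)

text \<open>
  Gauss's lemma for a prime constant, by comparing lowest coefficients: if \<open>p\<close> divides the
  constant coefficient of one factor, that coefficient can be removed from the factor.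
\<close>

lemma prime_in_const:
  assumes A: "subring_of A" and p: "prime_in A p" "p \<in> A"
    and "f \<in> polys_over A" "g \<in> polys_over A" "h \<in> polys_over A" "f * g = smult p h"
  shows "(\<exists>h\<in>polys_over A. f = smult p h) \<or> (\<exists>h\<in>polys_over A. g = smult p h)"
  using assms(4-)
proof (induction f arbitrary: g h)
  case 0
  then show ?case using subring_ofD(1)[OF subring_of_polys_over[OF A]] by (intro disjI1 bexI[of _ 0]) auto
next
  case (pCons a f)
  note P = subring_ofD[OF subring_of_polys_over[OF A]]
  have a: "a \<in> A" "f \<in> polys_over A" using pCons.prems by auto
  show ?case
  proof (cases "dvd_in A p a")
    case True
    then obtain z where z: "z \<in> A" "a = p * z" by (auto simp: dvd_in_def)
    have "pCons 0 (f * g) = smult p (h - smult z g)"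
      using pCons.prems(4) z by (simp add: smult_diff_right algebra_simps)
    moreover have "h - smult z g \<in> polys_over A"
      using pCons.prems z by (intro P smult_in_polys_over[OF A])
    moreover obtain c k where ck: "h - smult z g = pCons c k" by (cases "h - smult z g")
    ultimately have "f * g = smult p k" "k \<in> polys_over A" by auto
    then consider "\<exists>h\<in>polys_over A. f = smult p h" | "\<exists>h\<in>polys_over A. g = smult p h"
      using pCons.IH[OF a(2) pCons.prems(2)] by blast
    then show ?thesis
    proof cases
      case 1
      then obtain h' where "h' \<in> polys_over A" "f = smult p h'" by blast
      with z show ?thesis by (intro disjI1 bexI[of _ "pCons z h'"]) auto
    qed blast
  next
    case False
    have "\<exists>h\<in>polys_over A. g = smult p h"
      using pCons.prems(2-)
    proof (induction g arbitrary: h)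
      case 0
      then show ?case using P(1) by (intro bexI[of _ 0]) auto
    next
      case (pCons b g)
      let ?f = "pCons a f"
      have b: "b \<in> A" "g \<in> polys_over A" "?f \<in> polys_over A" using pCons.prems a by auto
      have "a * b = coeff (?f * pCons b g) 0" by (simp add: coeff_mult)
      then have "a * b = p * coeff h 0" by (simp only: pCons.prems(3) coeff_smult)
      then have "dvd_in A p (a * b)" using coeff_in[OF pCons.prems(2)] by (auto simp: dvd_in_def)
      then have "dvd_in A p b" using p False a b by (auto simp: prime_in_def)
      then obtain z where z: "z \<in> A" "b = p * z" by (auto simp: dvd_in_def)
      have "pCons 0 (?f * g) = smult p (h - smult z ?f)"
        using pCons.prems(3) z by (simp add: smult_diff_right algebra_simps)
      moreover have "h - smult z ?f \<in> polys_over A"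
        using pCons.prems z b by (intro P smult_in_polys_over[OF A])
      moreover obtain c k where ck: "h - smult z ?f = pCons c k" by (cases "h - smult z ?f")
      ultimately have "?f * g = smult p k" "k \<in> polys_over A" by auto
      then obtain h' where "h' \<in> polys_over A" "g = smult p h'" using pCons.IH[OF b(2)] by blast
      with z show ?case by (intro bexI[of _ "pCons z h'"]) auto
    qed
    then show ?thesis ..
  qed
qed

definition primitive_in :: "'a::idom set \<Rightarrow> 'a poly \<Rightarrow> bool"
  where "primitive_in A G \<longleftrightarrow> G \<in> polys_over A \<and> G \<noteq> 0 \<and>
    (\<forall>a\<in>A. \<forall>h\<in>polys_over A. G = smult a h \<longrightarrow> unit_in A a)"

lemma primitive_part_exists:
  assumes A: "subring_of A" and \<mu>: "factorial_norm A \<mu>" and "G \<in> polys_over A" "G \<noteq> 0"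
  shows "\<exists>a\<in>A. \<exists>H. G = smult a H \<and> primitive_in A H"
  using assms(3-)
proof (induction "\<mu> (lead_coeff G)" arbitrary: G rule: less_induct)
  case less
  show ?case
  proof (cases "primitive_in A G")
    case True
    then show ?thesis using subring_ofD(2)[OF A] by (intro bexI[of _ 1] exI[of _ G]) auto
  next
    case False
    then obtain a H where aH: "a \<in> A" "H \<in> polys_over A" "G = smult a H" "\<not> unit_in A a"
      using less.prems by (auto simp: primitive_in_def)
    then have nz: "a \<noteq> 0" "H \<noteq> 0" "lead_coeff H \<in> A" using less.prems by (auto simp: coeff_in)
    then have "\<mu> (lead_coeff G) = \<mu> a + \<mu> (lead_coeff H)" "\<mu> a \<noteq> 0"
      using \<mu> aH by (auto simp: factorial_norm_def)
    then obtain b H' where "b \<in> A" "H = smult b H'" "primitive_in A H'"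
      using less.hyps[of H] aH nz by auto
    then show ?thesis
      using aH by (intro bexI[of _ "a * b"] exI[of _ H']) (auto intro: subring_ofD[OF A])
  qed
qed

text \<open>
  The constant \<open>c\<close> is removed one irreducible factor at a time: such a factor is prime, it divides
  \<open>Q * G\<close> and it cannot divide the primitive polynomial \<open>G\<close>.
\<close>

lemma primitive_dvd_cancel:
  assumes A: "factorial_subring A" and G: "primitive_in A G"
    and "c \<in> A" "c \<noteq> 0" "P \<in> polys_over A" "Q \<in> polys_over A" "smult c P = Q * G"
  shows "dvd_in (polys_over A) G P"
proof -
  have sub: "subring_of A" using A by (simp add: factorial_subring_def)
  obtain \<mu> where \<mu>: "factorial_norm A \<mu>" using A by (auto simp: factorial_subring_def)
  show ?thesis
    using assms(3-)
  proof (induction "\<mu> c" arbitrary: c Q rule: less_induct)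
    case less
    show ?case
    proof (cases "unit_in A c")
      case True
      then obtain d where d: "d \<in> A" "c * d = 1" by (auto simp: unit_in_def)
      have "smult d (smult c P) = P" using d by (simp add: mult.commute)
      then have "P = G * smult d Q" using less.prems by (simp add: mult.commute)
      then show ?thesis
        using smult_in_polys_over[OF sub d(1) less.prems(4)] unfolding dvd_in_def by blast
    next
      case False
      then obtain p where p: "irreducible_in A p" "dvd_in A p c"
        using irreducible_factor_exists[OF sub \<mu> less.prems(1,2)] by blast
      then obtain c' where c': "c' \<in> A" "c = p * c'" by (auto simp: dvd_in_def)
      have pA: "p \<in> A" "p \<noteq> 0" "\<not> unit_in A p" "prime_in A p"
        using p A by (auto simp: irreducible_in_def factorial_subring_def)
      have "Q * G = smult p (smult c' P)" using less.prems c' by simp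
      moreover have "G \<in> polys_over A" using G by (simp add: primitive_in_def)
      ultimately have "(\<exists>h\<in>polys_over A. Q = smult p h) \<or> (\<exists>h\<in>polys_over A. G = smult p h)"
        using prime_in_const[OF sub pA(4,1)] less.prems smult_in_polys_over[OF sub c'(1)] by blast
      moreover have "\<not> (\<exists>h\<in>polys_over A. G = smult p h)"
        using G pA by (auto simp: primitive_in_def)
      ultimately obtain Q' where Q': "Q' \<in> polys_over A" "Q = smult p Q'" by blast
      have "smult p (smult c' P) = smult p (Q' * G)" using less.prems c' Q' by simp
      then have "smult c' P = Q' * G" using pA by (metis smult_cancel)
      moreover have "c' \<noteq> 0" "\<mu> c = \<mu> p + \<mu> c'" "\<mu> p \<noteq> 0"
        using c' less.prems pA \<mu> by (auto simp: factorial_norm_def)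
      ultimately show ?thesis
        using less.hyps[of c' Q'] c' less.prems Q' by auto
    qed
  qed
qed

definition ideal_in :: "'a::idom set \<Rightarrow> 'a set \<Rightarrow> bool"
  where "ideal_in A I \<longleftrightarrow> I \<subseteq> A \<and> (\<forall>x\<in>I. \<forall>y\<in>I. x - y \<in> I) \<and> (\<forall>x\<in>I. \<forall>a\<in>A. a * x \<in> I)"

text \<open>
  This plays the role of the Euclidean algorithm over the fraction field of \<open>A\<close>. A non-zero element
  \<open>G\<close> of least degree divides every element of the ideal after multiplication by a constant, by
  pseudo-division. If \<open>G\<close> is not constant, its primitive part divides without that constant.
\<close>

lemma ideal_const_or_common_divisor:
  assumes A: "factorial_subring A" and I: "ideal_in (polys_over A) I" and "\<exists>f\<in>I. f \<noteq> 0"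
  shows "(\<exists>c\<in>A - {0}. [:c:] \<in> I) \<or>
    (\<exists>G. primitive_in A G \<and> degree G > 0 \<and> (\<forall>f\<in>I. dvd_in (polys_over A) G f))"
proof -
  have sub: "subring_of A" using A by (simp add: factorial_subring_def)
  obtain \<mu> where \<mu>: "factorial_norm A \<mu>" using A by (auto simp: factorial_subring_def)
  define n where "n = (LEAST n. \<exists>f\<in>I. f \<noteq> 0 \<and> degree f = n)"
  have "\<exists>n. \<exists>f\<in>I. f \<noteq> 0 \<and> degree f = n" using assms(3) by blast
  then have "\<exists>f\<in>I. f \<noteq> 0 \<and> degree f = n" unfolding n_def by (rule LeastI_ex)
  then obtain G where G: "G \<in> I" "G \<noteq> 0" "degree G = n" by blast
  have min: "n \<le> degree f" if "f \<in> I" "f \<noteq> 0" for f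
    unfolding n_def using that by (intro Least_le) blast
  have IA: "f \<in> polys_over A" if "f \<in> I" for f using that I by (auto simp: ideal_in_def)
  show ?thesis
  proof (cases "n = 0")
    case True
    then obtain c where "G = [:c:]" using G by (metis degree_eq_zeroE)
    then show ?thesis using G IA[OF G(1)] by auto
  next
    case False
    obtain a H where aH: "a \<in> A" "G = smult a H" "primitive_in A H"
      using primitive_part_exists[OF sub \<mu> IA[OF G(1)] G(2)] by blast
    let ?l = "lead_coeff G"
    have l: "?l \<in> A" "?l \<noteq> 0" using IA[OF G(1)] G by (auto simp: coeff_in)
    have div: "\<exists>c\<in>A - {0}. \<exists>Q\<in>polys_over A. smult c f = Q * G" if "f \<in> I" for f
      using that
    proof (induction "degree f" arbitrary: f rule: less_induct)
      case less
      show ?case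
      proof (cases "f = 0")
        case True
        then show ?thesis
          using subring_ofD[OF sub] subring_ofD(1)[OF subring_of_polys_over[OF sub]]
          by (intro bexI[of _ 1] bexI[of _ 0]) auto
      next
        case False
        define q where "q = monom (lead_coeff f) (degree f - n)"
        define f' where "f' = smult ?l f - q * G"
        have fA: "f \<in> polys_over A" using IA less.prems by blast
        have q: "q \<in> polys_over A"
          using coeff_in[OF fA] subring_ofD(1)[OF sub] by (auto simp: q_def polys_over_def)
        have "[:?l:] \<in> polys_over A"
          using l subring_ofD(1)[OF subring_of_polys_over[OF sub]] by simp
        then have "[:?l:] * f \<in> I" using I less.prems unfolding ideal_in_def by blast
        moreover have "q * G \<in> I" using I G(1) q unfolding ideal_in_def by blast
        ultimately have f'I: "f' \<in> I" using I by (simp add: f'_def ideal_in_def)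
        have nf: "n \<le> degree f" using min less.prems False by blast
        have "f' = 0 \<or> degree f' < degree f"
        proof (rule disjCI)
          assume nd: "\<not> degree f' < degree f"
          have dq: "degree (q * G) = degree f"
            using False G nf by (simp add: q_def degree_mult_eq degree_monom_eq monom_eq_0_iff)
          have "degree f' \<le> degree f"
            unfolding f'_def using dq l by (intro degree_diff_le) auto
          with nd have d: "degree f' = degree f" by simp
          have "coeff (q * G) (degree f) = lead_coeff f * ?l"
            using lead_coeff_mult[of q G] dq by (simp add: q_def lead_coeff_monom degree_monom_eq False)
          then have "coeff f' (degree f) = 0" by (simp add: f'_def mult.commute)
          then show "f' = 0" using d by (metis leading_coeff_0_iff)
        qed
        then have "\<exists>c\<in>A - {0}. \<exists>Q\<in>polys_over A. smult c f' = Q * G"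
        proof
          assume "f' = 0"
          then show ?thesis
            using subring_ofD[OF sub] subring_ofD(1)[OF subring_of_polys_over[OF sub]]
            by (intro bexI[of _ 1] bexI[of _ 0]) auto
        qed (use less.hyps f'I in blast)
        then obtain c Q where cQ: "c \<in> A" "c \<noteq> 0" "Q \<in> polys_over A" "smult c f' = Q * G" by blast
        have "smult (c * ?l) f = (Q + smult c q) * G"
          using cQ(4) by (simp add: f'_def smult_diff_right algebra_simps)
        moreover have "c * ?l \<in> A - {0}" using cQ l subring_ofD(5)[OF sub] by simp
        moreover have "Q + smult c q \<in> polys_over A"
          using cQ q by (intro subring_ofD[OF subring_of_polys_over[OF sub]] smult_in_polys_over[OF sub])
        ultimately show ?thesis by blast
      qed
    qed
    have "dvd_in (polys_over A) H f" if fI: "f \<in> I" for f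
    proof -
      obtain c Q where c: "c \<in> A" "c \<noteq> 0" "Q \<in> polys_over A" "smult c f = Q * G"
        using div[OF fI] by blast
      then have "smult c f = smult a Q * H" by (simp add: aH)
      then show ?thesis
        using primitive_dvd_cancel[OF A aH(3) c(1,2) IA[OF fI] smult_in_polys_over[OF sub aH(1) c(3)]] by blast
    qed
    moreover have "degree H > 0" using False G aH by (auto split: if_splits)
    ultimately show ?thesis using aH(3) by blast
  qed
qed

lemma unit_in_polys_over_iff:
  assumes "subring_of A"
  shows "unit_in (polys_over A) p \<longleftrightarrow> (\<exists>a. p = [:a:] \<and> unit_in A a)"
proof
  assume "unit_in (polys_over A) p"
  then obtain q where q: "p \<in> polys_over A" "q \<in> polys_over A" "p * q = 1" by (auto simp: unit_in_def)
  then have "p \<noteq> 0" "q \<noteq> 0" by auto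
  then have "degree p + degree q = 0" using q(3) by (metis degree_1 degree_mult_eq)
  then obtain a b where "p = [:a:]" "q = [:b:]" by (metis add_is_0 degree_eq_zeroE)
  then show "\<exists>a. p = [:a:] \<and> unit_in A a" using q by (auto simp: unit_in_def one_pCons mult.commute)
next
  assume "\<exists>a. p = [:a:] \<and> unit_in A a"
  then obtain a b where "p = [:a:]" "a \<in> A" "b \<in> A" "a * b = 1" by (auto simp: unit_in_def)
  then show "unit_in (polys_over A) p"
    unfolding unit_in_def
    using subring_ofD(1)[OF subring_of_polys_over[OF assms]]
    by (auto intro!: bexI[of _ "[:b:]"] simp: one_pCons)
qed

lemma const_in_polys_over: "subring_of A \<Longrightarrow> a \<in> A \<Longrightarrow> [:a:] \<in> polys_over A"
  using subring_ofD(1)[OF subring_of_polys_over] by simp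

text \<open>
  For a non-constant \<open>p\<close> dividing \<open>f * g\<close> consider the ideal generated by \<open>p\<close> and \<open>f\<close>. If it contains
  a constant \<open>c\<close>, then \<open>p\<close> divides \<open>c * g\<close> and hence \<open>g\<close>. Otherwise \<open>p\<close> and \<open>f\<close> have a non-constant
  common divisor, which is associated to \<open>p\<close>.
\<close>

lemma irreducible_poly_is_prime:
  assumes A: "factorial_subring A" and p: "irreducible_in (polys_over A) p"
  shows "prime_in (polys_over A) p"
proof -
  have sub: "subring_of A" using A by (simp add: factorial_subring_def)
  note P = subring_ofD[OF subring_of_polys_over[OF sub]]
  have pP: "p \<in> polys_over A" "p \<noteq> 0" using p by (auto simp: irreducible_in_def)
  show ?thesis
  proof (cases "degree p = 0")
    case True
    then obtain a where a: "p = [:a:]" by (metis degree_eq_zeroE)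
    have aA: "a \<in> A" using pP a by simp
    have "irreducible_in A a"
      unfolding irreducible_in_def
    proof (intro conjI ballI impI)
      show "\<not> unit_in A a" using p a by (auto simp: irreducible_in_def unit_in_polys_over_iff[OF sub])
      fix b c assume bc: "b \<in> A" "c \<in> A" "a = b * c"
      then have "[:b:] \<in> polys_over A" "[:c:] \<in> polys_over A" "p = [:b:] * [:c:]"
        using const_in_polys_over[OF sub] a by auto
      then have "unit_in (polys_over A) [:b:] \<or> unit_in (polys_over A) [:c:]"
        using p unfolding irreducible_in_def by blast
      then show "unit_in A b \<or> unit_in A c" by (auto simp: unit_in_polys_over_iff[OF sub])
    qed (use aA pP a in auto)
    then have prime: "prime_in A a" using A by (auto simp: factorial_subring_def)
    show ?thesis
      unfolding prime_in_def dvd_in_def a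
      using prime_in_const[OF sub prime aA] by simp blast
  next
    case False
    have prim: "primitive_in A p"
      unfolding primitive_in_def
    proof (intro conjI ballI impI)
      fix a h assume ah: "a \<in> A" "h \<in> polys_over A" "p = smult a h"
      then have "p = [:a:] * h" "[:a:] \<in> polys_over A" using const_in_polys_over[OF sub] by auto
      then have "unit_in (polys_over A) [:a:] \<or> unit_in (polys_over A) h"
        using p ah unfolding irreducible_in_def by blast
      moreover have "degree h \<noteq> 0" using False ah by (auto split: if_splits)
      ultimately show "unit_in A a" by (auto simp: unit_in_polys_over_iff[OF sub])
    qed (use pP in auto)
    show ?thesis
      unfolding prime_in_def
    proof (intro ballI impI)
      fix f g assume fg: "f \<in> polys_over A" "g \<in> polys_over A" "dvd_in (polys_over A) p (f * g)"
      then obtain h where h: "h \<in> polys_over A" "f * g = p * h" by (auto simp: dvd_in_def)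
      define I where "I = {u * p + v * f | u v. u \<in> polys_over A \<and> v \<in> polys_over A}"
      have pI: "p \<in> I" unfolding I_def using P(1,2) by (intro CollectI exI[of _ 1] exI[of _ 0]) auto
      have fI: "f \<in> I" unfolding I_def using P(1,2) by (intro CollectI exI[of _ 0] exI[of _ 1]) auto
      have "ideal_in (polys_over A) I"
        unfolding ideal_in_def
      proof (intro conjI ballI)
        show "I \<subseteq> polys_over A" using P pP fg by (auto simp: I_def)
        fix x assume "x \<in> I"
        then obtain u v where uv: "u \<in> polys_over A" "v \<in> polys_over A" "x = u * p + v * f" by (auto simp: I_def)
        show "a * x \<in> I" if "a \<in> polys_over A" for a
          unfolding I_def using uv that P
          by (intro CollectI exI[of _ "a * u"] exI[of _ "a * v"]) (auto simp: algebra_simps)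
        fix y assume "y \<in> I"
        then obtain u' v' where "u' \<in> polys_over A" "v' \<in> polys_over A" "y = u' * p + v' * f" by (auto simp: I_def)
        then show "x - y \<in> I"
          unfolding I_def using uv P
          by (intro CollectI exI[of _ "u - u'"] exI[of _ "v - v'"]) (auto simp: algebra_simps)
      qed
      note ideal_const_or_common_divisor[OF A this]
      then have "(\<exists>c\<in>A - {0}. [:c:] \<in> I) \<or>
        (\<exists>G. primitive_in A G \<and> degree G > 0 \<and> (\<forall>f\<in>I. dvd_in (polys_over A) G f))"
        using pI pP by blast
      then consider (c) c where "c \<in> A" "c \<noteq> 0" "[:c:] \<in> I"
        | (G) G where "degree G > 0" "G \<in> polys_over A" "\<forall>f\<in>I. dvd_in (polys_over A) G f"
        by (auto simp: primitive_in_def)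
      then show "dvd_in (polys_over A) p f \<or> dvd_in (polys_over A) p g"
      proof cases
        case c
        then obtain u v where uv: "u \<in> polys_over A" "v \<in> polys_over A" "[:c:] = u * p + v * f" by (auto simp: I_def)
        have "smult c g = [:c:] * g" by simp
        also have "\<dots> = (u * g + v * h) * p"
          using h(2) unfolding uv(3) by (simp add: algebra_simps)
        finally have eq: "smult c g = (u * g + v * h) * p" .
        have "u * g + v * h \<in> polys_over A" using uv fg h by (intro P)
        then show ?thesis
          using primitive_dvd_cancel[OF A prim c(1,2) fg(2) _ eq] by blast
      next
        case G
        then obtain k where k: "k \<in> polys_over A" "p = G * k" using pI by (auto simp: dvd_in_def)
        then have "unit_in (polys_over A) G \<or> unit_in (polys_over A) k"
          using p G unfolding irreducible_in_def by blast
        then have "unit_in (polys_over A) k" using G(1) by (auto simp: unit_in_polys_over_iff[OF sub])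
        then obtain k' where k': "k' \<in> polys_over A" "k * k' = 1" by (auto simp: unit_in_def)
        then have "G = p * k'" using k by (simp add: mult.assoc)
        moreover obtain w where "w \<in> polys_over A" "f = G * w" using G fI by (auto simp: dvd_in_def)
        ultimately have "f = p * (k' * w)" "k' * w \<in> polys_over A" using k' P by (auto simp: mult.assoc)
        then show ?thesis by (auto simp: dvd_in_def)
      qed
    qed
  qed
qed

lemma factorial_polys_over:
  assumes A: "factorial_subring A"
  shows "factorial_subring (polys_over A)"
proof -
  have sub: "subring_of A" using A by (simp add: factorial_subring_def)
  obtain \<mu> where \<mu>: "factorial_norm A \<mu>" using A by (auto simp: factorial_subring_def)
  \<comment> \<open>degrees add and leading coefficients multiply\<close>
  define \<nu> where "\<nu> p = degree p + \<mu> (lead_coeff p)" for p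
  have "factorial_norm (polys_over A) \<nu>"
    unfolding factorial_norm_def
  proof (intro conjI ballI)
    fix x y assume "x \<in> polys_over A - {0}" "y \<in> polys_over A - {0}"
    then show "\<nu> (x * y) = \<nu> x + \<nu> y"
      using \<mu> unfolding \<nu>_def lead_coeff_mult
      by (simp add: degree_mult_eq factorial_norm_def coeff_in)
  next
    fix x assume x: "x \<in> polys_over A - {0}"
    have "\<nu> x = 0 \<longleftrightarrow> degree x = 0 \<and> unit_in A (lead_coeff x)"
      using x \<mu> by (auto simp: \<nu>_def factorial_norm_def coeff_in)
    also have "\<dots> \<longleftrightarrow> unit_in (polys_over A) x"
      by (auto simp: unit_in_polys_over_iff[OF sub] elim!: degree_eq_zeroE)
    finally show "\<nu> x = 0 \<longleftrightarrow> unit_in (polys_over A) x" .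
  qed
  then show ?thesis
    using irreducible_poly_is_prime[OF A] subring_of_polys_over[OF sub] by (auto simp: factorial_subring_def)
qed

text \<open>
  This is applied to the evaluation of polynomials at a transcendental element, which turns
  polynomials over a ring in \<open>d\<close> variables into elements of the ring in \<open>d + 1\<close> variables.
\<close>

lemma factorial_subring_image:
  fixes h :: "'b::idom \<Rightarrow> 'a::idom"
  assumes A: "factorial_subring A"
    and h: "\<And>x y. h (x * y) = h x * h y" "\<And>x y. h (x - y) = h x - h y" "h 1 = 1"
    and inj: "\<And>x. x \<in> A \<Longrightarrow> h x = 0 \<Longrightarrow> x = 0"
  shows "factorial_subring (h ` A)"
proof -
  have sub: "subring_of A" using A by (simp add: factorial_subring_def)
  note S = subring_ofD[OF sub]
  obtain \<mu> where \<mu>: "factorial_norm A \<mu>" using A by (auto simp: factorial_subring_def)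
  have eq: "h x = h y \<longleftrightarrow> x = y" if "x \<in> A" "y \<in> A" for x y
    using inj[of "x - y"] that S h(2) by auto
  have h0: "h 0 = 0" using h(2)[of 0 0] by simp
  have unit: "unit_in (h ` A) (h x) \<longleftrightarrow> unit_in A x" if "x \<in> A" for x
    using that S h eq[of "x * y" 1 for y] by (auto simp: unit_in_def simp flip: h(1,3))
  have dvd: "dvd_in (h ` A) (h x) (h y) \<longleftrightarrow> dvd_in A x y" if "x \<in> A" "y \<in> A" for x y
    using that S h eq by (auto simp: dvd_in_def simp flip: h(1))
  define g where "g = inv_into A h"
  have g: "g (h x) = x" if "x \<in> A" for x
    unfolding g_def using that eq by (intro inv_into_f_f inj_onI) auto
  have "factorial_norm (h ` A) (\<mu> \<circ> g)"
    unfolding factorial_norm_def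
  proof (intro conjI ballI)
    fix x' y' assume "x' \<in> h ` A - {0}" "y' \<in> h ` A - {0}"
    then obtain x y where xy: "x \<in> A - {0}" "y \<in> A - {0}" "x' = h x" "y' = h y" using h0 by blast
    then have "g (x' * y') = x * y" using g[of "x * y"] S by (simp add: h(1))
    then show "(\<mu> \<circ> g) (x' * y') = (\<mu> \<circ> g) x' + (\<mu> \<circ> g) y'"
      using \<mu> xy g by (simp add: factorial_norm_def)
  next
    fix x' assume "x' \<in> h ` A - {0}"
    then obtain x where "x \<in> A - {0}" "x' = h x" using h0 by blast
    then show "((\<mu> \<circ> g) x' = 0) = unit_in (h ` A) x'"
      using \<mu> g unit by (simp add: factorial_norm_def)
  qed
  moreover have "subring_of (h ` A)"
    unfolding subring_of_def using S h by (auto simp: image_iff simp flip: h)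
  moreover have "prime_in (h ` A) (h x)" if "x \<in> A" "irreducible_in (h ` A) (h x)" for x
  proof -
    have "irreducible_in A x"
      using that unit h0 unfolding irreducible_in_def by (auto simp flip: h(1))
    then have "prime_in A x" using A by (auto simp: factorial_subring_def)
    then show ?thesis
      unfolding prime_in_def using dvd that(1) S by (auto simp flip: h(1))
  qed
  ultimately show ?thesis
    unfolding factorial_subring_def by (auto simp: irreducible_in_def)
qed

lemma factorial_subring_field:
  assumes "subring_of A" "\<And>x. x \<in> A \<Longrightarrow> x \<noteq> 0 \<Longrightarrow> unit_in A x"
  shows "factorial_subring A"
  unfolding factorial_subring_def factorial_norm_def
  using assms by (auto intro!: exI[of _ "\<lambda>_. 0"] simp: irreducible_in_def)

section \<open>The ring of polynomial functions on integer points\<close>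

text \<open>
  Polynomials with rational coefficients are represented by the functions that they induce on integer
  points; sequences of integers provide room for any number of variables.
\<close>

inductive_set polyfuns :: "nat \<Rightarrow> ((nat \<Rightarrow> int) \<Rightarrow> rat) set"
  for d :: nat
  where
    const: "(\<lambda>_. c) \<in> polyfuns d"
  | var: "i < d \<Longrightarrow> (\<lambda>x. of_int (x i)) \<in> polyfuns d"
  | add: "f \<in> polyfuns d \<Longrightarrow> g \<in> polyfuns d \<Longrightarrow> (\<lambda>x. f x + g x) \<in> polyfuns d"
  | mult: "f \<in> polyfuns d \<Longrightarrow> g \<in> polyfuns d \<Longrightarrow> (\<lambda>x. f x * g x) \<in> polyfuns d"

lemma polyfuns_mono:
  assumes "f \<in> polyfuns d" "d \<le> e"
  shows "f \<in> polyfuns e"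
  using assms by induction (auto intro: polyfuns.intros)

lemma polyfuns_diff:
  assumes "f \<in> polyfuns d" "g \<in> polyfuns d"
  shows "(\<lambda>x. f x - g x) \<in> polyfuns d"
  using polyfuns.add[OF assms(1) polyfuns.mult[OF polyfuns.const[of "-1"] assms(2)]] by simp

lemma polyfuns_Union:
  assumes "f \<in> (\<Union>d. polyfuns d)" "g \<in> (\<Union>d. polyfuns d)"
  shows "(\<lambda>x. f x + g x) \<in> (\<Union>d. polyfuns d)" "(\<lambda>x. f x * g x) \<in> (\<Union>d. polyfuns d)"
    "(\<lambda>x. f x - g x) \<in> (\<Union>d. polyfuns d)"
proof -
  obtain d e where "f \<in> polyfuns d" "g \<in> polyfuns e" using assms by blast
  then have fg: "f \<in> polyfuns (max d e)" "g \<in> polyfuns (max d e)"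
    by (meson max.cobounded1 max.cobounded2 polyfuns_mono)+
  show "(\<lambda>x. f x + g x) \<in> (\<Union>d. polyfuns d)" "(\<lambda>x. f x * g x) \<in> (\<Union>d. polyfuns d)"
    "(\<lambda>x. f x - g x) \<in> (\<Union>d. polyfuns d)"
    using polyfuns.add[OF fg] polyfuns.mult[OF fg] polyfuns_diff[OF fg] by blast+
qed

lemma polyfuns_local:
  assumes "f \<in> polyfuns d" "\<And>i. i < d \<Longrightarrow> x i = y i"
  shows "f x = f y"
  using assms by induction auto

lemma polyfuns_on_line:
  assumes "f \<in> polyfuns d"
  shows "\<exists>q. \<forall>s. f (\<lambda>i. a i + s * b i) = poly q (of_int s)"
  using assms
proof induction
  case (const c)
  show ?case by (intro exI[of _ "[:c:]"]) simp
next
  case (var i)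
  show ?case by (intro exI[of _ "[:of_int (a i), of_int (b i):]"]) simp
next
  case (add f g)
  then obtain q r where "\<forall>s. f (\<lambda>i. a i + s * b i) = poly q (of_int s)"
    "\<forall>s. g (\<lambda>i. a i + s * b i) = poly r (of_int s)" by blast
  then show ?case by (intro exI[of _ "q + r"]) simp
next
  case (mult f g)
  then obtain q r where "\<forall>s. f (\<lambda>i. a i + s * b i) = poly q (of_int s)"
    "\<forall>s. g (\<lambda>i. a i + s * b i) = poly r (of_int s)" by blast
  then show ?case by (intro exI[of _ "q * r"]) simp
qed

lemma poly_zero_on_ints:
  fixes q :: "'a::{idom, ring_char_0} poly"
  assumes "\<And>s :: int. s \<ge> s0 \<Longrightarrow> poly q (of_int s) = 0"
  shows "q = 0"
proof (rule ccontr)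
  assume "q \<noteq> 0"
  then have "finite {x. poly q x = 0}" by (rule poly_roots_finite)
  moreover have "of_int ` {s0..} \<subseteq> {x. poly q x = 0}" using assms by auto
  ultimately have "finite (of_int ` {s0..} :: 'a set)" by (rule rev_finite_subset)
  then have "finite {s0..}" by (rule finite_imageD) (auto simp: inj_on_def)
  then show False using infinite_Ici by blast
qed

text \<open>
  On the line through \<open>a\<close> and \<open>b\<close> both functions are non-zero polynomials in one variable.
\<close>

lemma polyfuns_no_zero_divisors:
  assumes "f \<in> polyfuns d" "g \<in> polyfuns e" "f a \<noteq> 0" "g b \<noteq> 0"
  shows "\<exists>x. f x \<noteq> 0 \<and> g x \<noteq> 0"
proof (rule ccontr)
  let ?l = "\<lambda>s i. a i + s * (b i - a i)"
  assume *: "\<nexists>x. f x \<noteq> 0 \<and> g x \<noteq> 0"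
  obtain q where q: "\<And>s. f (?l s) = poly q (of_int s)"
    using polyfuns_on_line[OF assms(1), of a "\<lambda>i. b i - a i"] by auto
  obtain r where r: "\<And>s. g (?l s) = poly r (of_int s)"
    using polyfuns_on_line[OF assms(2), of a "\<lambda>i. b i - a i"] by auto
  have "poly (q * r) (of_int s) = 0" for s :: int
    using * by (simp flip: q r)
  then have "q * r = 0" by (rule poly_zero_on_ints)
  moreover have "q \<noteq> 0" using q[of 0] assms(3) by auto
  moreover have "r \<noteq> 0" using r[of 1] assms(4) by auto
  ultimately show False by simp
qed

typedef polyfun = "\<Union>d. polyfuns d"
  morphisms eval Polyfun
  by (auto intro: polyfuns.const)

setup_lifting type_definition_polyfun

instantiation polyfun :: idom
begin

lift_definition zero_polyfun :: polyfun is "\<lambda>_. 0" by (auto intro: polyfuns.const)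
lift_definition one_polyfun :: polyfun is "\<lambda>_. 1" by (auto intro: polyfuns.const)
lift_definition plus_polyfun :: "polyfun \<Rightarrow> polyfun \<Rightarrow> polyfun" is "\<lambda>f g x. f x + g x"
  by (rule polyfuns_Union)
lift_definition times_polyfun :: "polyfun \<Rightarrow> polyfun \<Rightarrow> polyfun" is "\<lambda>f g x. f x * g x"
  by (rule polyfuns_Union)
lift_definition uminus_polyfun :: "polyfun \<Rightarrow> polyfun" is "\<lambda>f x. - f x"
  using polyfuns_diff[OF polyfuns.const[of 0]] by auto
lift_definition minus_polyfun :: "polyfun \<Rightarrow> polyfun \<Rightarrow> polyfun" is "\<lambda>f g x. f x - g x"
  by (rule polyfuns_Union)

instance
proof
  fix a b :: polyfun
  assume "a \<noteq> 0" "b \<noteq> 0"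
  then obtain x y where "eval a x \<noteq> 0" "eval b y \<noteq> 0"
    by (metis eval_inject ext zero_polyfun.rep_eq)
  moreover obtain d e where "eval a \<in> polyfuns d" "eval b \<in> polyfuns e"
    using eval[of a] eval[of b] by blast
  ultimately obtain z where "eval a z \<noteq> 0" "eval b z \<noteq> 0"
    using polyfuns_no_zero_divisors by blast
  then have "eval (a * b) z \<noteq> 0" by (simp add: times_polyfun.rep_eq)
  then show "a * b \<noteq> 0" by (auto simp: zero_polyfun.rep_eq)
qed (transfer; simp add: algebra_simps fun_eq_iff)+

end

lemma eval_simps [simp]:
  "eval 0 x = 0" "eval 1 x = 1" "eval (f + g) x = eval f x + eval g x"
  "eval (f * g) x = eval f x * eval g x" "eval (f - g) x = eval f x - eval g x" "eval (- f) x = - eval f x"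
  by (transfer, simp)+

lift_definition Const :: "rat \<Rightarrow> polyfun" is "\<lambda>c _. c" by (auto intro: polyfuns.const)
lift_definition Var :: "nat \<Rightarrow> polyfun" is "\<lambda>i x. of_int (x i)" by (auto intro: polyfuns.var)

lemma eval_Const [simp]: "eval (Const c) x = c" by transfer simp
lemma eval_Var [simp]: "eval (Var i) x = of_int (x i)" by transfer simp

lemma polyfun_eqI: "(\<And>x. eval f x = eval g x) \<Longrightarrow> f = g"
  by transfer auto

definition polys :: "nat \<Rightarrow> polyfun set"
  where "polys d = {f. eval f \<in> polyfuns d}"

lemma Const_in_polys [simp]: "Const c \<in> polys d"
  by (auto simp: polys_def Const.rep_eq intro: polyfuns.const)

lemma Var_in_polys: "i < d \<Longrightarrow> Var i \<in> polys d"
  by (auto simp: polys_def Var.rep_eq intro: polyfuns.var)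

lemma subring_of_polys: "subring_of (polys d)"
proof -
  have "1 \<in> polys d" by (auto simp: polys_def one_polyfun.rep_eq intro: polyfuns.const)
  moreover have "f - g \<in> polys d" "f * g \<in> polys d" if "f \<in> polys d" "g \<in> polys d" for f g
    using that polyfuns_diff polyfuns.mult
    by (simp_all add: polys_def minus_polyfun.rep_eq times_polyfun.rep_eq)
  ultimately show ?thesis by (simp add: subring_of_def)
qed

lemma polys_Suc_mono: "f \<in> polys d \<Longrightarrow> f \<in> polys (Suc d)"
  by (auto simp: polys_def intro: polyfuns_mono)

lemma eval_poly_Var:
  assumes "q \<in> polys_over (polys d)"
  shows "eval (poly q (Var d)) (x(d := n)) = poly (map_poly (\<lambda>c. eval c x) q) (of_int n)"
  using assms
proof (induction q)
  case (pCons c q)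
  have "eval c (x(d := n)) = eval c x"
    using pCons.prems by (intro polyfuns_local[of "eval c" d]) (auto simp: polys_def)
  then show ?case using pCons by (simp add: map_poly_pCons del: fun_upd_apply) simp
qed simp

lemma Var_transcendental:
  assumes "q \<in> polys_over (polys d)" "poly q (Var d) = 0"
  shows "q = 0"
proof (rule poly_eqI)
  fix i
  have "eval (coeff q i) x = 0" for x
  proof -
    have "map_poly (\<lambda>c. eval c x) q = 0"
      using eval_poly_Var[OF assms(1), of x] assms(2) by (intro poly_zero_on_ints) auto
    then have "coeff (map_poly (\<lambda>c. eval c x) q) i = 0" by simp
    then show ?thesis by (simp add: coeff_map_poly)
  qed
  then show "coeff q i = coeff 0 i" by (intro polyfun_eqI) auto
qed

text \<open>
  A polynomial in \<open>d + 1\<close> variables is a polynomial in the last variable over the ring in the first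
  \<open>d\<close> variables.
\<close>

lemma polys_Suc: "polys (Suc d) = (\<lambda>q. poly q (Var d)) ` polys_over (polys d)"
proof (intro equalityI subsetI)
  note S = subring_ofD[OF subring_of_polys]
  note P = subring_ofD[OF subring_of_polys_over[OF subring_of_polys]]
  fix f assume "f \<in> polys (Suc d)"
  then have "eval f \<in> polyfuns (Suc d)" by (simp add: polys_def)
  then have "\<exists>q\<in>polys_over (polys d). \<forall>x. eval (poly q (Var d)) x = eval f x"
  proof induction
    case (const c)
    show ?case using P(1) by (intro bexI[of _ "[:Const c:]"]) auto
  next
    case (var i)
    show ?case
    proof (cases "i = d")
      case True
      then show ?thesis using S P(1) by (intro bexI[of _ "[:0, 1:]"]) auto
    next
      case False
      then show ?thesis
        using var P(1) Var_in_polys by (intro bexI[of _ "[:Var i:]"]) auto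
    qed
  next
    case (add f g)
    then obtain q r where "q \<in> polys_over (polys d)" "r \<in> polys_over (polys d)"
      "\<forall>x. eval (poly q (Var d)) x = f x" "\<forall>x. eval (poly r (Var d)) x = g x" by blast
    then show ?case using P by (intro bexI[of _ "q + r"]) auto
  next
    case (mult f g)
    then obtain q r where "q \<in> polys_over (polys d)" "r \<in> polys_over (polys d)"
      "\<forall>x. eval (poly q (Var d)) x = f x" "\<forall>x. eval (poly r (Var d)) x = g x" by blast
    then show ?case using P by (intro bexI[of _ "q * r"]) auto
  qed
  then show "f \<in> (\<lambda>q. poly q (Var d)) ` polys_over (polys d)"
    using polyfun_eqI by (metis image_iff)
next
  note S = subring_ofD[OF subring_of_polys]
  fix f assume "f \<in> (\<lambda>q. poly q (Var d)) ` polys_over (polys d)"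
  then obtain q where q: "q \<in> polys_over (polys d)" "f = poly q (Var d)" by blast
  have "poly q (Var d) \<in> polys (Suc d)"
    using q(1)
  proof (induction q)
    case (pCons a q)
    then have "a \<in> polys (Suc d)" "poly q (Var d) \<in> polys (Suc d)" "Var d \<in> polys (Suc d)"
      by (auto intro: polys_Suc_mono Var_in_polys)
    then have "a + Var d * poly q (Var d) \<in> polys (Suc d)" using S(3,5) by blast
    then show ?case by simp
  qed (simp add: S(1))
  then show "f \<in> polys (Suc d)" using q by simp
qed

lemma polys_0: "polys 0 = range Const"
proof (intro equalityI subsetI)
  fix f assume "f \<in> polys 0"
  then have "eval f \<in> polyfuns 0" by (simp add: polys_def)
  then have "eval f x = eval f (\<lambda>_. 0)" for x by (rule polyfuns_local) simp
  then have "f = Const (eval f (\<lambda>_. 0))" by (intro polyfun_eqI) simp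
  then show "f \<in> range Const" by blast
qed auto

lemma factorial_polys: "factorial_subring (polys d)"
proof (induction d)
  case 0
  have "unit_in (polys 0) x" if "x \<in> polys 0" "x \<noteq> 0" for x
  proof -
    obtain c where c: "x = Const c" using \<open>x \<in> polys 0\<close> by (auto simp: polys_0)
    have "Const 0 = 0" by (intro polyfun_eqI) simp
    then have "c \<noteq> 0" using c that by auto
    then have "x * Const (1 / c) = 1" using c by (intro polyfun_eqI) simp
    then show ?thesis using that unfolding unit_in_def by auto
  qed
  then show ?case by (intro factorial_subring_field subring_of_polys)
next
  case (Suc d)
  show ?case
    unfolding polys_Suc
    by (rule factorial_subring_image[OF factorial_polys_over[OF Suc]]) (auto dest: Var_transcendental)
qed

section \<open>Almost prime values of an integer polynomial\<close>

lemma poly_cong_int: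
  fixes p :: "int poly"
  assumes "[x = y] (mod l)"
  shows "[poly p x = poly p y] (mod l)"
  by (induction p) (auto intro!: cong_add cong_mult assms)

lemma card_poly_roots_mod_prime:
  fixes p :: "int poly"
  assumes "Factorial_Ring.prime l" "\<not> int l dvd coeff p i"
  shows "card ({n. int l dvd poly p n} \<inter> {0..<int l}) \<le> degree p"
  using assms(2)
proof (induction "degree p" arbitrary: p i)
  case 0
  then obtain c where c: "p = [:c:]" by (metis degree_eq_zeroE)
  then have "\<not> int l dvd c" using 0 by (cases i) auto
  then show ?case using c by simp
next
  case (Suc d)
  let ?R = "\<lambda>p. {n. int l dvd poly p n} \<inter> {0..<int l}"
  show ?case
  proof (cases "?R p = {}")
    case False
    then obtain a where "a \<in> ?R p" by blast
    then have a: "int l dvd poly p a" "a \<in> {0..<int l}" by auto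
    define q where "q = synthetic_div p a"
    have p: "p = [:poly p a:] + [:- a, 1:] * q"
      using synthetic_div_correct'[of a p] by (simp add: q_def algebra_simps)
    have "degree q = d" using Suc.hyps(2) by (simp add: q_def degree_synthetic_div)
    have "\<exists>i. \<not> int l dvd coeff q i"
    proof (rule ccontr)
      assume "\<nexists>i. \<not> int l dvd coeff q i"
      then have "int l dvd coeff ([:- a, 1:] * q) i" by (auto simp: coeff_pCons split: nat.split)
      moreover have "int l dvd coeff [:poly p a:] i" using a by (cases i) auto
      ultimately have "int l dvd coeff ([:poly p a:] + [:- a, 1:] * q) i" by (simp only: coeff_add dvd_add)
      then show False using Suc.prems p by metis
    qed
    then obtain i' where "\<not> int l dvd coeff q i'" by blast
    then have IH: "card (?R q) \<le> degree q" using Suc.hyps(1)[of q] \<open>degree q = d\<close> by blast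
    have "?R p \<subseteq> insert a (?R q)"
    proof
      fix n assume n: "n \<in> ?R p"
      have "poly p n = poly p a + (n - a) * poly q n" by (subst p) (simp add: algebra_simps)
      then have "int l dvd (n - a) * poly q n" using n a by (metis (no_types, lifting) IntE dvd_add_right_iff mem_Collect_eq)
      then have "int l dvd n - a \<or> int l dvd poly q n"
        using assms(1) by (simp add: prime_dvd_mult_iff)
      moreover have "n = a" if "int l dvd n - a"
      proof (rule ccontr)
        assume "n \<noteq> a"
        then have "int l \<le> \<bar>n - a\<bar>" using dvd_imp_le_int[of "n - a" "int l"] that by simp
        moreover have "0 \<le> a" "a < int l" "0 \<le> n" "n < int l" using n a by auto
        ultimately show False by linarith
      qed
      ultimately show "n \<in> insert a (?R q)" using n by blast
    qed
    then have "card (?R p) \<le> card (insert a (?R q))" by (intro card_mono) auto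
    also have "\<dots> \<le> Suc (card (?R q))" by (rule card_insert_le_m1) auto
    finally show ?thesis using IH \<open>degree q = d\<close> Suc.hyps(2) by simp
  qed simp
qed

definition num_prime_factors :: "nat set \<Rightarrow> int \<Rightarrow> nat"
  where "num_prime_factors S k = size (filter_mset (\<lambda>l. nat l \<notin> S) (prime_factorization k))"

lemma num_prime_factors_mult:
  assumes "a \<noteq> 0" "b \<noteq> 0"
  shows "num_prime_factors S (a * b) = num_prime_factors S a + num_prime_factors S b"
  using assms by (simp add: num_prime_factors_def prime_factorization_mult)

lemma num_prime_factors_dvd:
  assumes "a dvd b" "b \<noteq> 0"
  shows "num_prime_factors S a \<le> num_prime_factors S b"
  using assms by (auto simp: num_prime_factors_mult elim!: dvdE)

lemma num_prime_factors_antimono: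
  assumes "S \<subseteq> S'"
  shows "num_prime_factors S' k \<le> num_prime_factors S k"
  unfolding num_prime_factors_def
  by (intro size_mset_mono mset_subset_eqI) (use assms in auto)

lemma num_prime_factors_le:
  fixes z :: nat
  assumes "k \<noteq> 0" "\<And>l. Factorial_Ring.prime l \<Longrightarrow> int l dvd k \<Longrightarrow> l \<notin> S \<Longrightarrow> z \<le> l" "\<bar>k\<bar> \<le> int z ^ m" "z \<ge> 2"
  shows "num_prime_factors S k \<le> m"
proof -
  define M where "M = filter_mset (\<lambda>l. nat l \<notin> S) (prime_factorization k)"
  have large: "int z \<le> l" if "l \<in># M" for l
  proof -
    have l: "Factorial_Ring.prime l" "l dvd k" "nat l \<notin> S"
      using that by (auto simp: M_def in_prime_factors_iff)
    then have "l > 0" by (simp add: prime_gt_0_int)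
    then have "Factorial_Ring.prime (nat l)" "int (nat l) dvd k" using l by auto
    then have "z \<le> nat l" using assms(2) l(3) by blast
    then show ?thesis using \<open>l > 0\<close> by linarith
  qed
  then have "int z ^ size M \<le> prod_mset M"
  proof (induction M)
    case (add l M)
    then have "int z * int z ^ size M \<le> l * prod_mset M"
      by (intro mult_mono) (auto intro: order_trans[of 0 "int z"])
    then show ?case by simp
  qed simp
  also have "prod_mset M dvd prod_mset (prime_factorization k)"
    unfolding M_def by (intro prod_mset_subset_imp_dvd multiset_filter_subset)
  then have "prod_mset M \<le> prod_mset (prime_factorization k)"
    using assms(1) by (intro zdvd_imp_le) (auto simp: prod_mset_prime_factorization)
  also have "\<dots> = \<bar>k\<bar>" using assms(1) by (simp add: prod_mset_prime_factorization normalize_int_def)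
  also have "\<dots> \<le> int z ^ m" by fact
  finally have "int z ^ size M \<le> int z ^ m" .
  then have "size M \<le> m" using assms(4) by (intro power_le_imp_le_exp[of "int z"]) auto
  then show ?thesis by (simp add: num_prime_factors_def M_def)
qed

lemma abs_poly_le:
  fixes p :: "int poly"
  assumes "1 \<le> B" "\<bar>n\<bar> \<le> B" "degree p \<le> \<kappa>"
  shows "\<bar>poly p n\<bar> \<le> (\<Sum>i\<le>degree p. \<bar>coeff p i\<bar>) * B ^ \<kappa>"
proof -
  have "\<bar>poly p n\<bar> \<le> (\<Sum>i\<le>degree p. \<bar>coeff p i * n ^ i\<bar>)"
    unfolding poly_altdef by (rule sum_abs)
  also have "\<dots> \<le> (\<Sum>i\<le>degree p. \<bar>coeff p i\<bar> * B ^ \<kappa>)"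
  proof (intro sum_mono)
    fix i assume "i \<in> {..degree p}"
    then have "\<bar>n\<bar> ^ i \<le> B ^ i" "B ^ i \<le> B ^ \<kappa>"
      using assms by (auto intro!: power_mono power_increasing)
    then show "\<bar>coeff p i * n ^ i\<bar> \<le> \<bar>coeff p i\<bar> * B ^ \<kappa>"
      by (auto simp: abs_mult power_abs intro!: mult_left_mono)
  qed
  finally show ?thesis by (simp add: sum_distrib_right)
qed

lemma poly_nonzero_eventually:
  fixes p :: "'a::{idom, ring_char_0} poly"
  assumes "p \<noteq> 0"
  shows "\<exists>y. \<forall>n::int. n \<ge> y \<longrightarrow> poly p (of_int n) \<noteq> 0"
proof -
  have "finite (of_int -` {x. poly p x = 0} :: int set)"
    using poly_roots_finite[OF assms] by (intro finite_vimageI) (auto simp: inj_on_def)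
  then obtain y where "\<forall>n\<in>of_int -` {x. poly p x = 0}. n \<le> (y :: int)"
    using bdd_above_finite unfolding bdd_above_def by blast
  then show ?thesis by (intro exI[of _ "y + 1"]) force
qed

text \<open>
  The numbers \<open>N\<close> and \<open>r\<close> depend on the degree bound \<open>\<kappa>\<close> alone. This uniformity allows the
  polynomials to be fibres over a varying point. The sieve excludes, for each prime outside \<open>S\<close>, the
  roots of the primitive part of \<open>q\<close> and the common roots of \<open>Q\<close>, together at most \<open>2 * \<kappa>\<close> classes.
  Primes beyond the sifting range are too large to divide \<open>R\<close>, so they cannot divide all values of \<open>Q\<close>.
\<close>

lemma almost_prime_values:
  fixes \<kappa> :: nat
  shows "\<exists>N r. \<forall>S r0 q Q R y.
    (\<forall>l. Factorial_Ring.prime l \<and> l \<le> N \<longrightarrow> l \<in> S) \<longrightarrow>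
    q \<noteq> 0 \<longrightarrow> degree q \<le> \<kappa> \<longrightarrow> num_prime_factors S (lead_coeff q) \<le> r0 \<longrightarrow>
    (\<forall>P\<in>Q. degree P \<le> \<kappa>) \<longrightarrow>
    (\<forall>l. Factorial_Ring.prime l \<and> l \<notin> S \<longrightarrow> (\<exists>P\<in>Q. \<exists>i. \<not> int l dvd coeff P i)) \<longrightarrow>
    R \<noteq> 0 \<longrightarrow> (\<forall>l n. Factorial_Ring.prime l \<and> (\<forall>P\<in>Q. int l dvd poly P n) \<longrightarrow> int l dvd R) \<longrightarrow>
    (\<exists>n\<ge>y. poly q n \<noteq> 0 \<and> num_prime_factors S (poly q n) \<le> r0 + r \<and>
      (\<forall>l. Factorial_Ring.prime l \<and> l \<notin> S \<longrightarrow> (\<exists>P\<in>Q. \<not> int l dvd poly P n)))"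
proof -
  obtain j0 E where E: "E > 0" and sieve: "\<And>J \<Omega> y. J \<ge> j0 \<Longrightarrow>
    (\<And>p. Factorial_Ring.prime p \<Longrightarrow> 2 ^ 2 ^ j0 < p \<Longrightarrow> p \<le> 2 ^ 2 ^ J \<Longrightarrow>
       periodic (int p) (\<Omega> p) \<and> card (\<Omega> p \<inter> {0..<int p}) \<le> 2 * \<kappa>) \<Longrightarrow>
    (\<exists>n\<in>{y..<y + 2 ^ (E * 2 ^ J)}. \<forall>p. Factorial_Ring.prime p \<and> 2 ^ 2 ^ j0 < p \<and> p \<le> 2 ^ 2 ^ J \<longrightarrow> n \<notin> \<Omega> p)"
    using exists_avoiding_residues[of "2 * \<kappa>"] by metis
  define N :: nat where "N = 2 ^ 2 ^ j0"
  have "\<exists>n\<ge>y. poly q n \<noteq> 0 \<and> num_prime_factors S (poly q n) \<le> r0 + E * (\<kappa> + 1) \<and>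
      (\<forall>l. Factorial_Ring.prime l \<and> l \<notin> S \<longrightarrow> (\<exists>P\<in>Q. \<not> int l dvd poly P n))"
    if S: "\<And>l. Factorial_Ring.prime l \<Longrightarrow> l \<le> N \<Longrightarrow> l \<in> S"
      and q: "q \<noteq> 0" "degree q \<le> \<kappa>" "num_prime_factors S (lead_coeff q) \<le> r0"
      and Q: "\<And>P. P \<in> Q \<Longrightarrow> degree P \<le> \<kappa>"
        "\<And>l. Factorial_Ring.prime l \<Longrightarrow> l \<notin> S \<Longrightarrow> \<exists>P\<in>Q. \<exists>i. \<not> int l dvd coeff P i"
      and R: "R \<noteq> 0" "\<And>l n. Factorial_Ring.prime l \<Longrightarrow> (\<And>P. P \<in> Q \<Longrightarrow> int l dvd poly P n) \<Longrightarrow> int l dvd R"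
    for S r0 q Q R and y :: int
  proof -
    define c g where "c = content q" and "g = primitive_part q"
    have qcg: "q = smult c g" by (simp add: c_def g_def content_times_primitive_part)
    have c: "c \<noteq> 0" using q(1) by (simp add: c_def)
    have g: "g \<noteq> 0" "degree g \<le> \<kappa>" "content g = 1"
      using q by (auto simp: g_def degree_primitive_part content_primitive_part)
    have g_prim: "\<exists>i. \<not> int l dvd coeff g i" if "Factorial_Ring.prime l" for l
    proof (rule ccontr)
      assume "\<nexists>i. \<not> int l dvd coeff g i"
      then have "[:int l:] dvd g" by (simp add: const_poly_dvd_iff)
      then have "int l dvd content g" by (simp add: const_poly_dvd_iff_dvd_content)
      then show False using g that by (auto simp: prime_nat_iff)
    qed
    define \<Omega> where "\<Omega> l = (if l \<in> S then {} else {n. int l dvd poly g n} \<union> {n. \<forall>P\<in>Q. int l dvd poly P n})" for l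
    have per: "int l dvd poly P (n + int l) \<longleftrightarrow> int l dvd poly P n" for l n P
      by (rule cong_dvd_iff, rule poly_cong_int) (simp add: cong_def)
    have \<Omega>: "periodic (int l) (\<Omega> l) \<and> card (\<Omega> l \<inter> {0..<int l}) \<le> 2 * \<kappa>"
      if l: "Factorial_Ring.prime l" for l
    proof (cases "l \<in> S")
      case False
      have "periodic (int l) (\<Omega> l)" by (auto simp: periodic_def \<Omega>_def per)
      moreover have "card (\<Omega> l \<inter> {0..<int l}) \<le> \<kappa> + \<kappa>"
      proof -
        obtain i where "\<not> int l dvd coeff g i" using g_prim[OF l] by blast
        then have 1: "card ({n. int l dvd poly g n} \<inter> {0..<int l}) \<le> \<kappa>"
          using card_poly_roots_mod_prime[OF l] g(2) le_trans by blast
        obtain P i where P: "P \<in> Q" "\<not> int l dvd coeff P i" using Q(2)[OF l False] by blast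
        have "card ({n. \<forall>P\<in>Q. int l dvd poly P n} \<inter> {0..<int l}) \<le> card ({n. int l dvd poly P n} \<inter> {0..<int l})"
          using P(1) by (intro card_mono) auto
        also have "\<dots> \<le> \<kappa>" using card_poly_roots_mod_prime[OF l P(2)] Q(1)[OF P(1)] by simp
        finally have 2: "card ({n. \<forall>P\<in>Q. int l dvd poly P n} \<inter> {0..<int l}) \<le> \<kappa>" .
        have "\<Omega> l \<inter> {0..<int l} = ({n. int l dvd poly g n} \<inter> {0..<int l}) \<union> ({n. \<forall>P\<in>Q. int l dvd poly P n} \<inter> {0..<int l})"
          using False by (auto simp: \<Omega>_def)
        then have "card (\<Omega> l \<inter> {0..<int l}) \<le> card ({n. int l dvd poly g n} \<inter> {0..<int l}) + card ({n. \<forall>P\<in>Q. int l dvd poly P n} \<inter> {0..<int l})"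
          by (simp only: card_Un_le)
        with 1 2 show ?thesis by linarith
      qed
      ultimately show ?thesis by simp
    qed (simp add: \<Omega>_def periodic_def)
    obtain y0 where y0: "\<And>n. n \<ge> y0 \<Longrightarrow> poly q n \<noteq> 0"
      using poly_nonzero_eventually[OF q(1)] by auto
    define y1 where "y1 = max 1 (max y y0)"
    define C where "C = (\<Sum>i\<le>degree g. \<bar>coeff g i\<bar>)"
    have C0: "C \<ge> 0" by (simp add: C_def sum_nonneg)
    \<comment> \<open>large enough for the length \<open>X\<close> to exceed the coefficients and the starting point, and for the sifting range to contain the divisors of \<open>R\<close>\<close>
    define J where "J = j0 + nat y1 + nat \<bar>R\<bar> + nat (C * 2 ^ \<kappa>)"
    define z :: nat where "z = 2 ^ 2 ^ J"
    define X :: int where "X = 2 ^ (E * 2 ^ J)"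
    have Jz: "J \<le> z" using less_exp[of J] less_exp[of "2 ^ J"] unfolding z_def by linarith
    have Xz: "X = int z ^ E" by (simp add: X_def z_def mult.commute flip: power_mult)
    have "z ^ 1 \<le> z ^ E" using E by (intro power_increasing) (auto simp: z_def)
    then have zX: "int z \<le> X" unfolding Xz by (metis of_nat_le_iff of_nat_power power_one_right)
    have big: "y1 \<le> X" "\<bar>R\<bar> \<le> int z" "C * 2 ^ \<kappa> \<le> X"
      using Jz zX by (auto simp: J_def)
    have J: "J \<ge> j0" by (simp add: J_def)
    obtain n where n: "n \<in> {y1..<y1 + X}" and
      avoid: "\<And>p. Factorial_Ring.prime p \<Longrightarrow> N < p \<Longrightarrow> p \<le> z \<Longrightarrow> n \<notin> \<Omega> p"
      using sieve[OF J, of \<Omega> y1] \<Omega> unfolding N_def z_def X_def by blast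
    have n0: "n \<ge> y" "poly q n \<noteq> 0" using n y0 by (auto simp: y1_def)
    then have gn: "poly g n \<noteq> 0" using qcg by auto
    have "num_prime_factors S (poly g n) \<le> E * (\<kappa> + 1)"
    proof (rule num_prime_factors_le[OF gn])
      fix l assume l: "Factorial_Ring.prime l" "int l dvd poly g n" "l \<notin> S"
      then have "n \<in> \<Omega> l" "\<not> l \<le> N" using S by (auto simp: \<Omega>_def)
      then show "z \<le> l" using avoid[OF l(1)] by force
    next
      have "\<bar>poly g n\<bar> \<le> C * (2 * X) ^ \<kappa>"
        unfolding C_def using n big g(2) by (intro abs_poly_le) (auto simp: y1_def)
      also have "\<dots> = (C * 2 ^ \<kappa>) * X ^ \<kappa>" by (simp add: power_mult_distrib)
      also have "\<dots> \<le> X * X ^ \<kappa>" using big by (intro mult_right_mono) (auto simp: X_def)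
      also have "\<dots> = int z ^ (E * (\<kappa> + 1))" unfolding Xz by (simp add: power_add power_mult)
      finally show "\<bar>poly g n\<bar> \<le> int z ^ (E * (\<kappa> + 1))" .
    next
      have "(2 :: nat) ^ 1 \<le> 2 ^ 2 ^ J" by (intro power_increasing) auto
      then show "2 \<le> z" by (simp add: z_def)
    qed
    moreover have "num_prime_factors S c \<le> r0"
    proof -
      have "c dvd lead_coeff q" by (simp add: c_def content_dvd_coeff)
      then show ?thesis using num_prime_factors_dvd[of c "lead_coeff q" S] q by auto
    qed
    moreover have "poly q n = c * poly g n" by (simp add: qcg)
    ultimately have "num_prime_factors S (poly q n) \<le> r0 + E * (\<kappa> + 1)"
      using num_prime_factors_mult[OF c gn] by simp
    moreover have "\<exists>P\<in>Q. \<not> int l dvd poly P n" if l: "Factorial_Ring.prime l" "l \<notin> S" for l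
    proof (rule ccontr)
      assume *: "\<not> (\<exists>P\<in>Q. \<not> int l dvd poly P n)"
      then have "int l dvd R" using R(2)[OF l(1)] by blast
      then have "int l \<le> \<bar>R\<bar>" using R(1) by (intro zdvd_imp_le) auto
      then have "l \<le> z" using big by linarith
      moreover have "N < l" using S[OF l(1)] l(2) by force
      moreover have "n \<in> \<Omega> l" using * l(2) by (auto simp: \<Omega>_def)
      ultimately show False using avoid[OF l(1)] by blast
    qed
    ultimately show ?thesis using n0 by blast
  qed
  note main = this
  show ?thesis
  proof (rule exI[of _ N], rule exI[of _ "E * (\<kappa> + 1)"], intro allI impI, goal_cases)
    case (1 S r0 q Q R y)
    show ?case
      by (rule main[of S q r0 Q R y]) (use 1 in blast)+
  qed
qed

section \<open>The sieve in several variables\<close>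

definition int_valued :: "polyfun \<Rightarrow> bool"
  where "int_valued f \<longleftrightarrow> (\<forall>x. eval f x \<in> \<int>)"

definition int_eval :: "polyfun \<Rightarrow> (nat \<Rightarrow> int) \<Rightarrow> int"
  where "int_eval f x = \<lfloor>eval f x\<rfloor>"

lemma of_int_int_eval: "int_valued f \<Longrightarrow> of_int (int_eval f x) = eval f x"
  by (simp add: int_valued_def int_eval_def)

lemma int_valued_mult: "int_valued f \<Longrightarrow> int_valued g \<Longrightarrow> int_valued (f * g)"
  by (simp add: int_valued_def)

lemma int_valued_Const: "c \<in> \<int> \<Longrightarrow> int_valued (Const c)"
  by (simp add: int_valued_def)

lemma polyfuns_denominator:
  assumes "f \<in> polyfuns d"
  shows "\<exists>M::int. M > 0 \<and> (\<forall>x. of_int M * f x \<in> \<int>)"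
  using assms
proof induction
  case (const c)
  obtain a b where ab: "quotient_of c = (a, b)" by fastforce
  then have "c = of_int a / of_int b" "b > 0" by (auto dest: quotient_of_div quotient_of_denom_pos)
  then have "of_int b * c = of_int a" by simp
  then show ?case using \<open>b > 0\<close> by (intro exI[of _ b]) auto
next
  case (var i)
  show ?case by (intro exI[of _ 1]) simp
next
  case (add f g)
  then obtain M N :: int where M: "M > 0" "\<And>x. of_int M * f x \<in> \<int>" and N: "N > 0" "\<And>x. of_int N * g x \<in> \<int>" by blast
  have "of_int (M * N) * (f x + g x) \<in> \<int>" for x
  proof -
    have "of_int (M * N) * (f x + g x) = of_int N * (of_int M * f x) + of_int M * (of_int N * g x)"
      by (simp add: algebra_simps)
    then show ?thesis by (simp only: Ints_add Ints_mult Ints_of_int M N)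
  qed
  then show ?case using M N by (intro exI[of _ "M * N"]) auto
next
  case (mult f g)
  then obtain M N :: int where M: "M > 0" "\<And>x. of_int M * f x \<in> \<int>" and N: "N > 0" "\<And>x. of_int N * g x \<in> \<int>" by blast
  have "of_int (M * N) * (f x * g x) \<in> \<int>" for x
  proof -
    have "of_int (M * N) * (f x * g x) = (of_int M * f x) * (of_int N * g x)"
      by (simp add: algebra_simps)
    then show ?thesis by (simp only: Ints_mult M N)
  qed
  then show ?case using M N by (intro exI[of _ "M * N"]) auto
qed

lemma common_denominator:
  assumes "finite F"
  shows "\<exists>M::int. M > 0 \<and> (\<forall>f\<in>F. int_valued (Const (of_int M) * f))"
  using assms
proof (induction F rule: finite_induct)
  case empty
  show ?case by (intro exI[of _ 1]) simp
next
  case (insert f F)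
  then obtain M :: int where M: "M > 0" "\<And>f. f \<in> F \<Longrightarrow> int_valued (Const (of_int M) * f)" by blast
  obtain d where "eval f \<in> polyfuns d" using eval[of f] by blast
  then obtain N :: int where N: "N > 0" "\<And>x. of_int N * eval f x \<in> \<int>" using polyfuns_denominator by blast
  have "int_valued (Const (of_int (M * N)) * g)" if "g \<in> insert f F" for g
  proof (cases "g = f")
    case True
    have "of_int (M * N) * eval f x = of_int M * (of_int N * eval f x)" for x by simp
    then show ?thesis using N True unfolding int_valued_def by (simp add: Ints_mult mult.assoc)
  next
    case False
    then have *: "int_valued (Const (of_int M) * g)" using M that by auto
    have "Const (of_int (M * N)) * g = Const (of_int N) * (Const (of_int M) * g)"
      by (intro polyfun_eqI) simp
    then show ?thesis by (simp only: int_valued_mult int_valued_Const Ints_of_int *)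
  qed
  then show ?case using M N by (intro exI[of _ "M * N"]) auto
qed

definition coprime_family :: "polyfun set \<Rightarrow> polyfun set \<Rightarrow> bool"
  where "coprime_family A F \<longleftrightarrow> (\<forall>e\<in>A. (\<forall>g\<in>F. dvd_in A e g) \<longrightarrow> unit_in A e)"

text \<open>
  The point \<open>x\<close> satisfies the conclusion of the sieve for integer-valued \<open>f\<close> and \<open>F\<close>.
\<close>

definition sieved :: "nat set \<Rightarrow> nat \<Rightarrow> polyfun \<Rightarrow> polyfun set \<Rightarrow> (nat \<Rightarrow> int) \<Rightarrow> bool"
  where "sieved S r f F x \<longleftrightarrow> int_eval f x \<noteq> 0 \<and> num_prime_factors S (int_eval f x) \<le> r \<and>
    (\<forall>l. Factorial_Ring.prime l \<and> l \<notin> S \<longrightarrow> (\<exists>g\<in>F. \<not> int l dvd int_eval g x))"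

text \<open>
  The last line says that the sieved points are Zariski dense in affine space of dimension \<open>d\<close>.
\<close>

definition sievable :: "nat \<Rightarrow> bool"
  where "sievable d \<longleftrightarrow> (\<forall>f F. f \<in> polys d \<longrightarrow> f \<noteq> 0 \<longrightarrow> int_valued f \<longrightarrow>
    finite F \<longrightarrow> F \<subseteq> polys d \<longrightarrow> (\<forall>g\<in>F. int_valued g) \<longrightarrow> coprime_family (polys d) F \<longrightarrow>
    (\<exists>S r. finite S \<and> (\<forall>l\<in>S. Factorial_Ring.prime l) \<and>
      (\<forall>h\<in>polys d. h \<noteq> 0 \<longrightarrow> (\<exists>x. eval h x \<noteq> 0 \<and> sieved S r f F x))))"

lemma coprime_family_nonzero:
  assumes "coprime_family A F" "subring_of A"
  shows "\<exists>g\<in>F. g \<noteq> 0"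
proof (rule ccontr)
  assume "\<not> (\<exists>g\<in>F. g \<noteq> 0)"
  then have "\<forall>g\<in>F. dvd_in A 0 g" using subring_ofD(1)[OF assms(2)] by (auto simp: dvd_in_def)
  then have "unit_in A 0" using assms subring_ofD(1)[OF assms(2)] by (auto simp: coprime_family_def)
  then show False by (simp add: unit_in_def)
qed

lemma finite_prime_divisors:
  fixes k :: int
  assumes "k \<noteq> 0"
  shows "finite {l. Factorial_Ring.prime l \<and> int l dvd k}"
proof (rule finite_subset)
  show "{l. Factorial_Ring.prime l \<and> int l dvd k} \<subseteq> {..nat \<bar>k\<bar>}"
  proof
    fix l assume "l \<in> {l. Factorial_Ring.prime l \<and> int l dvd k}"
    then have "\<bar>int l\<bar> \<le> \<bar>k\<bar>" using dvd_imp_le_int[OF assms, of "int l"] by simp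
    then show "l \<in> {..nat \<bar>k\<bar>}" by simp
  qed
qed simp

lemma num_prime_factors_eq_0:
  assumes "k \<noteq> 0" "\<And>l. Factorial_Ring.prime l \<Longrightarrow> int l dvd k \<Longrightarrow> l \<in> S"
  shows "num_prime_factors S k = 0"
proof -
  have "nat l \<in> S" if "l \<in># prime_factorization k" for l
  proof -
    have l: "Factorial_Ring.prime l" "l dvd k" using that by (auto simp: in_prime_factors_iff)
    then have "l > 0" by (simp add: prime_gt_0_int)
    then show ?thesis using assms(2)[of "nat l"] l by simp
  qed
  then have "filter_mset (\<lambda>l. nat l \<notin> S) (prime_factorization k) = {#}"
    by (intro multiset_eqI) (auto simp: not_in_iff[symmetric])
  then show ?thesis by (simp only: num_prime_factors_def size_empty)
qed

lemma sievable_0: "sievable 0"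
  unfolding sievable_def
proof (intro allI impI)
  fix f F assume f: "f \<in> polys 0" "f \<noteq> 0" "int_valued f"
    and F: "F \<subseteq> polys 0" "\<forall>g\<in>F. int_valued g" "coprime_family (polys 0) F"
  obtain g where g: "g \<in> F" "g \<noteq> 0" using coprime_family_nonzero[OF F(3) subring_of_polys] by blast
  have const: "int_eval p x = int_eval p (\<lambda>_. 0)" if "p \<in> polys 0" for p x
    using that by (auto simp: polys_0 int_eval_def)
  have nz: "int_eval p (\<lambda>_. 0) \<noteq> 0" if "p \<in> polys 0" "int_valued p" "p \<noteq> 0" for p
  proof
    assume "int_eval p (\<lambda>_. 0) = 0"
    then have "eval p x = 0" for x using const[OF that(1), of x] of_int_int_eval[OF that(2), of x] by simp
    then show False using that(3) polyfun_eqI[of p 0] by simp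
  qed
  let ?k = "int_eval f (\<lambda>_. 0)" and ?k' = "int_eval g (\<lambda>_. 0)"
  have k: "?k \<noteq> 0" "?k' \<noteq> 0" using nz f F g by auto
  define S where "S = {l. Factorial_Ring.prime l \<and> int l dvd ?k} \<union> {l. Factorial_Ring.prime l \<and> int l dvd ?k'}"
  have "num_prime_factors S ?k = 0" using k by (intro num_prime_factors_eq_0) (auto simp: S_def)
  then have "sieved S 0 f F x" for x
    using k g const[OF f(1), of x] const[of g x] F(1)
    by (auto simp: sieved_def S_def intro!: bexI[of _ g])
  moreover have "\<exists>x. eval h x \<noteq> 0" if "h \<noteq> 0" for h
    using that polyfun_eqI[of h 0] by auto
  moreover have "finite S" "\<forall>l\<in>S. Factorial_Ring.prime l" using k by (auto simp: S_def finite_prime_divisors)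
  ultimately show "\<exists>S r. finite S \<and> (\<forall>l\<in>S. Factorial_Ring.prime l) \<and>
      (\<forall>h\<in>polys 0. h \<noteq> 0 \<longrightarrow> (\<exists>x. eval h x \<noteq> 0 \<and> sieved S r f F x))"
    by (intro exI[of _ S] exI[of _ "0 :: nat"]) simp
qed

text \<open>
  The restriction of a polynomial with integer-valued coefficients to the fibre over \<open>x\<close>.
\<close>

definition specialize :: "(nat \<Rightarrow> int) \<Rightarrow> polyfun poly \<Rightarrow> int poly"
  where "specialize x p = map_poly (\<lambda>c. int_eval c x) p"

lemma coeff_specialize: "coeff (specialize x p) i = int_eval (coeff p i) x"
  by (simp add: specialize_def coeff_map_poly int_eval_def)

lemma poly_specialize:
  assumes "p \<in> polys_over (polys d)" "\<And>i. int_valued (coeff p i)"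
  shows "of_int (poly (specialize x p) n) = eval (poly p (Var d)) (x(d := n))"
  using assms
proof (induction p)
  case 0
  then show ?case by (simp add: specialize_def)
next
  case (pCons c p)
  have "eval c (x(d := n)) = eval c x"
    using pCons.prems by (intro polyfuns_local[of "eval c" d]) (auto simp: polys_def)
  moreover have "int_valued c" "\<And>i. int_valued (coeff p i)"
    using pCons.prems(2)[of 0] pCons.prems(2)[of "Suc i" for i] by auto
  moreover have "specialize x (pCons c p) = pCons (int_eval c x) (specialize x p)"
    by (simp add: specialize_def map_poly_pCons int_eval_def)
  ultimately show ?case
    using pCons.IH pCons.prems(1) by (simp add: of_int_int_eval del: fun_upd_apply) simp
qed

lemma degree_specialize_le: "degree (specialize x p) \<le> degree p"
  by (rule degree_le) (simp add: coeff_specialize coeff_eq_0 int_eval_def)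

text \<open>
  The element \<open>c\<close> is a generalized resultant. It is found by applying the dichotomy
  for ideals to the set of all polynomials whose values are, up to a fixed denominator \<open>M\<close>, divisible
  by every \<open>l\<close> that divides the values of all elements of \<open>G\<close>. A non-constant common divisor is
  excluded by coprimality.
\<close>

lemma fibre_resultant:
  assumes G: "finite G" "G \<subseteq> polys_over (polys d)" "\<And>g i. g \<in> G \<Longrightarrow> int_valued (coeff g i)"
    and cop: "\<And>e. e \<in> polys_over (polys d) \<Longrightarrow> (\<And>g. g \<in> G \<Longrightarrow> dvd_in (polys_over (polys d)) e g) \<Longrightarrow>
      unit_in (polys_over (polys d)) e"
  shows "\<exists>c\<in>polys d. c \<noteq> 0 \<and> int_valued c \<and> (\<forall>l x n. (\<forall>g\<in>G. int l dvd poly (specialize x g) n) \<longrightarrow> int l dvd int_eval c x)"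
proof -
  note P = subring_ofD[OF subring_of_polys_over[OF subring_of_polys]]
  define ev where "ev P x n = eval (poly P (Var d)) (x(d := n))" for P x n
  have ev: "ev (P * Q) x n = ev P x n * ev Q x n" "ev (P - Q) x n = ev P x n - ev Q x n" for P Q x n
    by (simp_all add: ev_def del: fun_upd_apply)
  define I where "I = {P \<in> polys_over (polys d). \<exists>M::int. M > 0 \<and>
    (\<forall>l x n. (\<forall>g\<in>G. int l dvd poly (specialize x g) n) \<longrightarrow> (\<exists>k. of_int M * ev P x n = of_int (int l * k)))}"
  have I_intro: "P \<in> I" if "P \<in> polys_over (polys d)" "M > 0"
    "\<And>l x n. \<forall>g\<in>G. int l dvd poly (specialize x g) n \<Longrightarrow> \<exists>k. of_int M * ev P x n = of_int (int l * k)"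
    for P and M :: int
    unfolding I_def using that by blast
  have G_I: "g \<in> I" if g: "g \<in> G" for g
  proof -
    have "ev g x n = of_int (poly (specialize x g) n)" for x n
      unfolding ev_def using poly_specialize[of g d x n] g G by (simp add: subset_iff)
    then have "\<exists>k. of_int 1 * ev g x n = of_int (int l * k)"
      if "\<forall>g\<in>G. int l dvd poly (specialize x g) n" for l x n
      using that g by (metis dvd_def mult_1 of_int_1)
    then show ?thesis using g G by (intro I_intro[of g 1]) auto
  qed
  have ideal: "ideal_in (polys_over (polys d)) I"
    unfolding ideal_in_def
  proof (intro conjI ballI)
    show "I \<subseteq> polys_over (polys d)" by (auto simp: I_def)
    fix x assume x: "x \<in> I"
    then obtain M where M: "M > 0" "\<And>l y n. (\<forall>g\<in>G. int l dvd poly (specialize y g) n) \<Longrightarrow> \<exists>k. of_int M * ev x y n = of_int (int l * k)"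
      unfolding I_def by blast
    show "a * x \<in> I" if a: "a \<in> polys_over (polys d)" for a
    proof -
      obtain N :: int where N: "N > 0" "int_valued (Const (of_int N) * poly a (Var d))"
        using common_denominator[of "{poly a (Var d)}"] by auto
      have "\<exists>k. of_int (M * N) * ev (a * x) y n = of_int (int l * k)"
        if l: "\<forall>g\<in>G. int l dvd poly (specialize y g) n" for l y n
      proof -
        obtain k where k: "of_int M * ev x y n = of_int (int l * k)" using M(2)[OF l] by blast
        let ?b = "int_eval (Const (of_int N) * poly a (Var d)) (y(d := n))"
        have "of_int (M * N) * ev (a * x) y n = (of_int N * ev a y n) * (of_int M * ev x y n)"
          by (simp add: ev algebra_simps)
        also have "of_int N * ev a y n = of_int ?b"
          using of_int_int_eval[OF N(2), of "y(d := n)"] by (simp add: ev_def del: fun_upd_apply)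
        finally have "of_int (M * N) * ev (a * x) y n = of_int (int l * (?b * k))"
          unfolding k by (simp add: mult_ac)
        then show ?thesis by blast
      qed
      moreover have "a * x \<in> polys_over (polys d)" using P(5)[OF a] x by (simp add: I_def)
      ultimately show ?thesis using M(1) N(1) by (intro I_intro[of "a * x" "M * N"] mult_pos_pos)
    qed
    fix y assume y: "y \<in> I"
    then obtain N where N: "N > 0" "\<And>l x n. (\<forall>g\<in>G. int l dvd poly (specialize x g) n) \<Longrightarrow> \<exists>k. of_int N * ev y x n = of_int (int l * k)"
      unfolding I_def by blast
    have "\<exists>k. of_int (M * N) * ev (x - y) z n = of_int (int l * k)"
      if l: "\<forall>g\<in>G. int l dvd poly (specialize z g) n" for l z n
    proof -
      obtain j k where jk: "of_int M * ev x z n = of_int (int l * j)" "of_int N * ev y z n = of_int (int l * k)"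
        using M(2)[OF l] N(2)[OF l] by blast
      have "of_int (M * N) * ev (x - y) z n = of_int N * (of_int M * ev x z n) - of_int M * (of_int N * ev y z n)"
        by (simp add: ev algebra_simps)
      also have "\<dots> = of_int (int l * (N * j - M * k))" unfolding jk by (simp add: algebra_simps)
      finally show ?thesis by blast
    qed
    moreover have "x - y \<in> polys_over (polys d)" using P(4) x y by (simp add: I_def)
    ultimately show "x - y \<in> I" using M(1) N(1) by (intro I_intro[of "x - y" "M * N"] mult_pos_pos)
  qed
  have "\<exists>g\<in>G. g \<noteq> 0"
  proof (rule ccontr)
    assume "\<not> (\<exists>g\<in>G. g \<noteq> 0)"
    then have "dvd_in (polys_over (polys d)) 0 g" if "g \<in> G" for g using that P(1) by (auto simp: dvd_in_def)
    then have "unit_in (polys_over (polys d)) 0" using cop[OF P(1)] by blast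
    then show False by (simp add: unit_in_def)
  qed
  then have "\<exists>f\<in>I. f \<noteq> 0" using G_I by blast
  note dichotomy = ideal_const_or_common_divisor[OF factorial_polys ideal this]
  have no_divisor: False if H: "primitive_in (polys d) H" "degree H > 0" "\<forall>f\<in>I. dvd_in (polys_over (polys d)) H f" for H
  proof -
    have "unit_in (polys_over (polys d)) H" using cop[of H] H G_I by (auto simp: primitive_in_def)
    then show False using H(2) unit_in_polys_over_iff[OF subring_of_polys] by auto
  qed
  have "\<exists>c\<in>polys d - {0}. [:c:] \<in> I"
    using dichotomy
  proof
    assume "\<exists>H. primitive_in (polys d) H \<and> degree H > 0 \<and> (\<forall>f\<in>I. dvd_in (polys_over (polys d)) H f)"
    then show ?thesis using no_divisor by (elim exE conjE) blast
  qed
  then obtain c where c: "c \<in> polys d" "c \<noteq> 0" "[:c:] \<in> I" by blast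
  then obtain M where M: "M > 0" "\<And>l x n. (\<forall>g\<in>G. int l dvd poly (specialize x g) n) \<Longrightarrow> \<exists>k. of_int M * ev [:c:] x n = of_int (int l * k)"
    unfolding I_def by blast
  obtain N :: int where N: "N > 0" "int_valued (Const (of_int N) * c)"
    using common_denominator[of "{c}"] by auto
  define c' where "c' = Const (of_int M) * (Const (of_int N) * c)"
  have Const_nz: "Const (of_int k) \<noteq> 0" if "k > 0" for k :: int
    using that eval_Const[of "of_int k" undefined] by (metis eval_simps(1) less_irrefl of_int_eq_0_iff)
  have c': "int_valued c'" "c' \<noteq> 0" "c' \<in> polys d"
    unfolding c'_def using M N c Const_nz subring_ofD(5)[OF subring_of_polys]
    by (auto intro!: int_valued_mult int_valued_Const)
  moreover have "int l dvd int_eval c' x" if l: "\<forall>g\<in>G. int l dvd poly (specialize x g) n" for l x n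
  proof -
    obtain k where k: "of_int M * ev [:c:] x n = of_int (int l * k)" using M(2)[OF l] by blast
    have "eval c (x(d := n)) = eval c x"
      using c by (intro polyfuns_local[of "eval c" d]) (auto simp: polys_def)
    then have "eval c' x = of_int N * (of_int M * ev [:c:] x n)"
      by (simp add: c'_def ev_def del: fun_upd_apply)
    then have "of_int (int_eval c' x) = (of_int (int l * (N * k)) :: rat)"
      unfolding k using of_int_int_eval[OF c'(1)] by (simp add: mult_ac)
    then have "int_eval c' x = int l * (N * k)" by (simp only: of_int_eq_iff)
    then show ?thesis by simp
  qed
  ultimately show ?thesis by blast
qed

lemma coprime_coefficients:
  assumes G: "\<And>e. e \<in> polys_over A \<Longrightarrow> (\<And>g. g \<in> G \<Longrightarrow> dvd_in (polys_over A) e g) \<Longrightarrow> unit_in (polys_over A) e"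
    and A: "subring_of A"
  shows "coprime_family A {coeff g i | g i. g \<in> G \<and> i \<le> degree g}"
  unfolding coprime_family_def
proof (intro ballI impI)
  fix e assume e: "e \<in> A" "\<forall>c\<in>{coeff g i | g i. g \<in> G \<and> i \<le> degree g}. dvd_in A e c"
  have "dvd_in (polys_over A) [:e:] g" if g: "g \<in> G" for g
  proof -
    have "dvd_in A e (coeff g i)" for i
    proof (cases "i \<le> degree g")
      case False
      then show ?thesis using subring_ofD(1)[OF A] by (auto simp: coeff_eq_0 dvd_in_def)
    qed (use e g in blast)
    then obtain h where "h \<in> polys_over A" "g = smult e h" using const_dvd_iff[OF A] by metis
    then show ?thesis by (auto simp: dvd_in_def)
  qed
  then have "unit_in (polys_over A) [:e:]" using G[OF const_in_polys_over[OF A e(1)]] by blast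
  then show "unit_in A e" by (simp add: unit_in_polys_over_iff[OF A])
qed

text \<open>
  The induction hypothesis is used for the leading coefficient of \<open>f\<close> and all coefficients of \<open>G\<close>,
  at points where neither \<open>c\<close> nor the leading coefficient of \<open>h\<close> vanishes. The sieve in one variable
  then runs on the fibre, beyond all roots of \<open>h\<close>.
\<close>

lemma sieve_fibres:
  assumes IH: "sievable d"
    and f: "f \<in> polys_over (polys d)" "f \<noteq> 0" "\<And>i. int_valued (coeff f i)"
    and G: "finite G" "G \<subseteq> polys_over (polys d)" "\<And>g i. g \<in> G \<Longrightarrow> int_valued (coeff g i)"
    and cop: "\<And>e. e \<in> polys_over (polys d) \<Longrightarrow> (\<And>g. g \<in> G \<Longrightarrow> dvd_in (polys_over (polys d)) e g) \<Longrightarrow>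
      unit_in (polys_over (polys d)) e"
  shows "\<exists>S r. finite S \<and> (\<forall>l\<in>S. Factorial_Ring.prime l) \<and>
    (\<forall>h\<in>polys_over (polys d). h \<noteq> 0 \<longrightarrow> (\<exists>x n. eval (poly h (Var d)) (x(d := n)) \<noteq> 0 \<and>
      poly (specialize x f) n \<noteq> 0 \<and> num_prime_factors S (poly (specialize x f) n) \<le> r \<and>
      (\<forall>l. Factorial_Ring.prime l \<and> l \<notin> S \<longrightarrow> (\<exists>g\<in>G. \<not> int l dvd poly (specialize x g) n))))"
proof -
  let ?F = "{coeff g i | g i. g \<in> G \<and> i \<le> degree g}"
  obtain c where c: "c \<in> polys d" "c \<noteq> 0" "int_valued c"
    "\<And>l x n. (\<forall>g\<in>G. int l dvd poly (specialize x g) n) \<Longrightarrow> int l dvd int_eval c x"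
    using fibre_resultant[OF G cop] by blast
  have "?F = (\<Union>g\<in>G. (\<lambda>i. coeff g i) ` {..degree g})" by auto
  then have finF: "finite ?F" using G(1) by simp
  have F: "?F \<subseteq> polys d" "\<forall>g\<in>?F. int_valued g" using G(2,3) coeff_in by blast+
  have copF: "coprime_family (polys d) ?F"
    by (rule coprime_coefficients[OF cop subring_of_polys])
  have lf: "lead_coeff f \<in> polys d" "lead_coeff f \<noteq> 0" "int_valued (lead_coeff f)"
    using f coeff_in by auto
  note IH' = IH[unfolded sievable_def, THEN spec[of _ "lead_coeff f"], THEN spec[of _ ?F], THEN mp, OF lf(1),
      THEN mp, OF lf(2), THEN mp, OF lf(3), THEN mp, OF finF, THEN mp, OF F(1), THEN mp, OF F(2), THEN mp, OF copF]
  then obtain S1 r1 where S1: "finite S1" "\<forall>l\<in>S1. Factorial_Ring.prime l"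
    and dense: "\<forall>h\<in>polys d. h \<noteq> 0 \<longrightarrow> (\<exists>x. eval h x \<noteq> 0 \<and> sieved S1 r1 (lead_coeff f) ?F x)"
    by (elim exE conjE)
  define \<kappa> where "\<kappa> = Max (insert (degree f) (degree ` G))"
  have \<kappa>: "degree f \<le> \<kappa>" "\<And>g. g \<in> G \<Longrightarrow> degree g \<le> \<kappa>" using G(1) by (auto simp: \<kappa>_def)
  obtain N r where sieve: "\<forall>S r0 q Q R y.
    (\<forall>l. Factorial_Ring.prime l \<and> l \<le> N \<longrightarrow> l \<in> S) \<longrightarrow>
    q \<noteq> 0 \<longrightarrow> degree q \<le> \<kappa> \<longrightarrow> num_prime_factors S (lead_coeff q) \<le> r0 \<longrightarrow>
    (\<forall>P\<in>Q. degree P \<le> \<kappa>) \<longrightarrow>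
    (\<forall>l. Factorial_Ring.prime l \<and> l \<notin> S \<longrightarrow> (\<exists>P\<in>Q. \<exists>i. \<not> int l dvd coeff P i)) \<longrightarrow>
    R \<noteq> 0 \<longrightarrow> (\<forall>l n. Factorial_Ring.prime l \<and> (\<forall>P\<in>Q. int l dvd poly P n) \<longrightarrow> int l dvd R) \<longrightarrow>
    (\<exists>n\<ge>y. poly q n \<noteq> 0 \<and> num_prime_factors S (poly q n) \<le> r0 + r \<and>
      (\<forall>l. Factorial_Ring.prime l \<and> l \<notin> S \<longrightarrow> (\<exists>P\<in>Q. \<not> int l dvd poly P n)))"
    using almost_prime_values[of \<kappa>] by (elim exE)
  define S where "S = S1 \<union> {l. Factorial_Ring.prime l \<and> l \<le> N}"
  have S: "finite S" "\<forall>l\<in>S. Factorial_Ring.prime l" using S1 by (auto simp: S_def)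
  have "\<exists>x n. eval (poly h (Var d)) (x(d := n)) \<noteq> 0 \<and>
      poly (specialize x f) n \<noteq> 0 \<and> num_prime_factors S (poly (specialize x f) n) \<le> r1 + r \<and>
      (\<forall>l. Factorial_Ring.prime l \<and> l \<notin> S \<longrightarrow> (\<exists>g\<in>G. \<not> int l dvd poly (specialize x g) n))"
    if h: "h \<in> polys_over (polys d)" "h \<noteq> 0" for h
  proof -
    have "lead_coeff h * c \<in> polys d" "lead_coeff h * c \<noteq> 0"
      using h c coeff_in by (auto intro!: subring_ofD(5)[OF subring_of_polys])
    from dense[rule_format, OF this] obtain x where x: "eval (lead_coeff h) x \<noteq> 0" "eval c x \<noteq> 0"
      "sieved S1 r1 (lead_coeff f) ?F x" by auto
    have "int_eval (lead_coeff f) x \<noteq> 0" using x(3) by (simp add: sieved_def)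
    then have lead: "coeff (specialize x f) (degree f) \<noteq> 0" by (simp add: coeff_specialize)
    then have deg: "degree (specialize x f) = degree f"
      using degree_specialize_le[of x f] le_degree[OF lead] by simp
    have "map_poly (\<lambda>c. eval c x) h \<noteq> 0"
      using x(1) by (metis coeff_0 coeff_map_poly eval_simps(1))
    then obtain y where y: "\<And>n :: int. n \<ge> y \<Longrightarrow> poly (map_poly (\<lambda>c. eval c x) h) (of_int n) \<noteq> 0"
      using poly_nonzero_eventually by blast
    have "\<exists>n\<ge>y. poly (specialize x f) n \<noteq> 0 \<and> num_prime_factors S (poly (specialize x f) n) \<le> r1 + r \<and>
      (\<forall>l. Factorial_Ring.prime l \<and> l \<notin> S \<longrightarrow> (\<exists>P\<in>specialize x ` G. \<not> int l dvd poly P n))"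
    proof (rule sieve[rule_format, where R = "int_eval c x"])
      show "l \<in> S" if "Factorial_Ring.prime l \<and> l \<le> N" for l using that by (simp add: S_def)
      show "specialize x f \<noteq> 0" using lead by auto
      show "degree (specialize x f) \<le> \<kappa>" using deg \<kappa> by simp
      have "num_prime_factors S (lead_coeff (specialize x f)) \<le> num_prime_factors S1 (int_eval (lead_coeff f) x)"
        unfolding deg coeff_specialize by (rule num_prime_factors_antimono) (simp add: S_def)
      also have "\<dots> \<le> r1" using x(3) by (simp add: sieved_def)
      finally show "num_prime_factors S (lead_coeff (specialize x f)) \<le> r1" .
      show "degree P \<le> \<kappa>" if "P \<in> specialize x ` G" for P
        using that \<kappa>(2) degree_specialize_le le_trans by blast
      show "\<exists>P\<in>specialize x ` G. \<exists>i. \<not> int l dvd coeff P i" if l: "Factorial_Ring.prime l \<and> l \<notin> S" for l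
      proof -
        have "l \<notin> S1" using l by (simp add: S_def)
        then obtain g i where "g \<in> G" "\<not> int l dvd int_eval (coeff g i) x"
          using x(3) l unfolding sieved_def by blast
        then show ?thesis by (auto simp: coeff_specialize)
      qed
      show "int_eval c x \<noteq> 0" using x(2) of_int_int_eval[OF c(3), of x] by auto
      show "int l dvd int_eval c x"
        if "Factorial_Ring.prime l \<and> (\<forall>P\<in>specialize x ` G. int l dvd poly P n)" for l n
        using that c(4) by blast
    qed
    then obtain n where n: "n \<ge> y" "poly (specialize x f) n \<noteq> 0" "num_prime_factors S (poly (specialize x f) n) \<le> r1 + r"
      "\<forall>l. Factorial_Ring.prime l \<and> l \<notin> S \<longrightarrow> (\<exists>g\<in>G. \<not> int l dvd poly (specialize x g) n)" by auto
    moreover have "eval (poly h (Var d)) (x(d := n)) \<noteq> 0"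
      using y[OF n(1)] eval_poly_Var[OF h(1), of x n] by simp
    ultimately show ?thesis by blast
  qed
  then show ?thesis using S by (intro exI[of _ S] exI[of _ "r1 + r"]) simp
qed

text \<open>
  What remains is to make the coefficients with respect to the last variable integer-valued. The
  conclusion passes from \<open>M * f\<close> and \<open>M * g\<close> to their divisors \<open>f\<close> and \<open>g\<close>.
\<close>

lemma sievable_Suc:
  assumes IH: "sievable d"
  shows "sievable (Suc d)"
  unfolding sievable_def
proof (intro allI impI)
  fix f F assume f: "f \<in> polys (Suc d)" "f \<noteq> 0" "int_valued f" and finF: "finite F"
    and F: "F \<subseteq> polys (Suc d)" "\<forall>g\<in>F. int_valued g" "coprime_family (polys (Suc d)) F"
  let ?P = "polys_over (polys d)"
  let ?\<phi> = "\<lambda>q. poly q (Var d)"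
  note P = subring_ofD[OF subring_of_polys_over[OF subring_of_polys, of d]]
  obtain p where p: "p \<in> ?P" "f = ?\<phi> p" using f(1) by (auto simp: polys_Suc)
  have "\<forall>g\<in>F. \<exists>q\<in>?P. g = ?\<phi> q" using F(1) by (auto simp: polys_Suc)
  then obtain \<psi> where \<psi>: "\<And>g. g \<in> F \<Longrightarrow> \<psi> g \<in> ?P \<and> g = ?\<phi> (\<psi> g)" by metis
  define C where "C = (\<Union>q\<in>insert p (\<psi> ` F). coeff q ` {..degree q})"
  have "finite C" using finF by (simp add: C_def)
  then obtain M :: int where M: "M > 0" "\<And>c. c \<in> C \<Longrightarrow> int_valued (Const (of_int M) * c)"
    using common_denominator by blast
  have IV: "int_valued (coeff (smult (Const (of_int M)) q) i)" if "q = p \<or> q \<in> \<psi> ` F" for q i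
  proof (cases "i \<le> degree q")
    case True
    then show ?thesis using that M(2)[of "coeff q i"] by (auto simp: C_def)
  next
    case False
    then show ?thesis by (simp add: coeff_eq_0 int_valued_def)
  qed
  let ?s = "smult (Const (of_int M))"
  define p' where "p' = ?s p"
  define G where "G = (\<lambda>g. ?s (\<psi> g)) ` F"
  have Mnz: "Const (of_int M) \<noteq> 0" using M(1) by (metis eval_Const eval_simps(1) less_irrefl of_int_eq_0_iff)
  have MC: "Const (1 / of_int M) * Const (of_int M) = 1"
    using M(1) by (intro polyfun_eqI) simp
  have "p' \<in> ?P" using p(1) by (simp add: p'_def smult_in_polys_over subring_of_polys)
  moreover have "p' \<noteq> 0" using f p Mnz by (auto simp: p'_def)
  moreover have "int_valued (coeff p' i)" for i unfolding p'_def using IV by blast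
  moreover have "finite G" using finF by (simp add: G_def)
  moreover have "G \<subseteq> ?P" using \<psi> by (auto simp: G_def smult_in_polys_over subring_of_polys)
  moreover have "int_valued (coeff g i)" if "g \<in> G" for g i using that IV unfolding G_def by blast
  moreover have "unit_in ?P e" if e: "e \<in> ?P" "\<And>g. g \<in> G \<Longrightarrow> dvd_in ?P e g" for e
  proof -
    have "dvd_in (polys (Suc d)) (?\<phi> e) g" if g: "g \<in> F" for g
    proof -
      obtain k where k: "k \<in> ?P" "?s (\<psi> g) = e * k" using e(2) g by (auto simp: G_def dvd_in_def)
      have "g = Const (1 / of_int M) * Const (of_int M) * ?\<phi> (\<psi> g)" using \<psi>[OF g] MC by simp
      also have "\<dots> = Const (1 / of_int M) * ?\<phi> (?s (\<psi> g))" by simp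
      also have "\<dots> = ?\<phi> e * ?\<phi> (smult (Const (1 / of_int M)) k)" unfolding k(2) by simp
      finally have "g = ?\<phi> e * ?\<phi> (smult (Const (1 / of_int M)) k)" .
      then show ?thesis unfolding dvd_in_def polys_Suc
        using k(1) by (blast intro: smult_in_polys_over subring_of_polys Const_in_polys)
    qed
    then have "unit_in (polys (Suc d)) (?\<phi> e)" using F(3) e(1) by (auto simp: coprime_family_def polys_Suc)
    then obtain k where k: "k \<in> ?P" "?\<phi> e * ?\<phi> k = 1" by (auto simp: unit_in_def polys_Suc)
    then have "?\<phi> (e * k - 1) = 0" by simp
    then have "e * k - 1 = 0" using P e k by (intro Var_transcendental) auto
    then show ?thesis using e k by (auto simp: unit_in_def)
  qed
  ultimately obtain S r where S: "finite S" "\<forall>l\<in>S. Factorial_Ring.prime l"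
    and dense: "\<And>h. h \<in> ?P \<Longrightarrow> h \<noteq> 0 \<Longrightarrow> \<exists>x n. eval (?\<phi> h) (x(d := n)) \<noteq> 0 \<and>
      poly (specialize x p') n \<noteq> 0 \<and> num_prime_factors S (poly (specialize x p') n) \<le> r \<and>
      (\<forall>l. Factorial_Ring.prime l \<and> l \<notin> S \<longrightarrow> (\<exists>g\<in>G. \<not> int l dvd poly (specialize x g) n))"
    using sieve_fibres[OF IH, of p' G] by metis
  have spec: "poly (specialize x (?s q)) n = M * int_eval (?\<phi> q) (x(d := n))"
    if "q \<in> ?P" "q = p \<or> q \<in> \<psi> ` F" "int_valued (?\<phi> q)" for q x n
  proof -
    have "of_int (poly (specialize x (?s q)) n) = eval (?\<phi> (?s q)) (x(d := n))"
      using that IV by (intro poly_specialize) (auto simp: smult_in_polys_over subring_of_polys)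
    also have "\<dots> = of_int M * eval (?\<phi> q) (x(d := n))" by (simp del: fun_upd_apply)
    also have "\<dots> = of_int (M * int_eval (?\<phi> q) (x(d := n)))" using of_int_int_eval[OF that(3)] by simp
    finally show ?thesis by (simp only: of_int_eq_iff)
  qed
  have "\<exists>x. eval h x \<noteq> 0 \<and> sieved S r f F x" if h: "h \<in> polys (Suc d)" "h \<noteq> 0" for h
  proof -
    obtain q where q: "q \<in> ?P" "h = ?\<phi> q" using h(1) by (auto simp: polys_Suc)
    then have "q \<noteq> 0" using h(2) by auto
    then obtain x n where xn: "eval h (x(d := n)) \<noteq> 0" "poly (specialize x p') n \<noteq> 0"
      "num_prime_factors S (poly (specialize x p') n) \<le> r"
      "\<And>l. Factorial_Ring.prime l \<Longrightarrow> l \<notin> S \<Longrightarrow> \<exists>g\<in>G. \<not> int l dvd poly (specialize x g) n"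
      using dense[OF q(1)] q(2) by blast
    have fx: "poly (specialize x p') n = M * int_eval f (x(d := n))"
      using spec[of p x n] p f by (simp add: p'_def)
    have "num_prime_factors S (int_eval f (x(d := n))) \<le> r"
      using num_prime_factors_dvd[of "int_eval f (x(d := n))" "poly (specialize x p') n" S] xn fx by auto
    moreover have "\<exists>g\<in>F. \<not> int l dvd int_eval g (x(d := n))" if l: "Factorial_Ring.prime l" "l \<notin> S" for l
    proof -
      obtain g where g: "g \<in> F" "\<not> int l dvd poly (specialize x (?s (\<psi> g))) n" using xn(4)[OF l] by (auto simp: G_def)
      have "poly (specialize x (?s (\<psi> g))) n = M * int_eval g (x(d := n))"
        using spec[of "\<psi> g" x n] \<psi>[OF g(1)] g(1) F(2) by auto
      then have "\<not> int l dvd int_eval g (x(d := n))" using g(2) by (metis dvd_mult)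
      then show ?thesis using g(1) by blast
    qed
    ultimately have "sieved S r f F (x(d := n))" using xn(2) fx by (auto simp: sieved_def)
    then show ?thesis using xn(1) by blast
  qed
  then show "\<exists>S r. finite S \<and> (\<forall>l\<in>S. Factorial_Ring.prime l) \<and>
      (\<forall>h\<in>polys (Suc d). h \<noteq> 0 \<longrightarrow> (\<exists>x. eval h x \<noteq> 0 \<and> sieved S r f F x))"
    using S by (intro exI[of _ S] exI[of _ r]) simp
qed

theorem sievable: "sievable d"
  by (induction d) (auto intro: sievable_0 sievable_Suc)

section \<open>Nil algebras of matrices\<close>

definition cscale :: "complex \<Rightarrow> complex^'n^'n \<Rightarrow> complex^'n^'n" (infixl "*k" 70)
  where "c *k A = (\<chi> i j. c * A $ i $ j)"

lemma poly_det:
  fixes M :: "complex \<Rightarrow> complex^'n^'n"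
  assumes "\<And>i j. \<exists>p. \<forall>s. M s $ i $ j = poly p s"
  shows "\<exists>p. \<forall>s. det (M s) = poly p s"
proof -
  obtain p where p: "\<And>i j s. M s $ i $ j = poly (p i j) s" using assms by metis
  show ?thesis
    by (intro exI[of _ "\<Sum>\<sigma> | \<sigma> permutes UNIV. [:of_int (sign \<sigma>):] * (\<Prod>i\<in>UNIV. p i (\<sigma> i))"])
      (simp add: det_def p poly_sum poly_prod)
qed

lemma det_derivative_at_identity:
  fixes X :: "complex^'n^'n"
  shows "((\<lambda>s. det (mat 1 + s *k X)) has_field_derivative trace X) (at 0)"
proof -
  let ?e = "\<lambda>i j s. (if i = j then 1 else 0) + s * X $ i $ j"
  have deriv: "((\<lambda>s. of_int (sign \<sigma>) * (\<Prod>i\<in>UNIV. ?e i (\<sigma> i) s)) has_field_derivative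
      (if \<sigma> = id then trace X else 0)) (at 0)"
    if \<sigma>: "\<sigma> permutes UNIV" for \<sigma> :: "'n \<Rightarrow> 'n"
  proof -
    have "((\<lambda>s. of_int (sign \<sigma>) * (\<Prod>i\<in>UNIV. ?e i (\<sigma> i) s)) has_field_derivative
       of_int (sign \<sigma>) * (\<Sum>i\<in>UNIV. X $ i $ \<sigma> i * (\<Prod>j\<in>UNIV - {i}. ?e j (\<sigma> j) 0))) (at 0)"
      by (intro DERIV_cmult has_field_derivative_prod) (auto intro!: derivative_eq_intros)
    moreover have "of_int (sign \<sigma>) * (\<Sum>i\<in>UNIV. X $ i $ \<sigma> i * (\<Prod>j\<in>UNIV - {i}. ?e j (\<sigma> j) 0))
        = (if \<sigma> = id then trace X else 0)"
    proof (cases "\<sigma> = id")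
      case True
      then show ?thesis by (simp add: trace_def sign_id)
    next
      case False
      have zero: "(\<Prod>j\<in>UNIV - {i}. ?e j (\<sigma> j) 0) = 0" for i
      proof -
        obtain k where k: "\<sigma> k \<noteq> k" using False by (auto simp: fun_eq_iff)
        have "\<sigma> (\<sigma> k) \<noteq> \<sigma> k" using k permutes_inj[OF \<sigma>] by (auto dest: injD)
        then obtain j where "j \<noteq> i" "\<sigma> j \<noteq> j" using k by metis
        then show ?thesis by (intro prod_zero) (auto intro!: bexI[of _ j])
      qed
      show ?thesis by (simp only: zero False mult_zero_right sum.neutral_const if_False)
    qed
    ultimately show ?thesis by simp
  qed
  have "det (mat 1 + s *k X) = (\<Sum>\<sigma> | \<sigma> permutes UNIV. of_int (sign \<sigma>) * (\<Prod>i\<in>UNIV. ?e i (\<sigma> i) s))" for s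
    by (simp add: det_def mat_def cscale_def)
  moreover have "((\<lambda>s. \<Sum>\<sigma> | \<sigma> permutes UNIV. of_int (sign \<sigma>) * (\<Prod>i\<in>UNIV. ?e i (\<sigma> i) s))
      has_field_derivative (\<Sum>\<sigma> | \<sigma> permutes (UNIV :: 'n set). if \<sigma> = id then trace X else 0)) (at 0)"
    by (rule DERIV_sum, rule deriv) simp
  moreover have "(\<Sum>\<sigma> | \<sigma> permutes (UNIV :: 'n set). if \<sigma> = id then trace X else 0) = trace X"
    by (simp add: permutes_id)
  ultimately show ?thesis by (simp only:)
qed

lemma det_pencil_poly:
  fixes X :: "complex^'n^'n"
  shows "\<exists>p. (\<forall>s. det (mat 1 + s *k X) = poly p s) \<and> poly p 0 = 1 \<and> poly (pderiv p) 0 = trace X"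
proof -
  have "\<exists>p. \<forall>s. (mat 1 + s *k X) $ i $ j = poly p s" for i j
    by (intro exI[of _ "[:mat 1 $ i $ j, X $ i $ j:]"]) (simp add: cscale_def)
  then obtain p where p: "\<And>s. det (mat 1 + s *k X) = poly p s"
    using poly_det[of "\<lambda>s. mat 1 + s *k X"] by blast
  have "mat 1 + 0 *k X = (mat 1 :: complex^'n^'n)" by (simp add: vec_eq_iff cscale_def)
  then have "poly p 0 = 1" using p[of 0] by simp
  moreover have "(poly p has_field_derivative trace X) (at 0)"
    using det_derivative_at_identity[of X] by (simp add: p)
  then have "poly (pderiv p) 0 = trace X" using poly_DERIV DERIV_unique by blast
  ultimately show ?thesis using p by blast
qed

lemma matrix_vector_funpow:
  "(((**) X ^^ k) (mat 1)) *v v = (((*v) X) ^^ k) v"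
  for X :: "complex^'n^'n"
  by (induction k) (simp_all flip: matrix_vector_mul_assoc)

lemma scalar_matrix_vector: "(c *k X) *v v = c *s (X *v v)"
  for X :: "complex^'n^'n"
  by (simp add: vec_eq_iff matrix_vector_mult_def cscale_def sum_distrib_left mult.assoc)

text \<open>
  For nilpotent \<open>X\<close> the polynomial \<open>det (1 + s X)\<close> has no complex root, so it is constant. Its value at
  \<open>1\<close> and its derivative at \<open>0\<close> give the determinant and the trace.
\<close>

lemma unipotent_det_trace:
  fixes A :: "complex^'n^'n"
  assumes "unipotent A"
  shows "det A = 1" "trace (A - mat 1) = 0"
proof -
  define X where "X = A - mat 1"
  obtain k where k: "((**) X ^^ k) (mat 1) = 0" using assms by (auto simp: unipotent_def X_def)
  obtain p where p: "\<And>s. det (mat 1 + s *k X) = poly p s" "poly p 0 = 1" "poly (pderiv p) 0 = trace X"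
    using det_pencil_poly[of X] by blast
  have "poly p s \<noteq> 0" for s
  proof
    assume "poly p s = 0"
    then have "det (mat 1 + s *k X) = 0" by (simp add: p)
    then have "\<nexists>B. B ** (mat 1 + s *k X) = mat 1"
      by (metis invertible_det_nz invertible_left_inverse)
    then obtain v where v: "v \<noteq> 0" "(mat 1 + s *k X) *v v = 0"
      by (auto simp: matrix_left_invertible_ker)
    then have "v = (- s) *s (X *v v)"
      by (simp add: matrix_vector_mult_add_rdistrib scalar_matrix_vector vec_eq_iff) (metis add_eq_0_iff2)
    have "v = ((- s) ^ k) *s ((((*v) X) ^^ k) v)" for k
    proof (induction k)
      case (Suc k)
      have "v = (- s) *s (X *v v)" by fact
      also have "X *v v = X *v (((- s) ^ k) *s ((((*v) X) ^^ k) v))" using Suc by simp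
      finally show ?case by (simp add: vector_scalar_commute vector_smult_assoc)
    qed simp
    then have "v = ((- s) ^ k) *s ((((**) X ^^ k) (mat 1)) *v v)" by (simp only: matrix_vector_funpow)
    then show False using v(1) by (simp add: k)
  qed
  then have "constant (poly p)" using fundamental_theorem_of_algebra by blast
  then have p1: "poly p s = 1" for s using p(2) by (metis constant_def)
  have "mat 1 + 1 *k X = A" by (simp add: X_def vec_eq_iff cscale_def)
  then show "det A = 1" using p(1)[of 1] p1 by simp
  have "poly p = poly [:1:]" using p1 by (simp add: fun_eq_iff)
  then have "p = [:1:]" by (simp only: poly_eq_poly_eq_iff)
  then show "trace (A - mat 1) = 0" using p(3) by (simp add: X_def)
qed

lemma linear_matrix_left: "linear (\<lambda>Y :: complex^'n^'n. X ** Y)"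
  by (rule linearI) (simp_all add: matrix_add_ldistrib matrix_scalar_ac scalar_matrix_assoc)

lemma linear_matrix_right: "linear (\<lambda>X :: complex^'n^'n. X ** Y)"
  by (rule linearI) (simp_all add: vec_eq_iff matrix_matrix_mult_def sum.distrib distrib_right scaleR_sum_right)

lemma linear_matrix_apply: "linear (\<lambda>X :: complex^'n^'n. X *v v)"
  by (rule linearI) (simp_all add: vec_eq_iff matrix_vector_mult_def sum.distrib distrib_right scaleR_sum_right)

lemma matrix_apply_lincomb: "(c *\<^sub>R X + Y) *v v = c *\<^sub>R (X *v v) + Y *v v"
  for X Y :: "complex^'n^'n"
  by (simp add: vec_eq_iff matrix_vector_mult_def sum.distrib distrib_right scaleR_sum_right)

lemma matrix_mult_diff_ldistrib: "A ** (B - C) = A ** B - A ** C"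
  and matrix_mult_diff_rdistrib: "(B - C) ** A = B ** A - C ** A"
  for A B C :: "complex^'n^'n"
  by (simp_all add: vec_eq_iff matrix_matrix_mult_def sum_subtractf algebra_simps)

lemma matrix_cscale_minus: "X ** (c *k (- Y)) = c *k (- (X ** Y))"
  for X Y :: "complex^'n^'n"
  by (simp add: vec_eq_iff matrix_matrix_mult_def cscale_def sum_distrib_left sum_negf algebra_simps)

text \<open>
  Let \<open>D(s) = det (1 - s b)\<close>. For real \<open>s\<close> with \<open>D(s) \<noteq> 0\<close>, multiplication by \<open>1 - s b\<close> is a
  bijection of \<open>N\<close>, so \<open>b = (1 - s b) a\<close> with \<open>a \<in> N\<close>. Then \<open>D(s + h) = D(s) det (1 - h a)\<close>, and the
  derivative of \<open>D\<close> at \<open>s\<close> is \<open>- D(s)\<close> times the trace of \<open>a\<close>, which is zero. Hence \<open>D\<close> is constant and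
  \<open>1 - b\<close> is invertible.
\<close>

lemma no_fixed_vector:
  fixes N :: "(complex^'n^'n) set"
  assumes N: "subspace N" "\<And>x y. x \<in> N \<Longrightarrow> y \<in> N \<Longrightarrow> x ** y \<in> N" "\<And>x. x \<in> N \<Longrightarrow> trace x = 0"
    and b: "b \<in> N" "b *v v = v"
  shows "v = 0"
proof -
  obtain p where p: "\<And>s. det (mat 1 + s *k (- b)) = poly p s" "poly p 0 = 1"
    using det_pencil_poly[of "- b"] by blast
  have "poly (p * pderiv p) (complex_of_real s) = 0" for s :: real
  proof (cases "poly p (of_real s) = 0")
    case False
    let ?s = "complex_of_real s"
    let ?M = "mat 1 + ?s *k (- b)"
    have det: "det ?M \<noteq> 0" using False by (simp add: p)
    have inj: "x = 0" if "?M ** x = 0" for x :: "complex^'n^'n"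
    proof -
      obtain C where "C ** ?M = mat 1" using det invertible_det_nz[of ?M] by (auto simp: invertible_def)
      then have "x = C ** (?M ** x)" by (simp add: matrix_mul_assoc)
      then show ?thesis using that by simp
    qed
    have M: "?M ** x = x - s *\<^sub>R (b ** x)" for x :: "complex^'n^'n"
    proof -
      have "?M = mat 1 - s *\<^sub>R b" by (simp add: vec_eq_iff cscale_def) (simp add: scaleR_conv_of_real)
      then show ?thesis by (simp add: matrix_mult_diff_rdistrib scalar_matrix_assoc)
    qed
    have "(\<lambda>x. ?M ** x) ` N \<subseteq> N"
      unfolding M using N b by (auto intro!: subspace_diff subspace_scale)
    moreover have "dim ((\<lambda>x. ?M ** x) ` N) = dim N"
    proof (rule dim_image_eq[OF linear_matrix_left])
      show "inj_on ((**) ?M) (span N)"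
        by (rule inj_onI) (metis inj matrix_mult_diff_ldistrib right_minus_eq)
    qed
    ultimately have "(\<lambda>x. ?M ** x) ` N = N"
      using N(1) linear_subspace_image[OF linear_matrix_left N(1)] by (intro subspace_dim_equal) auto
    then have "b \<in> (\<lambda>x. ?M ** x) ` N" by (simp only: b(1))
    then obtain a where a: "b = ?M ** a" "a \<in> N" by (rule imageE)
    have fac: "poly p (?s + h) = poly p ?s * det (mat 1 + h *k (- a))" for h
    proof -
      have "?M ** (h *k (- a)) = h *k (- b)"
        by (simp only: matrix_cscale_minus a(1)[symmetric])
      then have "?M ** (mat 1 + h *k (- a)) = ?M + h *k (- b)"
        by (simp add: matrix_add_ldistrib)
      also have "\<dots> = mat 1 + (?s + h) *k (- b)"
        by (simp add: vec_eq_iff cscale_def algebra_simps)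
      finally show ?thesis unfolding p(1)[symmetric] det_mul[symmetric] by simp
    qed
    have "((\<lambda>h. poly p ?s * det (mat 1 + h *k (- a))) has_field_derivative poly p ?s * trace (- a)) (at 0)"
      by (intro DERIV_cmult det_derivative_at_identity)
    moreover have "trace (- a) = 0" using N(3)[OF a(2)] by (simp add: trace_def sum_negf)
    ultimately have "((\<lambda>h. poly p (?s + h)) has_field_derivative 0) (at 0)" by (simp add: fac)
    then have "(poly p has_field_derivative 0) (at ?s)"
      using DERIV_shift[of "poly p" 0 0 ?s] by (simp add: add.commute)
    then have "poly (pderiv p) ?s = 0" using poly_DERIV DERIV_unique by blast
    then show ?thesis by simp
  qed simp
  then have "p * pderiv p = 0"
    by (intro poly_zero_on_ints[of 0]) (metis of_real_of_int_eq)
  moreover have "p \<noteq> 0" using p(2) by auto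
  ultimately have "pderiv p = 0" by simp
  then have "degree p = 0" by (simp add: pderiv_eq_0_iff)
  then obtain c where "p = [:c:]" by (metis degree_eq_zeroE)
  then have "poly p 1 = 1" using p(2) by simp
  then have "det (mat 1 + 1 *k (- b)) \<noteq> 0" using p(1)[of 1] by simp
  moreover have "mat 1 + 1 *k (- b) = mat 1 - b" by (simp add: vec_eq_iff cscale_def)
  ultimately have "invertible (mat 1 - b)" by (simp add: invertible_det_nz)
  then obtain C where "C ** (mat 1 - b) = mat 1" by (auto simp: invertible_def)
  then have "v = C *v ((mat 1 - b) *v v)" by (simp add: matrix_vector_mul_assoc)
  also have "(mat 1 - b) *v v = 0" using b(2) by (simp add: matrix_vector_mult_diff_rdistrib)
  finally show ?thesis by simp
qed

text \<open>
  An argument in the style of Nakayama's lemma. Suppose \<open>N\<close> equals its square and let \<open>K\<close> be the space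
  of vectors killed by \<open>N\<close>. Among the vectors \<open>w \<notin> K\<close> take one with \<open>N w\<close> of least dimension and
  \<open>a \<in> N\<close> with \<open>a w \<notin> K\<close>. Then \<open>N a w\<close> is contained in \<open>N w\<close>, hence equal to it and contains \<open>a w\<close>.
  So \<open>a w = b a w\<close> with \<open>b \<in> N\<close>, which makes \<open>a w\<close> zero.
\<close>

lemma nil_algebra_square:
  fixes N :: "(complex^'n^'n) set"
  assumes N: "subspace N" "\<And>x y. x \<in> N \<Longrightarrow> y \<in> N \<Longrightarrow> x ** y \<in> N" "\<And>x. x \<in> N \<Longrightarrow> trace x = 0"
    and "x0 \<in> N" "x0 \<noteq> 0"
  shows "span {x ** y | x y. x \<in> N \<and> y \<in> N} \<noteq> N"
proof
  assume N2: "span {x ** y | x y. x \<in> N \<and> y \<in> N} = N"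
  define K where "K = {v. \<forall>x\<in>N. x *v v = 0}"
  let ?W = "\<lambda>w. (\<lambda>x. x *v w) ` N"
  have KI: "v \<in> K" if "\<And>x. x \<in> N \<Longrightarrow> x *v v \<in> K" for v
  proof -
    have "x *v v = 0" if "x \<in> span {x ** y | x y. x \<in> N \<and> y \<in> N}" for x
      using that
    proof (induction rule: span_induct_alt)
      case (step c x y)
      then obtain a b where ab: "x = a ** b" "a \<in> N" "b \<in> N" by blast
      have "x *v v = a *v (b *v v)" by (simp add: ab matrix_vector_mul_assoc)
      also have "\<dots> = 0" using \<open>\<And>x. x \<in> N \<Longrightarrow> x *v v \<in> K\<close> ab by (auto simp: K_def)
      finally have "x *v v = 0" .
      then show ?case using step by (simp add: matrix_apply_lincomb)
    qed simp
    then show ?thesis by (simp add: K_def N2)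
  qed
  have "\<exists>w. w \<notin> K"
  proof (rule ccontr)
    assume "\<not> (\<exists>w. w \<notin> K)"
    then have "x0 *v v = 0" for v using assms(4) by (auto simp: K_def)
    then have "x0 *v v = 0 *v v" for v by simp
    then show False using assms(5) by (metis matrix_eq)
  qed
  then obtain w where w: "w \<notin> K" "\<And>u. u \<notin> K \<Longrightarrow> dim (?W w) \<le> dim (?W u)"
    using ex_has_least_nat[of "\<lambda>w. w \<notin> K" _ "\<lambda>w. dim (?W w)"] by metis
  obtain a where a: "a \<in> N" "a *v w \<notin> K" using KI w(1) by blast
  let ?u = "a *v w"
  have sub: "subspace (?W v)" for v by (rule linear_subspace_image[OF linear_matrix_apply N(1)])
  have "?W ?u \<subseteq> ?W w" using N(2) a(1) by (auto simp: matrix_vector_mul_assoc)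
  then have "?W ?u = ?W w" using sub w(2)[OF a(2)] by (intro subspace_dim_equal) auto
  moreover have "?u \<in> ?W w" using a(1) by blast
  ultimately have "?u \<in> ?W ?u" by simp
  then obtain b where b: "b \<in> N" "b *v ?u = ?u" by auto
  have "?u = 0" by (rule no_fixed_vector[OF N b])
  then show False using a(2) by (simp add: K_def)
qed

section \<open>Additive coordinates on unipotent groups\<close>

text \<open>
  Coordinate functionals of the rational vector space of complex numbers reduce statements about
  complex coefficients to rational ones.
\<close>

lemma rational_linear_functional:
  fixes z :: complex
  assumes "z \<noteq> 0"
  obtains \<psi> :: "complex \<Rightarrow> rat" where "\<And>x y. \<psi> (x + y) = \<psi> x + \<psi> y" "\<And>q x. \<psi> (of_rat q * x) = q * \<psi> x" "\<psi> z = 1"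
proof -
  interpret Q: vector_space_pair "\<lambda>q (x :: complex). of_rat q * x" "\<lambda>(q :: rat) (x :: rat). q * x"
    by unfold_locales (auto simp: algebra_simps of_rat_add of_rat_mult)
  have "Q.vs1.independent {z}" using assms by simp
  then obtain \<psi> where \<psi>: "Vector_Spaces.linear (\<lambda>q (x :: complex). of_rat q * x) (\<lambda>(q :: rat) (x :: rat). q * x) \<psi>"
    "\<psi> z = 1"
    using Q.linear_independent_extend[of "{z}" "\<lambda>_. 1"] by auto
  show thesis
    by (rule that[of \<psi>]) (use \<psi> Q.linear_add Q.linear_scale in auto)
qed

lemma additive_sum:
  fixes \<psi> :: "'a::ab_group_add \<Rightarrow> 'b::ab_group_add"
  assumes "\<And>x y. \<psi> (x + y) = \<psi> x + \<psi> y"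
  shows "\<psi> (\<Sum>i\<in>I. f i) = (\<Sum>i\<in>I. \<psi> (f i))"
proof -
  have "\<psi> 0 = 0" using assms[of 0 0] by simp
  then show ?thesis by (induction I rule: infinite_finite_induct) (simp_all add: assms)
qed

lemma of_real_of_rat: "complex_of_real (of_rat q) = of_rat q"
  by (cases q) (simp add: of_rat_rat)

lemma GL_simps [simp]:
  "x \<otimes>\<^bsub>GL\<^esub> y = x ** y" "\<one>\<^bsub>GL\<^esub> = mat 1" "carrier GL = {A. invertible A}"
  by (simp_all add: GL_def)

locale unipotent_matrix_group =
  fixes \<Gamma> :: "(complex^'n^'n) set"
  assumes sub: "subgroup \<Gamma> GL"
    and rat: "A \<in> \<Gamma> \<Longrightarrow> A $ i $ j \<in> \<rat>"
    and uni: "A \<in> \<Gamma> \<Longrightarrow> unipotent A"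
begin

lemma one_closed: "mat 1 \<in> \<Gamma>"
  using subgroup.one_closed[OF sub] by simp

lemma mult_closed: "A \<in> \<Gamma> \<Longrightarrow> B \<in> \<Gamma> \<Longrightarrow> A ** B \<in> \<Gamma>"
  using subgroup.m_closed[OF sub, of A B] by simp

lemma invertible: "A \<in> \<Gamma> \<Longrightarrow> invertible A"
  using subgroup.mem_carrier[OF sub, of A] by simp

end

definition linear_coord :: "('n \<Rightarrow> 'n \<Rightarrow> rat) \<Rightarrow> complex^'n^'n \<Rightarrow> complex"
  where "linear_coord w X = (\<Sum>i\<in>UNIV. \<Sum>j\<in>UNIV. of_rat (w i j) * X $ i $ j)"

lemma linear_coord_0 [simp]: "linear_coord w 0 = 0"
  by (simp add: linear_coord_def)

lemma linear_coord_add: "linear_coord w (X + Y) = linear_coord w X + linear_coord w Y"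
  by (simp add: linear_coord_def sum.distrib distrib_left)

lemma linear_coord_scaleR: "linear_coord w (c *\<^sub>R X) = c *\<^sub>R linear_coord w X"
  by (simp add: linear_coord_def scaleR_sum_right)

text \<open>
  A linear form \<open>L\<close> with \<open>L((g - 1)(h - 1)) = 0\<close> for all \<open>g\<close> and \<open>h\<close> is additive in the sense that
  \<open>L(g h - 1) = L(g - 1) + L(h - 1)\<close>. Such a form, non-zero on the span \<open>N\<close> of the \<open>g - 1\<close>, exists
  since \<open>N\<close> is an algebra of trace zero and therefore not equal to its square. A real form is obtained
  by orthogonal projection and made rational by a functional that is linear over the rationals.
\<close>

lemma (in unipotent_matrix_group) additive_coordinate:
  assumes "\<Gamma> \<noteq> {mat 1}"
  shows "\<exists>w. (\<forall>g\<in>\<Gamma>. \<forall>h\<in>\<Gamma>. linear_coord w (g ** h - mat 1) = linear_coord w (g - mat 1) + linear_coord w (h - mat 1)) \<and>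
    (\<exists>\<gamma>\<in>\<Gamma>. linear_coord w (\<gamma> - mat 1) = 1)"
proof -
  define S where "S = (\<lambda>g. g - mat 1) ` \<Gamma>"
  define N where "N = span S"
  have N: "subspace N" by (simp add: N_def)
  have SN: "x \<in> N" if "x \<in> S" for x using that by (simp add: N_def span_base)
  have SS: "x ** y \<in> N" if xy: "x \<in> S" "y \<in> S" for x y
  proof -
    obtain g h where gh: "g \<in> \<Gamma>" "h \<in> \<Gamma>" "x = g - mat 1" "y = h - mat 1" using xy by (auto simp: S_def)
    have "x ** y = (g ** h - mat 1) - x - y"
      by (simp add: gh matrix_mult_diff_ldistrib matrix_mult_diff_rdistrib)
    moreover have "g ** h - mat 1 \<in> S" using gh mult_closed by (auto simp: S_def)
    ultimately show ?thesis using xy SN N by (simp add: subspace_diff)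
  qed
  have SNN: "x ** y \<in> N" if "x \<in> S" "y \<in> N" for x y
    using that(2) unfolding N_def
  proof (induction rule: span_induct_alt)
    case (step c a b)
    have "x ** (c *\<^sub>R a + b) = c *\<^sub>R (x ** a) + x ** b"
      using linear_add[OF linear_matrix_left] linear_scale[OF linear_matrix_left] by metis
    then show ?case
      using step SS[OF that(1) step(1)] N unfolding N_def[symmetric] by (simp add: subspace_add subspace_scale)
  qed (simp add: matrix_matrix_mult_def vec_eq_iff[of 0] zero_vec_def[symmetric] span_zero flip: zero_vec_def)
  have NN: "x ** y \<in> N" if "x \<in> N" "y \<in> N" for x y
    using that(1) unfolding N_def
  proof (induction rule: span_induct_alt)
    case base
    have "0 ** y = 0" by (simp add: vec_eq_iff matrix_matrix_mult_def)
    then show ?case by (simp add: span_zero)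
  next
    case (step c a b)
    have "(c *\<^sub>R a + b) ** y = c *\<^sub>R (a ** y) + b ** y"
      using linear_add[OF linear_matrix_right] linear_scale[OF linear_matrix_right] by metis
    then show ?case
      using step SNN[OF step(1) that(2)] N unfolding N_def[symmetric] by (simp add: subspace_add subspace_scale)
  qed
  have tr: "trace x = 0" if "x \<in> N" for x
    using that unfolding N_def
  proof (induction rule: span_induct_alt)
    case (step c a b)
    then have "trace a = 0" using unipotent_det_trace(2)[OF uni] by (auto simp: S_def)
    then show ?case using step by (simp add: trace_add) (simp add: trace_def flip: scaleR_sum_right)
  qed (simp add: trace_def)
  obtain g0 where g0: "g0 \<in> \<Gamma>" "g0 \<noteq> mat 1" using assms one_closed by blast
  define N2 where "N2 = span {x ** y | x y. x \<in> N \<and> y \<in> N}"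
  have "N2 \<noteq> N"
    unfolding N2_def
    by (rule nil_algebra_square[OF N NN tr, of "g0 - mat 1"]) (use g0 SN in \<open>auto simp: S_def\<close>)
  moreover have "N2 \<subseteq> N" unfolding N2_def using N NN by (intro span_minimal) auto
  ultimately obtain x where x: "x \<in> N" "x \<notin> N2" by blast
  obtain y z where yz: "y \<in> span {x ** y | x y. x \<in> N \<and> y \<in> N}"
    "\<And>w. w \<in> span {x ** y | x y. x \<in> N \<and> y \<in> N} \<Longrightarrow> orthogonal z w" "x = y + z"
    using orthogonal_subspace_decomp_exists[of "{x ** y | x y. x \<in> N \<and> y \<in> N}" x] by blast
  have z2: "z \<bullet> (a ** b) = 0" if "a \<in> N" "b \<in> N" for a b
    using yz(2)[of "a ** b"] that by (auto simp: orthogonal_def intro: span_base)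
  have "z \<noteq> 0" using yz(1,3) x(2) by (auto simp: N2_def)
  moreover have "z \<bullet> x = z \<bullet> z" using yz(2)[OF yz(1)] by (simp add: yz(3) inner_add_right orthogonal_def)
  ultimately have zx: "z \<bullet> x \<noteq> 0" by simp
  have "\<exists>\<gamma>\<in>\<Gamma>. z \<bullet> (\<gamma> - mat 1) \<noteq> 0"
  proof (rule ccontr)
    assume *: "\<not> (\<exists>\<gamma>\<in>\<Gamma>. z \<bullet> (\<gamma> - mat 1) \<noteq> 0)"
    have "z \<bullet> a = 0" if "a \<in> span S" for a
      using that by (induction rule: span_induct_alt) (use * in \<open>auto simp: S_def inner_add_right\<close>)
    then show False using x(1) zx by (simp add: N_def)
  qed
  then obtain \<gamma> where \<gamma>: "\<gamma> \<in> \<Gamma>" "z \<bullet> (\<gamma> - mat 1) \<noteq> 0" by blast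
  have "complex_of_real (z \<bullet> (\<gamma> - mat 1)) \<noteq> 0" using \<gamma>(2) by simp
  then obtain \<psi> :: "complex \<Rightarrow> rat" where \<psi>: "\<And>x y. \<psi> (x + y) = \<psi> x + \<psi> y" "\<And>q x. \<psi> (of_rat q * x) = q * \<psi> x"
    "\<psi> (of_real (z \<bullet> (\<gamma> - mat 1))) = 1"
    by (rule rational_linear_functional) (rule that)
  define w where "w i j = \<psi> (of_real (Re (z $ i $ j)))" for i j
  have coord: "linear_coord w X = of_rat (\<psi> (of_real (z \<bullet> X)))" if X: "\<And>i j. X $ i $ j \<in> \<rat>" for X
  proof -
    define q where "q i j = to_rat (X $ i $ j)" for i j
    have q: "X $ i $ j = of_rat (q i j)" for i j using of_rat_to_rat[OF X] by (simp add: q_def)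
    have "z $ i $ j \<bullet> X $ i $ j = Re (z $ i $ j) * of_rat (q i j)" for i j
    proof -
      have "X $ i $ j = of_real (of_rat (q i j))" by (simp add: q of_real_of_rat)
      then show ?thesis by (simp add: inner_complex_def)
    qed
    then have "z \<bullet> X = (\<Sum>i\<in>UNIV. \<Sum>j\<in>UNIV. Re (z $ i $ j) * of_rat (q i j))"
      by (simp add: inner_vec_def)
    then have "complex_of_real (z \<bullet> X) = (\<Sum>i\<in>UNIV. \<Sum>j\<in>UNIV. of_rat (q i j) * of_real (Re (z $ i $ j)))"
      by (simp add: mult.commute of_real_of_rat)
    then have "\<psi> (of_real (z \<bullet> X)) = (\<Sum>i\<in>UNIV. \<Sum>j\<in>UNIV. q i j * w i j)"
      by (simp add: additive_sum[of \<psi>, OF \<psi>(1)] \<psi>(2) w_def)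
    then show ?thesis by (simp add: linear_coord_def q of_rat_sum of_rat_mult mult.commute)
  qed
  have ratd: "(g - mat 1) $ i $ j \<in> \<rat>" if "g \<in> \<Gamma>" for g i j
    using rat[OF that] by (simp add: mat_def)
  have hom: "linear_coord w (g ** h - mat 1) = linear_coord w (g - mat 1) + linear_coord w (h - mat 1)"
    if gh: "g \<in> \<Gamma>" "h \<in> \<Gamma>" for g h
  proof -
    have "g - mat 1 \<in> N" "h - mat 1 \<in> N" using gh SN by (auto simp: S_def)
    then have "z \<bullet> ((g - mat 1) ** (h - mat 1)) = 0" by (rule z2)
    moreover have eq: "g ** h - mat 1 = (g - mat 1) ** (h - mat 1) + (g - mat 1) + (h - mat 1)"
      by (simp add: matrix_mult_diff_ldistrib matrix_mult_diff_rdistrib)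
    ultimately have "z \<bullet> (g ** h - mat 1) = z \<bullet> (g - mat 1) + z \<bullet> (h - mat 1)"
      by (simp only: eq inner_add_right add_0)
    then show ?thesis
      unfolding coord[OF ratd[OF gh(1)]] coord[OF ratd[OF gh(2)]] coord[OF ratd[OF mult_closed[OF gh]]]
      by (simp add: \<psi>(1) of_rat_add)
  qed
  have "linear_coord w (\<gamma> - mat 1) = 1" using coord[OF ratd[OF \<gamma>(1)]] \<psi>(3) by simp
  then show ?thesis using hom \<gamma>(1) by blast
qed

section \<open>Integer powers and regular functions\<close>

definition gbinomial_poly :: "nat \<Rightarrow> rat poly"
  where "gbinomial_poly j = smult (1 / fact j) (\<Prod>i=0..<j. [:- of_nat i, 1:])"

lemma poly_gbinomial_poly: "poly (gbinomial_poly j) x = x gchoose j"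
  by (simp add: gbinomial_poly_def gbinomial_prod_rev poly_prod)

lemma matrix_cscale_right: "X ** (c *k Y) = c *k (X ** Y)"
  for X Y :: "complex^'n^'n"
  by (simp add: vec_eq_iff matrix_matrix_mult_def cscale_def sum_distrib_left algebra_simps)

lemma cscale_add: "(a + b) *k X = a *k X + b *k X"
  by (simp add: vec_eq_iff cscale_def algebra_simps)

text \<open>
  \<open>A ^ t\<close> is the binomial series in \<open>A - 1\<close>, which is finite. Pascal's rule shows that multiplication by
  \<open>A\<close> raises the exponent by one, for negative exponents as well.
\<close>

lemma unipotent_int_power_poly:
  fixes A :: "complex^'n^'n"
  assumes "invertible A" "unipotent A" "\<And>i j. A $ i $ j \<in> \<rat>"
  shows "\<exists>q. \<forall>t::int. \<forall>i j. (A [^]\<^bsub>GL\<^esub> t) $ i $ j = of_rat (poly (q i j) (of_int t))"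
proof -
  interpret G: group GL by (rule group_GL)
  define X where "X = A - mat 1"
  define P where "P j = ((**) X ^^ j) (mat 1)" for j
  obtain k where k: "P k = 0" using assms(2) by (auto simp: unipotent_def X_def P_def)
  have P0: "P 0 = mat 1" and PSuc: "P (Suc j) = X ** P j" for j by (simp_all add: P_def)
  have Pk: "P (Suc k) = 0" by (simp add: PSuc k vec_eq_iff matrix_matrix_mult_def)
  have PR: "P j $ a $ b \<in> \<rat>" for j a b
  proof (induction j arbitrary: a b)
    case (Suc j)
    then show ?case
      using assms(3) by (auto simp: PSuc matrix_matrix_mult_def X_def mat_def intro!: Rats_sum Rats_mult)
  qed (simp add: P0 mat_def)
  define e where "e j a b = to_rat (P j $ a $ b)" for j a b
  have e: "P j $ a $ b = of_rat (e j a b)" for j a b using of_rat_to_rat[OF PR] by (simp add: e_def)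
  define c where "c t j = (of_rat (of_int t gchoose j) :: complex)" for t :: int and j
  define Q where "Q t = (\<Sum>j<Suc k. c t j *k P j)" for t
  have c: "c (t + 1) 0 = c t 0" "c (t + 1) (Suc j) = c t j + c t (Suc j)" for t j
    using gbinomial_Suc_Suc[of "of_int t :: rat" j] by (simp_all add: c_def of_rat_add)
  have step: "A ** Q t = Q (t + 1)" for t
  proof -
    have "X ** Q t = (\<Sum>j<Suc k. c t j *k P (Suc j))"
      unfolding Q_def by (subst linear_sum[OF linear_matrix_left]) (simp only: matrix_cscale_right PSuc)
    also have "\<dots> = (\<Sum>j<k. c t j *k P (Suc j))"
      by (simp add: Pk vec_eq_iff cscale_def)
    finally have XQ: "X ** Q t = (\<Sum>j<k. c t j *k P (Suc j))" .
    have "A ** Q t = Q t + X ** Q t"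
      using matrix_mult_diff_rdistrib[of A "mat 1" "Q t"] by (simp add: X_def)
    also have "\<dots> = c t 0 *k P 0 + (\<Sum>j<k. c t j *k P (Suc j) + c t (Suc j) *k P (Suc j))"
      unfolding XQ unfolding Q_def sum.lessThan_Suc_shift by (simp add: sum.distrib)
    also have "\<dots> = Q (t + 1)"
      unfolding Q_def sum.lessThan_Suc_shift c cscale_add ..
    finally show ?thesis .
  qed
  have A: "A \<in> carrier GL" using assms(1) by simp
  have "A [^]\<^bsub>GL\<^esub> t = Q t" for t :: int
  proof (induction t rule: int_induct[where k = 0])
    case base
    have "c 0 0 = 1" "c 0 (Suc j) = 0" for j by (simp_all add: c_def)
    then have "Q 0 = 1 *k P 0" unfolding Q_def sum.lessThan_Suc_shift
      by (simp add: cscale_def vec_eq_iff)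
    then show ?case by (simp add: P0 cscale_def vec_eq_iff)
  next
    case (step1 i)
    have "A [^]\<^bsub>GL\<^esub> (i + 1) = A ** (A [^]\<^bsub>GL\<^esub> i)"
      using G.int_pow_mult[OF A, of 1 i] A by (simp add: add.commute)
    then show ?case using step1 step by simp
  next
    case (step2 i)
    have "A [^]\<^bsub>GL\<^esub> i = A ** (A [^]\<^bsub>GL\<^esub> (i - 1))"
      using G.int_pow_mult[OF A, of 1 "i - 1"] A by simp
    then have "A ** (A [^]\<^bsub>GL\<^esub> (i - 1)) = A ** Q (i - 1)" using step2 step[of "i - 1"] by simp
    moreover obtain C where "C ** A = mat 1" using assms(1) by (auto simp: invertible_def)
    ultimately show ?case by (metis matrix_mul_assoc matrix_mul_lid)
  qed
  moreover have "Q t $ a $ b = of_rat (poly (\<Sum>j<Suc k. smult (e j a b) (gbinomial_poly j)) (of_int t))" for t a b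
    by (simp add: Q_def c_def cscale_def e poly_sum poly_gbinomial_poly of_rat_sum of_rat_mult of_rat_add mult.commute)
  ultimately show ?thesis
    by (intro exI[of _ "\<lambda>a b. \<Sum>j<Suc k. smult (e j a b) (gbinomial_poly j)"]) simp
qed

text \<open>
  Pulling back along \<open>B\<close> maps regular functions into any algebra \<open>R\<close> of functions that contains the
  entries of \<open>B\<close>. The inverse determinant causes no trouble as \<open>B\<close> takes values of determinant one.
\<close>

lemma GL_regular_pullback:
  assumes "f \<in> GL_regular K"
    and const: "\<And>c. c \<in> K \<Longrightarrow> (\<lambda>_. c) \<in> R" "1 \<in> K"
    and add: "\<And>u v. u \<in> R \<Longrightarrow> v \<in> R \<Longrightarrow> (\<lambda>x. u x + v x) \<in> R"
    and mult: "\<And>u v. u \<in> R \<Longrightarrow> v \<in> R \<Longrightarrow> (\<lambda>x. u x * v x) \<in> R"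
    and entry: "\<And>i j. (\<lambda>x. B x $ i $ j) \<in> R" and det: "\<And>x. det (B x) = 1"
  shows "(\<lambda>x. f (B x)) \<in> R"
  using assms(1) by induction (use assms(2-) in auto)

lemma GL_regular_left_translate:
  assumes "f \<in> GL_regular UNIV"
  shows "(\<lambda>X. f (C ** X)) \<in> GL_regular UNIV"
  using assms
proof induction
  case (entry i j)
  have "(\<lambda>X. \<Sum>k\<in>I. C $ i $ k * X $ k $ j) \<in> GL_regular UNIV" for I :: "'a set"
  proof (induction I rule: infinite_finite_induct)
    case (insert k I)
    then show ?case
      using GL_regular.add[OF GL_regular.mult[OF GL_regular.const[of "C $ i $ k"] GL_regular.entry[of k j]]] by simp
  qed (auto intro: GL_regular.const)
  then show ?case by (simp add: matrix_matrix_mult_def)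
next
  case inv_det
  show ?case
    using GL_regular.mult[OF GL_regular.const[of "inverse (det C)" UNIV] GL_regular.inv_det] by (simp add: det_mul)
qed (auto intro: GL_regular.intros)

lemma GL_regular_sum:
  assumes "0 \<in> K" "\<And>i. i \<in> I \<Longrightarrow> f i \<in> GL_regular K"
  shows "(\<lambda>X. \<Sum>i\<in>I. f i X) \<in> GL_regular K"
  using assms(2)
  by (induction I rule: infinite_finite_induct) (auto intro: GL_regular.intros assms(1))

lemma linear_coord_regular:
  fixes w :: "'n::finite \<Rightarrow> 'n \<Rightarrow> rat"
  shows "(\<lambda>A. linear_coord w (A - mat 1)) \<in> GL_regular \<rat>"
proof -
  have "(\<lambda>A. of_rat (w i j) * (A $ i $ j + - mat 1 $ i $ j)) \<in> GL_regular \<rat>" for i j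
    by (intro GL_regular.mult GL_regular.add GL_regular.const GL_regular.entry) (auto simp: mat_def)
  then have "(\<lambda>A. \<Sum>i\<in>UNIV. \<Sum>j\<in>UNIV. of_rat (w i j) * (A $ i $ j + - mat 1 $ i $ j)) \<in> GL_regular \<rat>"
    by (intro GL_regular_sum) auto
  then show ?thesis by (simp add: linear_coord_def)
qed

section \<open>Polynomial parametrization of the group\<close>

definition rational_polyfuns :: "nat \<Rightarrow> ((nat \<Rightarrow> int) \<Rightarrow> complex) set"
  where "rational_polyfuns d = {u. \<exists>p\<in>polys d. \<forall>x. u x = of_rat (eval p x)}"

lemma rational_polyfuns_closed:
  "c \<in> \<rat> \<Longrightarrow> (\<lambda>_. c) \<in> rational_polyfuns d"
  "u \<in> rational_polyfuns d \<Longrightarrow> v \<in> rational_polyfuns d \<Longrightarrow> (\<lambda>x. u x + v x) \<in> rational_polyfuns d"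
  "u \<in> rational_polyfuns d \<Longrightarrow> v \<in> rational_polyfuns d \<Longrightarrow> (\<lambda>x. u x * v x) \<in> rational_polyfuns d"
proof -
  note S = subring_ofD[OF subring_of_polys[of d]]
  show "(\<lambda>_. c) \<in> rational_polyfuns d" if "c \<in> \<rat>"
  proof -
    show ?thesis
      unfolding rational_polyfuns_def using of_rat_to_rat[OF that]
      by (intro CollectI bexI[of _ "Const (to_rat c)"]) simp_all
  qed
  show "(\<lambda>x. u x + v x) \<in> rational_polyfuns d" "(\<lambda>x. u x * v x) \<in> rational_polyfuns d"
    if "u \<in> rational_polyfuns d" "v \<in> rational_polyfuns d"
  proof -
    obtain p q where pq: "p \<in> polys d" "q \<in> polys d" "\<And>x. u x = of_rat (eval p x)" "\<And>x. v x = of_rat (eval q x)"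
      using \<open>u \<in> rational_polyfuns d\<close> \<open>v \<in> rational_polyfuns d\<close> by (auto simp: rational_polyfuns_def)
    have "p + q \<in> polys d" "p * q \<in> polys d" using pq S by auto
    moreover have "\<forall>x. u x + v x = of_rat (eval (p + q) x)" "\<forall>x. u x * v x = of_rat (eval (p * q) x)"
      using pq(3,4) by (simp_all add: of_rat_add of_rat_mult)
    ultimately show "(\<lambda>x. u x + v x) \<in> rational_polyfuns d" "(\<lambda>x. u x * v x) \<in> rational_polyfuns d"
      unfolding rational_polyfuns_def by blast+
  qed
qed

lemma rational_polyfuns_mono: "u \<in> rational_polyfuns d \<Longrightarrow> u \<in> rational_polyfuns (Suc d)"
  by (auto simp: rational_polyfuns_def intro: polys_Suc_mono)

lemma poly_Var_rational_polyfun: "(\<lambda>x. of_rat (poly q (of_int (x d)))) \<in> rational_polyfuns (Suc d)"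
proof (induction q)
  case (pCons c q)
  have "(\<lambda>x. of_int (x d)) \<in> rational_polyfuns (Suc d)"
    unfolding rational_polyfuns_def by (auto intro!: bexI[of _ "Var d"] Var_in_polys)
  then have "(\<lambda>x. of_rat c + of_int (x d) * of_rat (poly q (of_int (x d)))) \<in> rational_polyfuns (Suc d)"
    using pCons by (intro rational_polyfuns_closed) auto
  then show ?case by (simp add: of_rat_add of_rat_mult)
qed (auto intro: rational_polyfuns_closed)

text \<open>
  The last two conditions say that the \<open>d\<close> exponents are regular functions of the matrix and that the
  values of \<open>\<phi>\<close> are Zariski dense in \<open>\<Gamma>\<close>.
\<close>

definition parametrizes :: "nat \<Rightarrow> ((nat \<Rightarrow> int) \<Rightarrow> complex^'n^'n) \<Rightarrow> (complex^'n^'n) set \<Rightarrow> bool"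
  where "parametrizes d \<phi> \<Gamma> \<longleftrightarrow> (\<forall>x. \<phi> x \<in> \<Gamma>) \<and>
    (\<forall>i j. (\<lambda>x. \<phi> x $ i $ j) \<in> rational_polyfuns d) \<and>
    (\<forall>k<d. \<exists>f\<in>GL_regular \<rat>. \<forall>x. f (\<phi> x) = of_int (x k)) \<and>
    (\<forall>f\<in>GL_regular UNIV. (\<forall>x. f (\<phi> x) = 0) \<longrightarrow> (\<forall>A\<in>\<Gamma>. f A = 0))"

lemma regular_on_powers:
  fixes A :: "complex^'n^'n"
  assumes "invertible A" "unipotent A" "\<And>i j. A $ i $ j \<in> \<rat>" "\<And>t::int. unipotent (A [^]\<^bsub>GL\<^esub> t)"
    and "f \<in> GL_regular UNIV"
  shows "\<exists>P. \<forall>t::int. f (A [^]\<^bsub>GL\<^esub> t) = poly P (of_int t)"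
proof -
  obtain q where q: "\<And>t::int. \<And>i j. (A [^]\<^bsub>GL\<^esub> t) $ i $ j = of_rat (poly (q i j) (of_int t))"
    using unipotent_int_power_poly[OF assms(1-3)] by blast
  let ?R = "{u. \<exists>P. \<forall>t::int. u t = poly P (of_int t :: complex)}"
  have rat: "of_rat (poly p (of_int t)) = poly (map_poly of_rat p) (of_int t :: complex)" for p t
    by (induction p) (simp_all add: map_poly_pCons of_rat_add of_rat_mult)
  have "(\<lambda>t. f (A [^]\<^bsub>GL\<^esub> t)) \<in> ?R"
  proof (rule GL_regular_pullback[OF assms(5)])
    show "(\<lambda>_. c) \<in> ?R" for c by (intro CollectI exI[of _ "[:c:]"]) simp
    fix u v assume "u \<in> ?R" "v \<in> ?R"
    then obtain P Q where "\<forall>t. u t = poly P (of_int t)" "\<forall>t. v t = poly Q (of_int t)" by blast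
    then show "(\<lambda>t. u t + v t) \<in> ?R" "(\<lambda>t. u t * v t) \<in> ?R"
      by (intro CollectI exI[of _ "P + Q"] allI, simp, intro CollectI exI[of _ "P * Q"] allI, simp)
  next
    show "(\<lambda>t. (A [^]\<^bsub>GL\<^esub> t) $ i $ j) \<in> ?R" for i j
      unfolding q rat by blast
    show "det (A [^]\<^bsub>GL\<^esub> t) = 1" for t :: int using unipotent_det_trace(1)[OF assms(4)] .
  qed simp
  then show ?thesis by blast
qed

context unipotent_matrix_group
begin

lemma int_pow_closed: "A \<in> \<Gamma> \<Longrightarrow> A [^]\<^bsub>GL\<^esub> (t::int) \<in> \<Gamma>"
  using group.subgroup_int_pow_closed[OF group_GL sub] .

lemma int_pow_add: "A \<in> \<Gamma> \<Longrightarrow> A [^]\<^bsub>GL\<^esub> (s + t :: int) = A [^]\<^bsub>GL\<^esub> s ** A [^]\<^bsub>GL\<^esub> t"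
  using group.int_pow_mult[OF group_GL, of A s t] subgroup.mem_carrier[OF sub] by simp

lemma int_pow_cancel: "A \<in> \<Gamma> \<Longrightarrow> A [^]\<^bsub>GL\<^esub> (s :: int) ** (A [^]\<^bsub>GL\<^esub> (- s) ** B) = B"
  "A \<in> \<Gamma> \<Longrightarrow> A [^]\<^bsub>GL\<^esub> (- s :: int) ** (A [^]\<^bsub>GL\<^esub> s ** B) = B"
proof -
  assume A: "A \<in> \<Gamma>"
  interpret G: group GL by (rule group_GL)
  show "A [^]\<^bsub>GL\<^esub> (s :: int) ** (A [^]\<^bsub>GL\<^esub> (- s) ** B) = B" "A [^]\<^bsub>GL\<^esub> (- s :: int) ** (A [^]\<^bsub>GL\<^esub> s ** B) = B"
    using int_pow_add[OF A, of s "- s", symmetric] int_pow_add[OF A, of "- s" s, symmetric]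
    by (simp_all add: matrix_mul_assoc)
qed

lemma regular_poly_on_powers:
  assumes "A \<in> \<Gamma>" "f \<in> GL_regular UNIV"
  shows "\<exists>P. \<forall>t::int. f (A [^]\<^bsub>GL\<^esub> t) = poly P (of_int t)"
  by (rule regular_on_powers) (use assms invertible uni rat int_pow_closed in auto)

end

lemma rational_polyfuns_local:
  assumes "u \<in> rational_polyfuns d" "\<And>i. i < d \<Longrightarrow> x i = y i"
  shows "u x = u y"
proof -
  obtain p where p: "eval p \<in> polyfuns d" "\<And>x. u x = of_rat (eval p x)"
    using assms(1) by (auto simp: rational_polyfuns_def polys_def)
  then show ?thesis using polyfuns_local[OF p(1), of x y] assms(2) by simp
qed

lemma rational_polyfuns_sum:
  assumes "\<And>i. i \<in> I \<Longrightarrow> u i \<in> rational_polyfuns d"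
  shows "(\<lambda>x. \<Sum>i\<in>I. u i x) \<in> rational_polyfuns d"
  using assms by (induction I rule: infinite_finite_induct) (auto intro: rational_polyfuns_closed)

lemma GL_regular_mono: "f \<in> GL_regular K \<Longrightarrow> K \<subseteq> L \<Longrightarrow> f \<in> GL_regular L"
  by (induction rule: GL_regular.induct) (auto intro: GL_regular.intros)

lemma matrix_mult_entry: "(A ** B) $ i $ j = (\<Sum>k\<in>UNIV. A $ i $ k * B $ k $ j)"
  by (simp add: matrix_matrix_mult_def)

text \<open>
  The additive coordinate \<open>\<kappa>\<close> recovers the exponent of \<open>\<gamma>\<close>, and after division by that power the
  regular functions for \<open>\<Gamma>'\<close> recover the others.

  For density let \<open>A \<in> \<Gamma>\<close> and \<open>\<kappa>(A) = a / M\<close>. The powers \<open>A ^ (M \<tau>)\<close> lie in \<open>\<gamma> ^ (a \<tau>) \<Gamma>'\<close>, so a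
  regular function that vanishes on the values of the parametrization vanishes at all of them. Its value at
  \<open>A ^ t\<close> is a polynomial in \<open>t\<close>, hence vanishes at \<open>t = 1\<close> as well.
\<close>

lemma parametrizes_extend:
  fixes \<Gamma> \<Gamma>' :: "(complex^'n^'n) set"
  assumes "unipotent_matrix_group \<Gamma>"
    and hom: "\<And>g h. g \<in> \<Gamma> \<Longrightarrow> h \<in> \<Gamma> \<Longrightarrow>
      linear_coord w (g ** h - mat 1) = linear_coord w (g - mat 1) + linear_coord w (h - mat 1)"
    and \<gamma>: "\<gamma> \<in> \<Gamma>" "linear_coord w (\<gamma> - mat 1) = 1"
    and \<Gamma>': "\<Gamma>' = {g \<in> \<Gamma>. linear_coord w (g - mat 1) = 0}"
    and \<phi>': "parametrizes d \<phi>' \<Gamma>'"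
  shows "parametrizes (Suc d) (\<lambda>x. \<gamma> [^]\<^bsub>GL\<^esub> (x d) ** \<phi>' x) \<Gamma>"
proof -
  interpret unipotent_matrix_group \<Gamma> by fact
  interpret G: group GL by (rule group_GL)
  let ?\<kappa> = "\<lambda>A. linear_coord w (A - mat 1)"
  let ?\<phi> = "\<lambda>x. \<gamma> [^]\<^bsub>GL\<^esub> (x d) ** \<phi>' x"
  have \<kappa>1: "?\<kappa> (mat 1) = 0" by simp
  have \<kappa>pow: "?\<kappa> (A [^]\<^bsub>GL\<^esub> t) = of_int t * ?\<kappa> A" if A: "A \<in> \<Gamma>" for A and t :: int
  proof (induction t rule: int_induct[where k = 0])
    case base
    then show ?case by (simp add: \<kappa>1)
  next
    case (step1 i)
    have "?\<kappa> (A [^]\<^bsub>GL\<^esub> (i + 1)) = ?\<kappa> (A [^]\<^bsub>GL\<^esub> i) + ?\<kappa> (A [^]\<^bsub>GL\<^esub> (1::int))"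
      unfolding int_pow_add[OF A] using A by (intro hom int_pow_closed)
    then show ?case using step1 A invertible by (simp add: algebra_simps)
  next
    case (step2 i)
    have "?\<kappa> (A [^]\<^bsub>GL\<^esub> (i - 1 + 1)) = ?\<kappa> (A [^]\<^bsub>GL\<^esub> (i - 1)) + ?\<kappa> (A [^]\<^bsub>GL\<^esub> (1::int))"
      unfolding int_pow_add[OF A, of "i - 1" 1] using A by (intro hom int_pow_closed)
    then show ?case using step2 A invertible by (simp add: algebra_simps)
  qed
  have \<phi>'1: "\<phi>' x \<in> \<Gamma>" "?\<kappa> (\<phi>' x) = 0" for x using \<phi>' \<Gamma>' by (auto simp: parametrizes_def)
  have 1: "?\<phi> x \<in> \<Gamma>" for x using mult_closed int_pow_closed \<gamma>(1) \<phi>'1 by blast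
  obtain q where q: "\<And>t::int. \<And>i j. (\<gamma> [^]\<^bsub>GL\<^esub> t) $ i $ j = of_rat (poly (q i j) (of_int t))"
    using unipotent_int_power_poly[of \<gamma>] invertible uni rat \<gamma>(1) by blast
  have 2: "(\<lambda>x. ?\<phi> x $ i $ j) \<in> rational_polyfuns (Suc d)" for i j
  proof -
    have "(\<lambda>x. \<Sum>k\<in>UNIV. of_rat (poly (q i k) (of_int (x d))) * \<phi>' x $ k $ j) \<in> rational_polyfuns (Suc d)"
      using \<phi>' by (intro rational_polyfuns_sum rational_polyfuns_closed(3) poly_Var_rational_polyfun rational_polyfuns_mono)
        (auto simp: parametrizes_def)
    then show ?thesis by (simp add: matrix_matrix_mult_def q)
  qed
  have \<kappa>\<phi>: "?\<kappa> (?\<phi> x) = of_int (x d)" for x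
    using hom[OF int_pow_closed[OF \<gamma>(1)] \<phi>'1(1)] \<kappa>pow[OF \<gamma>(1)] \<gamma>(2) \<phi>'1(2) by simp
  have 3: "\<exists>f\<in>GL_regular \<rat>. \<forall>x. f (?\<phi> x) = of_int (x k)" if k: "k < Suc d" for k
  proof (cases "k = d")
    case True
    then show ?thesis using linear_coord_regular[of w] \<kappa>\<phi> by (intro bexI[of _ ?\<kappa>]) auto
  next
    case False
    then obtain f where f: "f \<in> GL_regular \<rat>" "\<And>x. f (\<phi>' x) = of_int (x k)"
      using k \<phi>' unfolding parametrizes_def by (metis less_Suc_eq)
    let ?R = "{u. \<exists>g\<in>GL_regular \<rat>. \<forall>x. u x = g (?\<phi> x)}"
    have const: "(\<lambda>_. c) \<in> ?R" if "c \<in> \<rat>" for c using that by (auto intro!: bexI[OF _ GL_regular.const])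
    have add: "(\<lambda>x. u x + v x) \<in> ?R" "(\<lambda>x. u x * v x) \<in> ?R" if "u \<in> ?R" "v \<in> ?R" for u v
    proof -
      obtain g h where gh: "g \<in> GL_regular \<rat>" "h \<in> GL_regular \<rat>" "\<forall>x. u x = g (?\<phi> x)" "\<forall>x. v x = h (?\<phi> x)"
        using \<open>u \<in> ?R\<close> \<open>v \<in> ?R\<close> by blast
      show "(\<lambda>x. u x + v x) \<in> ?R" using gh by (intro CollectI bexI[OF _ GL_regular.add[OF gh(1,2)]]) simp
      show "(\<lambda>x. u x * v x) \<in> ?R" using gh by (intro CollectI bexI[OF _ GL_regular.mult[OF gh(1,2)]]) simp
    qed
    have coord: "(\<lambda>x. of_int (- x d)) \<in> ?R"
    proof -
      have "(\<lambda>x. of_int (x d)) \<in> ?R" using linear_coord_regular[of w] \<kappa>\<phi> by (intro CollectI bexI[of _ ?\<kappa>]) auto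
      then show ?thesis using add(2)[OF const[of "-1"]] by simp
    qed
    have poly: "(\<lambda>x. of_rat (poly p (of_int (- x d)))) \<in> ?R" for p
    proof (induction p)
      case 0
      have "(\<lambda>_. 0) \<in> ?R" by (rule const) simp
      then show ?case by (simp only: poly_0 of_rat_0)
    next
      case (pCons a p)
      have "(\<lambda>x. of_rat a + of_int (- x d) * of_rat (poly p (of_int (- x d)))) \<in> ?R"
        by (intro add const coord pCons) auto
      then show ?case by (simp add: of_rat_add of_rat_mult of_rat_minus of_rat_diff)
    qed
    have sum: "(\<lambda>x. \<Sum>i\<in>I. u i x) \<in> ?R" if "\<And>i. u i \<in> ?R" for u and I :: "'n set"
      by (induction I rule: infinite_finite_induct) (simp_all only: sum.infinite sum.empty sum.insert not_False_eq_True const Rats_0 add that)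
    have "(\<lambda>x. f (\<phi>' x)) \<in> ?R"
    proof (rule GL_regular_pullback[OF f(1)])
      show "(\<lambda>x. \<phi>' x $ i $ j) \<in> ?R" for i j
      proof -
        have "\<phi>' x $ i $ j = (\<gamma> [^]\<^bsub>GL\<^esub> (- x d) ** ?\<phi> x) $ i $ j" for x
          by (simp only: int_pow_cancel(2)[OF \<gamma>(1)])
        then have "\<phi>' x $ i $ j = (\<Sum>k\<in>UNIV. of_rat (poly (q i k) (of_int (- x d))) * ?\<phi> x $ k $ j)" for x
          by (simp only: matrix_mult_entry[of "\<gamma> [^]\<^bsub>GL\<^esub> (- x d)" for x] q)
        moreover have "(\<lambda>x. ?\<phi> x $ k $ j) \<in> ?R" for k
          by (intro CollectI bexI[OF _ GL_regular.entry[of k j]]) simp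
        then have "(\<lambda>x. \<Sum>k\<in>UNIV. of_rat (poly (q i k) (of_int (- x d))) * ?\<phi> x $ k $ j) \<in> ?R"
          by (intro sum add poly)
        ultimately show ?thesis by (simp only:)
      qed
      show "det (\<phi>' x) = 1" for x using unipotent_det_trace(1) uni \<phi>'1 by blast
    qed (use const add in auto)
    then show ?thesis using f(2) by auto
  qed
  have 4: "f A = 0" if f: "f \<in> GL_regular UNIV" "\<And>x. f (?\<phi> x) = 0" and A: "A \<in> \<Gamma>" for f A
  proof -
    \<comment> \<open>on each coset of \<open>\<Gamma>'\<close> the left translate of \<open>f\<close> is regular\<close>
    have \<Gamma>'0: "f (\<gamma> [^]\<^bsub>GL\<^esub> s ** B) = 0" if B: "B \<in> \<Gamma>'" for s :: int and B
    proof -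
      have zero: "f (\<gamma> [^]\<^bsub>GL\<^esub> s ** \<phi>' x) = 0" for x
      proof -
        have "\<phi>' (x(d := s)) $ i $ j = \<phi>' x $ i $ j" for i j
          using \<phi>' by (intro rational_polyfuns_local[of "\<lambda>x. \<phi>' x $ i $ j" d]) (auto simp: parametrizes_def)
        then have "\<phi>' (x(d := s)) = \<phi>' x" by (simp add: vec_eq_iff)
        then show ?thesis using f(2)[of "x(d := s)"] by simp
      qed
      have "g B = 0" if "g \<in> GL_regular UNIV" "\<And>x. g (\<phi>' x) = 0" for g
        using \<phi>' B that unfolding parametrizes_def by blast
      from this[OF GL_regular_left_translate[OF f(1)] zero] show ?thesis .
    qed
    have "?\<kappa> A \<in> \<rat>"
      unfolding linear_coord_def using rat[OF A] by (intro Rats_sum Rats_mult) (auto simp: mat_def)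
    then obtain r where r: "?\<kappa> A = of_rat r" using of_rat_to_rat by metis
    obtain a M where aM: "quotient_of r = (a, M)" by fastforce
    then have rM: "r = of_int a / of_int M" and M: "M > 0" by (auto dest: quotient_of_div quotient_of_denom_pos)
    have \<kappa>A: "of_int M * ?\<kappa> A = of_int a" using M by (simp add: r rM of_rat_divide)
    have zero: "f (A [^]\<^bsub>GL\<^esub> (M * \<tau>)) = 0" for \<tau>
    proof -
      define B where "B = \<gamma> [^]\<^bsub>GL\<^esub> (- (a * \<tau>)) ** A [^]\<^bsub>GL\<^esub> (M * \<tau>)"
      have "?\<kappa> B = of_int (- (a * \<tau>)) * ?\<kappa> \<gamma> + of_int (M * \<tau>) * ?\<kappa> A"
        unfolding B_def using hom[OF int_pow_closed[OF \<gamma>(1)] int_pow_closed[OF A]] \<kappa>pow \<gamma>(1) A by simp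
      also have "\<dots> = of_int \<tau> * (of_int M * ?\<kappa> A - of_int a)"
        by (simp add: \<gamma>(2) algebra_simps)
      finally have "B \<in> \<Gamma>'"
        using \<kappa>A mult_closed int_pow_closed \<gamma>(1) A by (simp add: \<Gamma>' B_def)
      then have "f (\<gamma> [^]\<^bsub>GL\<^esub> (a * \<tau>) ** B) = 0" by (rule \<Gamma>'0)
      then show ?thesis by (simp only: B_def int_pow_cancel(1)[OF \<gamma>(1)])
    qed
    obtain P where P: "\<And>t::int. f (A [^]\<^bsub>GL\<^esub> t) = poly P (of_int t)" using regular_poly_on_powers[OF A f(1)] by blast
    have "poly (pcompose P [:0, of_int M:]) (of_int \<tau>) = 0" for \<tau> :: int
      using zero[of \<tau>] P[of "M * \<tau>"] by (simp add: poly_pcompose mult.commute)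
    then have "pcompose P [:0, of_int M:] = 0" by (rule poly_zero_on_ints)
    then have "poly (pcompose P [:0, of_int M:]) (1 / of_int M) = 0" by simp
    then have "poly P 1 = 0" using M by (simp add: poly_pcompose)
    then show ?thesis using P[of 1] A invertible by simp
  qed
  show ?thesis unfolding parametrizes_def using 1 2 3 4 by blast
qed

text \<open>
  Each step passes to the kernel of an additive coordinate, on which the span of the \<open>g - 1\<close> has smaller
  dimension.
\<close>

theorem parametrization_exists:
  fixes \<Gamma> :: "(complex^'n^'n) set"
  assumes "unipotent_matrix_group \<Gamma>"
  shows "\<exists>d \<phi>. parametrizes d \<phi> \<Gamma>"
  using assms
proof (induction "dim ((\<lambda>g. g - mat 1) ` \<Gamma>)" arbitrary: \<Gamma> rule: less_induct)
  case less
  interpret unipotent_matrix_group \<Gamma> by (rule less.prems)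
  interpret G: group GL by (rule group_GL)
  show ?case
  proof (cases "\<Gamma> = {mat 1}")
    case True
    have "parametrizes 0 (\<lambda>_. mat 1) \<Gamma>"
      unfolding parametrizes_def True by (auto intro!: rational_polyfuns_closed simp: mat_def)
    then show ?thesis by blast
  next
    case False
    then obtain w \<gamma> where w: "\<And>g h. g \<in> \<Gamma> \<Longrightarrow> h \<in> \<Gamma> \<Longrightarrow>
        linear_coord w (g ** h - mat 1) = linear_coord w (g - mat 1) + linear_coord w (h - mat 1)"
      "\<gamma> \<in> \<Gamma>" "linear_coord w (\<gamma> - mat 1) = 1"
      using additive_coordinate by metis
    define \<Gamma>' where "\<Gamma>' = {g \<in> \<Gamma>. linear_coord w (g - mat 1) = 0}"
    have inv: "linear_coord w (inv\<^bsub>GL\<^esub> g - mat 1) = - linear_coord w (g - mat 1)" if g: "g \<in> \<Gamma>" for g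
    proof -
      have "inv\<^bsub>GL\<^esub> g \<in> \<Gamma>" using subgroup.m_inv_closed[OF sub g] .
      then have "linear_coord w (inv\<^bsub>GL\<^esub> g ** g - mat 1) = linear_coord w (inv\<^bsub>GL\<^esub> g - mat 1) + linear_coord w (g - mat 1)"
        using g by (intro w)
      moreover have "inv\<^bsub>GL\<^esub> g ** g = mat 1" using G.l_inv[of g] subgroup.mem_carrier[OF sub g] by simp
      ultimately show ?thesis by (simp add: linear_coord_def eq_neg_iff_add_eq_0)
    qed
    have "subgroup \<Gamma>' GL"
    proof (rule G.subgroupI)
      show "\<Gamma>' \<subseteq> carrier GL" using subgroup.subset[OF sub] by (auto simp: \<Gamma>'_def)
      show "\<Gamma>' \<noteq> {}" using one_closed by (auto simp: \<Gamma>'_def)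
      show "inv\<^bsub>GL\<^esub> g \<in> \<Gamma>'" if "g \<in> \<Gamma>'" for g
        using that inv subgroup.m_inv_closed[OF sub] by (auto simp: \<Gamma>'_def)
      show "g \<otimes>\<^bsub>GL\<^esub> h \<in> \<Gamma>'" if "g \<in> \<Gamma>'" "h \<in> \<Gamma>'" for g h
        using that w(1) mult_closed by (auto simp: \<Gamma>'_def)
    qed
    then have \<Gamma>': "unipotent_matrix_group \<Gamma>'"
      by (rule unipotent_matrix_group.intro) (simp_all add: \<Gamma>'_def rat uni)
    have zero: "linear_coord w x = 0" if "x \<in> span ((\<lambda>g. g - mat 1) ` \<Gamma>')" for x
      using that by (induction rule: span_induct_alt)
        (auto simp: \<Gamma>'_def linear_coord_add linear_coord_scaleR)
    have "\<gamma> - mat 1 \<in> span ((\<lambda>g. g - mat 1) ` \<Gamma>)" using w(2) by (intro span_base) auto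
    moreover have "\<gamma> - mat 1 \<notin> span ((\<lambda>g. g - mat 1) ` \<Gamma>')" using zero[of "\<gamma> - mat 1"] w(3) by auto
    moreover have "span ((\<lambda>g. g - mat 1) ` \<Gamma>') \<subseteq> span ((\<lambda>g. g - mat 1) ` \<Gamma>)"
      by (intro span_mono) (auto simp: \<Gamma>'_def)
    ultimately have "dim ((\<lambda>g. g - mat 1) ` \<Gamma>') < dim ((\<lambda>g. g - mat 1) ` \<Gamma>)"
      by (intro dim_psubset) blast
    then obtain d \<phi>' where "parametrizes d \<phi>' \<Gamma>'" using less.hyps \<Gamma>' by blast
    then have "parametrizes (Suc d) (\<lambda>x. \<gamma> [^]\<^bsub>GL\<^esub> (x d) ** \<phi>' x) \<Gamma>"
      by (intro parametrizes_extend[OF less.prems w \<Gamma>'_def])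
    then show ?thesis by blast
  qed
qed

section \<open>From integers to S-integers\<close>

lemma int_in_S_integers: "of_int k \<in> S_integers S"
  by (rule S_integersI[of _ k 1]) auto

lemma int_div_in_S_integers:
  assumes "M \<noteq> 0" "\<And>l. Factorial_Ring.prime l \<Longrightarrow> int l dvd M \<Longrightarrow> l \<in> S"
  shows "of_int k / of_int M \<in> S_integers S"
  by (rule S_integersI[OF refl assms])

lemma rat_valuation_div:
  assumes "k \<noteq> 0" "M > 0" "Factorial_Ring.prime l" "\<not> int l dvd M"
  shows "rat_valuation l (of_int k / of_int M) = int (multiplicity (int l) k)"
proof -
  obtain n d where nd: "quotient_of (of_int k / of_int M) = (n, d)" by fastforce
  then have "of_int k / of_int M = (of_int n / of_int d :: rat)" "d > 0"
    by (auto dest: quotient_of_div quotient_of_denom_pos)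
  then have "of_int (k * d) = (of_int (n * M) :: rat)" using assms(2) by (simp add: field_simps)
  then have kd: "k * d = n * M" by (simp only: of_int_eq_iff)
  have "n \<noteq> 0" using kd assms(1) \<open>d > 0\<close> by auto
  have p: "prime_elem (int l)" using assms(3) by simp
  have "multiplicity (int l) (k * d) = multiplicity (int l) k + multiplicity (int l) d"
    using p assms(1) \<open>d > 0\<close> by (intro prime_elem_multiplicity_mult_distrib) auto
  moreover have "multiplicity (int l) (n * M) = multiplicity (int l) n + multiplicity (int l) M"
    using p assms(2) \<open>n \<noteq> 0\<close> by (intro prime_elem_multiplicity_mult_distrib) auto
  moreover have "multiplicity (int l) M = 0" using assms(4) by (rule not_dvd_imp_multiplicity_0)
  ultimately show ?thesis using kd by (simp add: rat_valuation_def nd)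
qed

lemma sum_multiplicities_le:
  assumes "k \<noteq> 0" "finite L" "\<And>l. l \<in> L \<Longrightarrow> Factorial_Ring.prime l \<and> l \<notin> S"
  shows "(\<Sum>l\<in>L. multiplicity (int l) k) \<le> num_prime_factors S k"
proof -
  let ?M = "filter_mset (\<lambda>l. nat l \<notin> S) (prime_factorization k)"
  have "(\<Sum>l\<in>L. multiplicity (int l) k) = (\<Sum>l\<in>L. count ?M (int l))"
    using assms(3) by (intro sum.cong) (auto simp: count_prime_factorization)
  also have "\<dots> = (\<Sum>q\<in>int ` L. count ?M q)" by (simp add: sum.reindex inj_on_def)
  also have "\<dots> \<le> (\<Sum>q\<in>int ` L \<union> set_mset ?M. count ?M q)"
    using assms(2) by (intro sum_mono2) auto
  also have "\<dots> = (\<Sum>q\<in>set_mset ?M. count ?M q)"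
    using assms(2) by (intro sum.mono_neutral_right) (auto simp: not_in_iff[symmetric])
  also have "\<dots> = num_prime_factors S k" by (simp add: num_prime_factors_def size_multiset_overloaded_eq)
  finally show ?thesis .
qed

lemma at_most_prime_factors_div:
  assumes "k \<noteq> 0" "M > 0" "\<And>l. Factorial_Ring.prime l \<Longrightarrow> int l dvd M \<Longrightarrow> l \<in> S" "num_prime_factors S k \<le> r"
  shows "at_most_prime_factors S r (of_int k / of_int M)"
proof -
  let ?q = "of_int k / of_int M :: rat"
  let ?L = "{l. Factorial_Ring.prime l \<and> l \<notin> S \<and> rat_valuation l ?q \<noteq> 0}"
  have q: "?q \<noteq> 0" using assms by simp
  have fin: "finite ?L" by (rule finite_subset[OF _ finite_rat_valuation_support[OF q]]) auto
  have "(\<Sum>l\<in>?L. rat_valuation l ?q) = (\<Sum>l\<in>?L. int (multiplicity (int l) k))"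
    using assms by (intro sum.cong refl rat_valuation_div) auto
  also have "\<dots> \<le> int (num_prime_factors S k)"
    unfolding of_nat_sum[symmetric] of_nat_le_iff using assms(1) fin by (intro sum_multiplicities_le) auto
  finally have "(\<Sum>l\<in>?L. rat_valuation l ?q) \<le> int r" using assms(4) by linarith
  moreover have "?q \<in> S_integers S" using assms by (intro int_div_in_S_integers) auto
  ultimately show ?thesis using q by (simp add: at_most_prime_factors_def)
qed

text \<open>
  The integers in the ideal generated by the values are the multiples of their least positive
  element \<open>g\<close>. It divides all \<open>k i\<close>, so its prime factors lie in \<open>S\<close> and \<open>g\<close> is a unit.
\<close>

lemma gcd_is_unit_div:
  assumes "finite I" "M > 0" "\<And>l. Factorial_Ring.prime l \<Longrightarrow> int l dvd M \<Longrightarrow> l \<in> S"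
    and k: "\<And>l. Factorial_Ring.prime l \<Longrightarrow> l \<notin> S \<Longrightarrow> \<exists>i\<in>I. \<not> int l dvd k i"
    and nz: "\<exists>i\<in>I. k i \<noteq> 0"
  shows "gcd_is_unit S ((\<lambda>i. of_int (k i) / of_int M) ` I)"
proof -
  let ?R = "S_integer_ring S" and ?Q = "(\<lambda>i. of_int (k i) / of_int M :: rat) ` I"
  interpret R: cring ?R by (rule cring_S_integer_ring)
  have ops: "carrier ?R = S_integers S" "x \<otimes>\<^bsub>?R\<^esub> y = x * y" "x \<oplus>\<^bsub>?R\<^esub> y = x + y" "\<one>\<^bsub>?R\<^esub> = 1" "\<zero>\<^bsub>?R\<^esub> = 0" for x y
    by (simp_all add: S_integer_ring_def)
  have Q: "?Q \<subseteq> S_integers S" using assms(2,3) by (auto intro: int_div_in_S_integers)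
  define J where "J = Idl\<^bsub>?R\<^esub> ?Q"
  have J: "ideal J ?R" unfolding J_def using Q by (intro R.genideal_ideal) (simp add: ops)
  have JQ: "?Q \<subseteq> J" unfolding J_def using Q by (intro R.genideal_self) (simp add: ops)
  have Jadd: "x + y \<in> J" if "x \<in> J" "y \<in> J" for x y
    using additive_subgroup.a_closed[OF ideal.axioms(1)[OF J] that] by (simp add: ops)
  have Jmult: "a * x \<in> J" if "x \<in> J" "a \<in> S_integers S" for a x
    using ideal.I_l_closed[OF J that(1)] that(2) by (simp add: ops)
  define H where "H = {j :: int. of_int j \<in> J}"
  have Hadd: "x + y \<in> H" if "x \<in> H" "y \<in> H" for x y using that Jadd by (simp add: H_def)
  have Hmult: "a * x \<in> H" if "x \<in> H" for a x using that Jmult int_in_S_integers by (simp add: H_def)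
  have kH: "k i \<in> H" if "i \<in> I" for i
  proof -
    have "of_int M * (of_int (k i) / of_int M) \<in> J" using JQ that by (intro Jmult int_in_S_integers) auto
    then show ?thesis using assms(2) by (simp add: H_def)
  qed
  obtain i0 where i0: "i0 \<in> I" "k i0 \<noteq> 0" using nz by blast
  have "\<exists>n. n > 0 \<and> int n \<in> H"
  proof (intro exI[of _ "nat \<bar>k i0\<bar>"] conjI)
    have "sgn (k i0) * k i0 \<in> H" by (intro Hmult kH i0)
    moreover have "sgn (k i0) * k i0 = \<bar>k i0\<bar>" by (simp only: abs_sgn[of "k i0"] mult.commute)
    moreover have "\<bar>k i0\<bar> = int (nat \<bar>k i0\<bar>)" by simp
    ultimately show "int (nat \<bar>k i0\<bar>) \<in> H" by (simp only:)
  qed (use i0 in simp)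
  define g where "g = (LEAST n. n > 0 \<and> int n \<in> H)"
  have g: "g > 0" "int g \<in> H" using LeastI_ex[OF \<open>\<exists>n. _ n\<close>] by (auto simp: g_def)
  have "int g dvd k i" if "i \<in> I" for i
  proof (rule ccontr)
    assume "\<not> int g dvd k i"
    then have "k i mod int g \<noteq> 0" by (simp add: dvd_eq_mod_eq_0)
    moreover have "k i mod int g \<ge> 0" using g(1) by simp
    ultimately have pos: "k i mod int g > 0" by linarith
    have "k i + - (k i div int g) * int g \<in> H" by (intro Hadd Hmult kH g that)
    then have "k i mod int g \<in> H" by (simp add: minus_div_mult_eq_mod)
    then have "0 < nat (k i mod int g) \<and> int (nat (k i mod int g)) \<in> H" using pos by simp
    then have "g \<le> nat (k i mod int g)" by (rule Least_le[of "\<lambda>n. 0 < n \<and> int n \<in> H", folded g_def])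
    moreover have "k i mod int g < int g" using g(1) by simp
    ultimately show False using pos by linarith
  qed
  then have "1 / of_int (int g) \<in> S_integers S"
    using g(1) k int_div_in_S_integers[of "int g" S 1] by (metis dvd_trans of_int_1 of_nat_0_less_iff order_less_irrefl)
  then have "1 / of_int (int g) * of_int (int g) \<in> J" using g(2) by (intro Jmult) (auto simp: H_def)
  then have "\<one>\<^bsub>?R\<^esub> \<in> J" using g(1) by (simp add: ops)
  then have "J = carrier ?R" using ideal.one_imp_carrier[OF J] by blast
  then show ?thesis using Q by (simp add: gcd_is_unit_def J_def)
qed

section \<open>Transfer between the group and integer points\<close>

text \<open>
  Complex regular functions on the group become complex combinations of rational polynomial functions.
\<close>

inductive_set complex_polyfuns :: "nat \<Rightarrow> ((nat \<Rightarrow> int) \<Rightarrow> complex) set"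
  for d :: nat
  where
    scaled: "p \<in> polys d \<Longrightarrow> (\<lambda>x. c * of_rat (eval p x)) \<in> complex_polyfuns d"
  | add: "u \<in> complex_polyfuns d \<Longrightarrow> v \<in> complex_polyfuns d \<Longrightarrow> (\<lambda>x. u x + v x) \<in> complex_polyfuns d"

lemma complex_polyfuns_mult:
  assumes "u \<in> complex_polyfuns d" "v \<in> complex_polyfuns d"
  shows "(\<lambda>x. u x * v x) \<in> complex_polyfuns d"
  using assms(1)
proof induction
  case (scaled p c)
  show ?case
    using assms(2)
  proof induction
    case (scaled q e)
    have "p * q \<in> polys d" using subring_ofD(5)[OF subring_of_polys] \<open>p \<in> polys d\<close> scaled by blast
    from complex_polyfuns.scaled[OF this, of "c * e"] show ?case by (simp add: of_rat_mult mult_ac)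
  next
    case (add u v)
    then show ?case using complex_polyfuns.add by (simp add: distrib_left)
  qed
next
  case (add u v)
  then show ?case using complex_polyfuns.add by (simp add: distrib_right)
qed

text \<open>
  This reduces the non-vanishing of complex regular functions, which define the Zariski topology, to the
  non-vanishing of rational polynomials.
\<close>

lemma rational_functional_of_complex_polyfun:
  assumes "u \<in> complex_polyfuns d"
    and "\<And>x y. \<psi> (x + y) = \<psi> x + \<psi> y" "\<And>q x. \<psi> (of_rat q * x) = q * \<psi> x"
  shows "\<exists>p\<in>polys d. \<forall>x. \<psi> (u x) = eval p x"
  using assms(1)
proof induction
  case (scaled p c)
  have "p * Const (\<psi> c) \<in> polys d" using subring_ofD(5)[OF subring_of_polys scaled] by simp
  moreover have "\<psi> (c * of_rat (eval p x)) = eval (p * Const (\<psi> c)) x" for x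
    using assms(3)[of "eval p x" c] by (simp add: mult.commute)
  ultimately show ?case by blast
next
  case (add u v)
  then obtain p q where "p \<in> polys d" "q \<in> polys d" "\<And>x. \<psi> (u x) = eval p x" "\<And>x. \<psi> (v x) = eval q x" by blast
  then show ?case
    using subring_ofD(3)[OF subring_of_polys] assms(2) by (intro bexI[of _ "p + q"]) auto
qed

locale parametrized_group = unipotent_matrix_group +
  fixes d :: nat and \<phi>
  assumes param: "parametrizes d \<phi> \<Gamma>"
begin

lemma \<phi>_in: "\<phi> x \<in> \<Gamma>"
  using param by (simp add: parametrizes_def)

lemma det_\<phi>: "det (\<phi> x) = 1"
  using unipotent_det_trace(1)[OF uni[OF \<phi>_in]] .

lemma pull_back_rational:
  assumes "f \<in> GL_regular \<rat>"
  shows "\<exists>p\<in>polys d. \<forall>x. f (\<phi> x) = of_rat (eval p x)"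
proof -
  have "(\<lambda>x. f (\<phi> x)) \<in> rational_polyfuns d"
    by (rule GL_regular_pullback[OF assms])
      (use param det_\<phi> in \<open>auto intro: rational_polyfuns_closed simp: parametrizes_def\<close>)
  then show ?thesis by (simp add: rational_polyfuns_def)
qed

lemma pull_back_complex:
  assumes "f \<in> GL_regular UNIV"
  shows "(\<lambda>x. f (\<phi> x)) \<in> complex_polyfuns d"
proof (rule GL_regular_pullback[OF assms])
  show "(\<lambda>_. c) \<in> complex_polyfuns d" for c
    using complex_polyfuns.scaled[of "Const 1" d c] by simp
  show "(\<lambda>x. \<phi> x $ i $ j) \<in> complex_polyfuns d" for i j
  proof -
    have "(\<lambda>x. \<phi> x $ i $ j) \<in> rational_polyfuns d" using param by (simp add: parametrizes_def)
    then obtain p where p: "p \<in> polys d" "\<And>x. \<phi> x $ i $ j = of_rat (eval p x)"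
      by (auto simp: rational_polyfuns_def)
    show ?thesis using complex_polyfuns.scaled[OF p(1), of 1] by (simp add: p(2))
  qed
qed (auto intro: complex_polyfuns.add complex_polyfuns_mult det_\<phi>)

lemma lift_polyfun:
  assumes "p \<in> polys d"
  shows "\<exists>f\<in>GL_regular \<rat>. \<forall>x. f (\<phi> x) = of_rat (eval p x)"
proof -
  have "eval p \<in> polyfuns d" using assms by (simp add: polys_def)
  then show ?thesis
  proof induction
    case (const c)
    then show ?case by (intro bexI[OF _ GL_regular.const[of "of_rat c"]]) auto
  next
    case (var i)
    then show ?case using param by (auto simp: parametrizes_def)
  next
    case (add u v)
    then obtain f g where fg: "f \<in> GL_regular \<rat>" "g \<in> GL_regular \<rat>"
      "\<And>x. f (\<phi> x) = of_rat (u x)" "\<And>x. g (\<phi> x) = of_rat (v x)" by blast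
    show ?case by (intro bexI[OF _ GL_regular.add[OF fg(1,2)]]) (simp add: fg of_rat_add)
  next
    case (mult u v)
    then obtain f g where fg: "f \<in> GL_regular \<rat>" "g \<in> GL_regular \<rat>"
      "\<And>x. f (\<phi> x) = of_rat (u x)" "\<And>x. g (\<phi> x) = of_rat (v x)" by blast
    show ?case by (intro bexI[OF _ GL_regular.mult[OF fg(1,2)]]) (simp add: fg of_rat_mult)
  qed
qed

lemma vanish_on_closure:
  assumes "zariski_dense_in \<Gamma> U" "f \<in> GL_regular UNIV" "\<And>x. f (\<phi> x) = 0" "A \<in> U"
  shows "f A = 0"
proof -
  let ?Z = "{A \<in> carrier GL. \<forall>f\<in>{f}. f A = 0}"
  have "zariski_closed_over UNIV ?Z"
    unfolding zariski_closed_over_def using assms(2) by (intro exI[of _ "{f}"]) simp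
  moreover have "f A = 0" if "A \<in> \<Gamma>" for A
    using param assms(2,3) that unfolding parametrizes_def by blast
  then have "\<Gamma> \<subseteq> ?Z" using subgroup.subset[OF sub] by auto
  ultimately have "U \<subseteq> ?Z" using assms(1) unfolding zariski_dense_in_def by blast
  then show ?thesis using assms(4) by auto
qed

lemma regular_eq_on_closure:
  assumes "zariski_dense_in \<Gamma> U" "f \<in> GL_regular \<rat>" "g \<in> GL_regular \<rat>" "\<And>x. f (\<phi> x) = g (\<phi> x)" "A \<in> U"
  shows "f A = g A"
proof -
  have "(\<lambda>A. f A + (-1) * g A) \<in> GL_regular UNIV"
    using assms(2,3) GL_regular_mono[of _ \<rat> UNIV]
    by (intro GL_regular.add GL_regular.mult GL_regular.const) auto
  from vanish_on_closure[OF assms(1) this _ assms(5)] show ?thesis using assms(4) by simp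
qed

text \<open>
  If a complex regular function does not vanish at some \<open>\<phi> x0\<close>, compose it with a functional that is
  linear over the rationals and does not vanish there. The result is a non-zero rational polynomial,
  which is non-zero at some \<open>x\<close> with \<open>\<phi> x \<in> D\<close>.
\<close>

lemma density_criterion:
  assumes "zariski_dense_in \<Gamma> U" "D \<subseteq> \<Gamma>"
    and dense: "\<And>h. h \<in> polys d \<Longrightarrow> h \<noteq> 0 \<Longrightarrow> \<exists>x. eval h x \<noteq> 0 \<and> \<phi> x \<in> D"
  shows "zariski_dense_in D U"
  unfolding zariski_dense_in_def
proof (intro conjI allI impI)
  show "D \<subseteq> U" using assms(1,2) by (auto simp: zariski_dense_in_def)
  fix Z :: "(complex^'a^'a) set" assume "zariski_closed_over UNIV Z" "D \<subseteq> Z"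
  then obtain F where F: "F \<subseteq> GL_regular UNIV" "Z = {A \<in> carrier GL. \<forall>f\<in>F. f A = 0}"
    by (auto simp: zariski_closed_over_def)
  have zero: "f (\<phi> x0) = 0" if f: "f \<in> F" for f x0
  proof (rule ccontr)
    assume "f (\<phi> x0) \<noteq> 0"
    then obtain \<psi> :: "complex \<Rightarrow> rat" where \<psi>: "\<And>x y. \<psi> (x + y) = \<psi> x + \<psi> y"
      "\<And>q x. \<psi> (of_rat q * x) = q * \<psi> x" "\<psi> (f (\<phi> x0)) = 1"
      by (rule rational_linear_functional) (rule that)
    have "f \<in> GL_regular UNIV" using F f by blast
    then obtain h where h: "h \<in> polys d" "\<And>x. \<psi> (f (\<phi> x)) = eval h x"
      using rational_functional_of_complex_polyfun[OF pull_back_complex \<psi>(1,2)] by blast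
    have "h \<noteq> 0" using h(2)[of x0] \<psi>(3) by auto
    then obtain x where x: "eval h x \<noteq> 0" "\<phi> x \<in> D" using dense h(1) by blast
    then have "f (\<phi> x) = 0" using \<open>D \<subseteq> Z\<close> F f by auto
    moreover have "\<psi> 0 = 0" using \<psi>(1)[of 0 0] by simp
    ultimately show False using h(2)[of x] x(1) by simp
  qed
  have "\<Gamma> \<subseteq> Z"
  proof
    fix A assume A: "A \<in> \<Gamma>"
    have "f A = 0" if "f \<in> F" for f
      using param zero[OF that] that F(1) A unfolding parametrizes_def by blast
    then show "A \<in> Z" using subgroup.mem_carrier[OF sub A] F(2) by auto
  qed
  then show "U \<subseteq> Z" using assms(1) \<open>zariski_closed_over UNIV Z\<close> unfolding zariski_dense_in_def by blast
qed

text \<open>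
  A common divisor of the polynomials lifts to a regular function, which divides the \<open>ps i\<close> in the
  coordinate ring because identities between regular functions extend from the parametrized points to
  the closure. So it divides \<open>1\<close> there, and this can be pulled back.
\<close>

lemma pull_back_coprime:
  assumes dense: "zariski_dense_in \<Gamma> U"
    and gcd: "is_gcd_of (Q_coord_ring U) \<one>\<^bsub>Q_coord_ring U\<^esub> (ps ` I)"
    and ps: "\<And>i. i \<in> I \<Longrightarrow> f i \<in> GL_regular \<rat> \<and> ps i = restrict (f i) U"
    and P: "\<And>i. i \<in> I \<Longrightarrow> P i \<in> polys d \<and> (\<forall>x. f i (\<phi> x) = of_rat (eval (P i) x))"
  shows "coprime_family (polys d) (P ` I)"
  unfolding coprime_family_def
proof (intro ballI impI)
  fix e assume e: "e \<in> polys d" "\<forall>g\<in>P ` I. dvd_in (polys d) e g"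
  have \<phi>U: "\<phi> x \<in> U" for x using \<phi>_in dense by (auto simp: zariski_dense_in_def)
  obtain e' where e': "e' \<in> GL_regular \<rat>" "\<And>x. e' (\<phi> x) = of_rat (eval e x)" using lift_polyfun[OF e(1)] by blast
  have carr: "restrict g U \<in> carrier (Q_coord_ring U)" if "g \<in> GL_regular \<rat>" for g
    using that by (simp add: Q_coord_ring_def)
  have "restrict e' U divides\<^bsub>Q_coord_ring U\<^esub> ps i" if i: "i \<in> I" for i
  proof -
    obtain k where k: "k \<in> polys d" "P i = e * k" using e(2) i by (auto simp: dvd_in_def)
    obtain k' where k': "k' \<in> GL_regular \<rat>" "\<And>x. k' (\<phi> x) = of_rat (eval k x)" using lift_polyfun[OF k(1)] by blast
    have "f i A = e' A * k' A" if "A \<in> U" for A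
      by (rule regular_eq_on_closure[OF dense _ GL_regular.mult[OF e'(1) k'(1)] _ that])
        (use ps[OF i] P[OF i] in \<open>auto simp: e'(2) k'(2) k(2) of_rat_mult\<close>)
    then have "ps i = restrict e' U \<otimes>\<^bsub>Q_coord_ring U\<^esub> restrict k' U"
      using ps[OF i] by (auto simp: Q_coord_ring_def fun_eq_iff)
    then show ?thesis using carr[OF k'(1)] unfolding factor_def by blast
  qed
  moreover have "ps ` I \<subseteq> carrier (Q_coord_ring U)" using ps carr by auto
  ultimately have "restrict e' U divides\<^bsub>Q_coord_ring U\<^esub> \<one>\<^bsub>Q_coord_ring U\<^esub>"
    using gcd carr[OF e'(1)] by (auto simp: is_gcd_of_iff)
  then obtain c where c: "c \<in> GL_regular \<rat>" "(\<lambda>A\<in>U. 1) = (\<lambda>A\<in>U. restrict e' U A * restrict c U A)"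
    by (auto simp: factor_def Q_coord_ring_def)
  obtain c' where c': "c' \<in> polys d" "\<And>x. c (\<phi> x) = of_rat (eval c' x)" using pull_back_rational[OF c(1)] by blast
  have "eval (e * c') x = 1" for x
  proof -
    have "1 = e' (\<phi> x) * c (\<phi> x)" using fun_cong[OF c(2), of "\<phi> x"] \<phi>U by simp
    then have "of_rat (eval (e * c') x) = (of_rat 1 :: complex)" by (simp add: e'(2) c'(2) of_rat_mult)
    then show ?thesis by (simp only: of_rat_eq_iff)
  qed
  then have "e * c' = 1" by (intro polyfun_eqI) (simp only: eval_simps)
  then show "unit_in (polys d) e" using e(1) c'(1) by (auto simp: unit_in_def)
qed

end

lemma to_rat_of_rat: "to_rat (of_rat q) = q"
  using of_rat_to_rat[of "of_rat q"] by simp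

lemma coprime_family_scale:
  assumes "coprime_family (polys d) F" "c \<noteq> 0"
  shows "coprime_family (polys d) ((\<lambda>g. Const c * g) ` F)"
  unfolding coprime_family_def
proof (intro ballI impI)
  fix e assume e: "e \<in> polys d" "\<forall>g\<in>(\<lambda>g. Const c * g) ` F. dvd_in (polys d) e g"
  have "dvd_in (polys d) e g" if "g \<in> F" for g
  proof -
    obtain k where k: "k \<in> polys d" "Const c * g = e * k" using e(2) \<open>g \<in> F\<close> by (auto simp: dvd_in_def)
    have "Const (1 / c) * Const c = 1" using assms(2) by (intro polyfun_eqI) simp
    then have "g = Const (1 / c) * (Const c * g)" by (simp flip: mult.assoc)
    then have "g = e * (Const (1 / c) * k)" unfolding k(2) by (simp add: mult_ac)
    moreover have "Const (1 / c) * k \<in> polys d" using k(1) subring_ofD(5)[OF subring_of_polys] by simp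
    ultimately show ?thesis by (auto simp: dvd_in_def)
  qed
  then show "unit_in (polys d) e" using assms(1) e(1) by (auto simp: coprime_family_def)
qed

theorem theorem4:
  fixes U \<Gamma> :: "(complex^'n^'n) set"
    and p :: "complex^'n^'n \<Rightarrow> complex"
    and ps :: "nat \<Rightarrow> complex^'n^'n \<Rightarrow> complex"
    and m :: nat
  assumes "unipotent_Q_group U"
    and "finitely_generated_subgroup \<Gamma> GL"
    and "\<Gamma> \<subseteq> rational_points U"
    and "zariski_dense_in \<Gamma> U"
    and "p \<in> carrier (Q_coord_ring U)"
    and "\<And>i. i \<in> {1..m} \<Longrightarrow> ps i \<in> carrier (Q_coord_ring U)"
    and "p \<noteq> \<zero>\<^bsub>Q_coord_ring U\<^esub>"
    and "is_gcd_of (Q_coord_ring U) \<one>\<^bsub>Q_coord_ring U\<^esub> (ps ` {1..m})"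
  shows "\<exists>(S :: nat set) (r :: nat).
    finite S \<and> (\<forall>l\<in>S. Factorial_Ring.prime l) \<and> r > 0 \<and>
    zariski_dense_in
      {\<gamma> \<in> \<Gamma>. at_most_prime_factors S r (to_rat (p \<gamma>)) \<and>
                gcd_is_unit S ((\<lambda>i. to_rat (ps i \<gamma>)) ` {1..m})}
      U"
proof -
  have "unipotent_matrix_group \<Gamma>"
    by (rule unipotent_matrix_group.intro)
      (use assms(1-3) in \<open>auto simp: finitely_generated_subgroup_def rational_points_def unipotent_Q_group_def\<close>)
  then obtain d \<phi> where "parametrized_group \<Gamma> d \<phi>"
    using parametrization_exists by (metis parametrized_group.intro parametrized_group_axioms.intro)
  then interpret parametrized_group \<Gamma> d \<phi> .
  note dense = assms(4)
  have \<phi>U: "\<phi> x \<in> U" for x using \<phi>_in dense by (auto simp: zariski_dense_in_def)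
  obtain f where f: "f \<in> GL_regular \<rat>" "p = restrict f U" using assms(5) by (auto simp: Q_coord_ring_def)
  obtain P where P: "P \<in> polys d" "\<And>x. f (\<phi> x) = of_rat (eval P x)" using pull_back_rational[OF f(1)] by blast
  have "P \<noteq> 0"
  proof
    assume "P = 0"
    then have "f A = 0" if "A \<in> U" for A
      using vanish_on_closure[OF dense GL_regular_mono[OF f(1)] _ that] P(2) by simp
    then have "p = (\<lambda>A\<in>U. 0)" unfolding f(2) by (rule restrict_ext)
    then show False using assms(7) by (simp add: Q_coord_ring_def)
  qed
  have "\<exists>g. \<forall>i\<in>{1..m}. g i \<in> GL_regular \<rat> \<and> ps i = restrict (g i) U"
  proof (intro bchoice ballI)
    fix i assume "i \<in> {1..m}"
    then have "ps i \<in> (\<lambda>g. restrict g U) ` GL_regular \<rat>"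
      using assms(6) by (simp only: Q_coord_ring_def partial_object.simps)
    then show "\<exists>g. g \<in> GL_regular \<rat> \<and> ps i = restrict g U" by blast
  qed
  then obtain g where g: "\<And>i. i \<in> {1..m} \<Longrightarrow> g i \<in> GL_regular \<rat> \<and> ps i = restrict (g i) U" by blast
  have "\<exists>G. \<forall>i\<in>{1..m}. G i \<in> polys d \<and> (\<forall>x. g i (\<phi> x) = of_rat (eval (G i) x))"
    using g pull_back_rational by (intro bchoice) blast
  then obtain G where G: "\<And>i. i \<in> {1..m} \<Longrightarrow> G i \<in> polys d \<and> (\<forall>x. g i (\<phi> x) = of_rat (eval (G i) x))" by blast
  have cop: "coprime_family (polys d) (G ` {1..m})"
    by (rule pull_back_coprime[OF dense assms(8) g G])
  obtain M :: int where M: "M > 0" "\<And>h. h \<in> insert P (G ` {1..m}) \<Longrightarrow> int_valued (Const (of_int M) * h)"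
    using common_denominator[of "insert P (G ` {1..m})"] by auto
  let ?M = "Const (of_int M)"
  let ?F = "(\<lambda>h. ?M * h) ` (G ` {1..m})"
  have mult: "?M * h \<in> polys d" if "h \<in> polys d" for h using that subring_ofD(5)[OF subring_of_polys] by simp
  have "?M \<noteq> 0" using M(1) by (metis eval_Const eval_simps(1) less_irrefl of_int_eq_0_iff)
  then have MP: "?M * P \<noteq> 0" using \<open>P \<noteq> 0\<close> by simp
  have copM: "coprime_family (polys d) ?F" using coprime_family_scale[OF cop] M(1) by simp
  have IVF: "\<forall>h\<in>?F. int_valued h" using M(2) by auto
  have F: "?F \<subseteq> polys d" using G mult by auto
  have finF: "finite ?F" by simp
  note sv = sievable[of d, unfolded sievable_def, THEN spec[of _ "?M * P"], THEN spec[of _ ?F], THEN mp, OF mult[OF P(1)],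
      THEN mp, OF MP, THEN mp, OF M(2), OF insertI1, THEN mp, OF finF, THEN mp, OF F, THEN mp, OF IVF, THEN mp, OF copM]
  from sv obtain S0 r0 where S0: "finite S0" "\<forall>l\<in>S0. Factorial_Ring.prime l"
    and sieve: "\<forall>h\<in>polys d. h \<noteq> 0 \<longrightarrow> (\<exists>x. eval h x \<noteq> 0 \<and> sieved S0 r0 (?M * P) ?F x)"
    by (elim exE conjE)
  define S where "S = S0 \<union> {l. Factorial_Ring.prime l \<and> int l dvd M}"
  have S: "finite S" "\<forall>l\<in>S. Factorial_Ring.prime l" "S0 \<subseteq> S" "\<And>l. Factorial_Ring.prime l \<Longrightarrow> int l dvd M \<Longrightarrow> l \<in> S"
    using S0 M(1) finite_prime_divisors[of M] by (auto simp: S_def)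
  let ?D = "{\<gamma> \<in> \<Gamma>. at_most_prime_factors S (Suc r0) (to_rat (p \<gamma>)) \<and>
                gcd_is_unit S ((\<lambda>i. to_rat (ps i \<gamma>)) ` {1..m})}"
  have scaled_value: "eval h x = of_int (int_eval (?M * h) x) / of_int M" if "h \<in> insert P (G ` {1..m})" for h x
    using of_int_int_eval[OF M(2)[OF that], of x] M(1) by simp
  have sieved_D: "\<phi> x \<in> ?D" if x: "sieved S0 r0 (?M * P) ?F x" for x
  proof -
    have "to_rat (p (\<phi> x)) = of_int (int_eval (?M * P) x) / of_int M"
      using scaled_value[of P x] P(2) f(2) \<phi>U by (simp add: to_rat_of_rat)
    moreover have "num_prime_factors S (int_eval (?M * P) x) \<le> Suc r0"
      using num_prime_factors_antimono[OF S(3), of "int_eval (?M * P) x"] x by (simp add: sieved_def)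
    ultimately have 1: "at_most_prime_factors S (Suc r0) (to_rat (p (\<phi> x)))"
      using at_most_prime_factors_div[of "int_eval (?M * P) x" M S "Suc r0"] x M(1) S(4) by (simp add: sieved_def)
    have nd: "\<exists>i\<in>{1..m}. \<not> int l dvd int_eval (?M * G i) x" if "Factorial_Ring.prime l" "l \<notin> S" for l
      using x that S(3) unfolding sieved_def by blast
    obtain l where "Factorial_Ring.prime l" "l \<notin> S"
      using primes_infinite S(1) by (metis finite_subset mem_Collect_eq subsetI)
    from nd[OF this] have nz: "\<exists>i\<in>{1..m}. int_eval (?M * G i) x \<noteq> 0" by (metis dvd_0_right)
    have "(\<lambda>i. to_rat (ps i (\<phi> x))) ` {1..m} = (\<lambda>i. of_int (int_eval (?M * G i) x) / of_int M) ` {1..m}"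
    proof (intro image_cong refl)
      fix i assume i: "i \<in> {1..m}"
      show "to_rat (ps i (\<phi> x)) = of_int (int_eval (?M * G i) x) / of_int M"
        using scaled_value[of "G i" x] i g[OF i] G[OF i] \<phi>U by (simp add: to_rat_of_rat)
    qed
    then have 2: "gcd_is_unit S ((\<lambda>i. to_rat (ps i (\<phi> x))) ` {1..m})"
      using gcd_is_unit_div[of "{1..m}" M S "\<lambda>i. int_eval (?M * G i) x"] M(1) S(4) nd nz by simp
    show ?thesis using 1 2 \<phi>_in by simp
  qed
  have "zariski_dense_in ?D U"
    by (rule density_criterion[OF dense]) (use sieve sieved_D in blast)+
  then show ?thesis using S(1,2) by (intro exI[of _ S] exI[of _ "Suc r0"]) simp
qed

end
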